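(* Let $r\ge 2$ and let $\lambda=(a_1,\dots,a_r)$ be integers with $a_1>a_2>\cdots>a_{r-1}>a_r=0$. Put $d(\lambda)=\gcd(a_1,\dots,a_r)$ and $\rho=(r-1,r-2,\dots,1,0)$. For a tuple $\mu=(b_1,\dots,b_r)$ of non-negative integers let $S(\mu)=\det\big(x_i^{b_j}\big)_{1\le i,j\le r}\in\mathbb{C}[x_1,\dots,x_r]$, and for a positive integer $d$ write $d\rho=(d(r-1),d(r-2),\dots,d,0)$. If $\lambda\neq d(\lambda)\rho$, then the polynomial $C(\lambda)=S(\lambda)/S(d(\lambda)\rho)$ (which is a symmetric polynomial) is irreducible in the ring $\mathbb{C}[x_1,\dots,x_r]$.
   Context: $S(d\rho)=\prod_{i<j}(x_i^d-x_j^d)$ divides $S(\lambda)$ when $d\mid d(\lambda)$, so $C(\lambda)$ is a polynomial. Irreducible means: not a unit and not a product of two non-units. *)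

theory Defs
  imports Complex_Main "HOL-Library.Poly_Mapping" "HOL-Combinatorics.Permutations"
begin

text \<open>Multivariate polynomials over the complex numbers in variables x_0, x_1, ...:
  a polynomial maps monomials (exponent vectors nat =>0 nat) to complex coefficients.
  The ring C[x_1,...,x_r] is the subring of polynomials whose variables lie in {..<r}
  (0-based indexing).\<close>

type_synonym mpoly = "(nat \<Rightarrow>\<^sub>0 nat) \<Rightarrow>\<^sub>0 complex"

definition Var :: "nat \<Rightarrow> mpoly" where
  "Var i = Poly_Mapping.single (Poly_Mapping.single i 1) 1"

definition vars :: "mpoly \<Rightarrow> nat set" where
  "vars p = {i::nat. \<exists>m::nat \<Rightarrow>\<^sub>0 nat. m \<in> Poly_Mapping.keys p \<and> i \<in> Poly_Mapping.keys m}"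

definition in_ring :: "nat \<Rightarrow> mpoly \<Rightarrow> bool" where
  "in_ring r p \<longleftrightarrow> vars p \<subseteq> {..<r}"

definition unit_in :: "nat \<Rightarrow> mpoly \<Rightarrow> bool" where
  "unit_in r p \<longleftrightarrow> (\<exists>q. in_ring r q \<and> p * q = 1)"

definition irreducible_in :: "nat \<Rightarrow> mpoly \<Rightarrow> bool" where
  "irreducible_in r p \<longleftrightarrow> in_ring r p \<and> \<not> unit_in r p \<and>
     (\<forall>g h. in_ring r g \<and> in_ring r h \<and> p = g * h \<longrightarrow> unit_in r g \<or> unit_in r h)"

text \<open>S(mu) = det (x_i^(b_j)) for i, j < r, via the Leibniz formula.\<close>
definition S :: "nat \<Rightarrow> (nat \<Rightarrow> nat) \<Rightarrow> mpoly" where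
  "S r b = (\<Sum>\<sigma> | \<sigma> permutes {..<r}. of_int (sign \<sigma>) * (\<Prod>i<r. Var i ^ b (\<sigma> i)))"

definition drho :: "nat \<Rightarrow> nat \<Rightarrow> nat \<Rightarrow> nat" where
  "drho r d j = d * (r - 1 - j)"

end

theory Submission
  imports Defs "Jordan_Normal_Form.Determinant" "HOL-Computational_Algebra.Fundamental_Theorem_Algebra"
begin

text \<open>
  Induction on the number of variables. If C(lambda) = G H, then setting one variable to zero, or
  taking the leading coefficient in one variable, gives a factorisation of the polynomial of a
  shorter exponent vector, up to explicit linear factors x_u - z x_v (z a root of unity) and powers
  of variables. By induction one of the two factors becomes, up to a constant, a product of such
  linear factors. If the inner exponents are spread widely enough, evaluation at roots of unity
  shows that the same factor is degenerate for all variables and both operations, and hence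
  constant. Otherwise the inner exponents form an arithmetic progression as tight as possible, up
  to the duality x_i to 1/x_i. Then one factor restricts on x_n = 0 to a complete homogeneous
  symmetric polynomial in the x_i^D, and comparing absolute values of roots, or orders of
  vanishing, gives a contradiction. The base case of three variables uses the double roots
  of trinomials and a Bezout identity.
\<close>

section \<open>Evaluation of polynomials\<close>

text \<open>The induction hypothesis sees only specialisations, and these may have a larger gcd than
  d: d' on x_n = 0, d'' for the leading coefficient in x_n. The surplus roots of unity are the
  source of the linear factors, and nothing tells how these are shared out between G and H. The two
  kinds of specialisation are therefore linked: x_j = 0 commutes with the leading coefficient in x_i
  where the result is nonzero. After both, the exponents a_1, ..., a_{n-1} remain. With N = a_1 -
  a_{n-1}, the columns of a_1 and a_{n-1} agree at 1, w, ..., w^(n-2), w of order N, so the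
  determinant vanishes, while all linear factors survive as soon as (n-1) d' and (n-1) d'' are at
  most N. This is the required spread. If it fails for e = d' or d'', then n-1 exponents congruent
  mod e span less than (n-1) e, which leaves only a progression of step e. There h_{c-1}(1, 1, s)
  has constant term c and leading coefficient 1, hence for c > 1 a root outside the unit
  disc.\<close>

class complex_alg = comm_ring_1 +
  fixes emb :: "complex \<Rightarrow> 'a"
  assumes emb_add: "emb (a + b) = emb a + emb b"
    and emb_mult: "emb (a * b) = emb a * emb b"
    and emb_1 [simp]: "emb 1 = 1"

lemma emb_0 [simp]: "emb 0 = (0 :: 'a :: complex_alg)"
  using emb_add[of 0 0, where 'a='a] by simp

lemma emb_minus: "emb (- c) = - (emb c :: 'a :: complex_alg)"
  using emb_add[of c "- c", where 'a='a] by (intro minus_unique[symmetric]) simp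

lemma emb_diff: "emb (a - b) = emb a - (emb b :: 'a :: complex_alg)"
  using emb_add[of a "- b", where 'a='a] by (simp add: emb_minus)

lemma emb_power: "emb (c ^ n) = (emb c :: 'a :: complex_alg) ^ n"
  by (induction n) (auto simp: emb_mult)

lemma emb_of_nat: "emb (of_nat n) = (of_nat n :: 'a :: complex_alg)"
  by (induction n) (auto simp: emb_add)

lemma emb_of_int: "emb (of_int n) = (of_int n :: 'a :: complex_alg)"
  by (cases n) (auto simp: emb_of_nat emb_minus emb_diff)

instantiation complex :: complex_alg
begin
definition emb_complex :: "complex \<Rightarrow> complex" where "emb_complex c = c"
instance by standard (auto simp: emb_complex_def)
end

instantiation poly :: (complex_alg) complex_alg
begin
definition emb_poly :: "complex \<Rightarrow> 'a poly" where "emb_poly c = [:emb c:]"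
instance by standard (auto simp: emb_poly_def emb_add emb_mult one_pCons)
end

instantiation poly_mapping :: (comm_monoid_add, complex_alg) complex_alg
begin
definition emb_poly_mapping :: "complex \<Rightarrow> 'a \<Rightarrow>\<^sub>0 'b" where
  "emb_poly_mapping c = Poly_Mapping.single 0 (emb c)"
instance by standard (auto simp: emb_poly_mapping_def emb_add emb_mult single_add mult_single)
end

lemma emb_complex [simp]: "emb c = (c :: complex)"
  by (simp add: emb_complex_def)

lemma emb_nonzero_iff [simp]:
  "(emb c :: 'a :: {complex_alg, zero_neq_one}) = 0 \<longleftrightarrow> c = 0"
proof
  assume *: "(emb c :: 'a) = 0"
  show "c = 0"
  proof (rule ccontr)
    assume "c \<noteq> 0"
    hence "(1 :: 'a) = emb c * emb (1 / c)"
      by (simp flip: emb_mult)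
    thus False using * by simp
  qed
qed auto

text \<open>Evaluations, coefficientwise maps, specialisations and permutations of variables are all
  homomorphisms of complex algebras, so one list of rules serves them all.\<close>

definition ahom :: "('a :: complex_alg \<Rightarrow> 'b :: complex_alg) \<Rightarrow> bool" where
  "ahom \<phi> \<longleftrightarrow> (\<forall>x y. \<phi> (x + y) = \<phi> x + \<phi> y) \<and> (\<forall>x y. \<phi> (x * y) = \<phi> x * \<phi> y)
     \<and> (\<forall>c. \<phi> (emb c) = emb c)"

lemma ahomI:
  assumes "\<And>x y. \<phi> (x + y) = \<phi> x + \<phi> y" "\<And>x y. \<phi> (x * y) = \<phi> x * \<phi> y" "\<And>c. \<phi> (emb c) = emb c"
  shows "ahom \<phi>"
  using assms by (auto simp: ahom_def)

lemma
  assumes "ahom \<phi>"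
  shows ahom_add: "\<phi> (x + y) = \<phi> x + \<phi> y" and ahom_mult: "\<phi> (x * y) = \<phi> x * \<phi> y"
    and ahom_emb: "\<phi> (emb c) = emb c" and ahom_0: "\<phi> 0 = 0" and ahom_1: "\<phi> 1 = 1"
    and ahom_minus: "\<phi> (- x) = - \<phi> x" and ahom_diff: "\<phi> (x - y) = \<phi> x - \<phi> y"
    and ahom_power: "\<phi> (x ^ n) = \<phi> x ^ n"
    and ahom_sum: "\<phi> (sum f A) = (\<Sum>a\<in>A. \<phi> (f a))"
    and ahom_prod: "\<phi> (prod f A) = (\<Prod>a\<in>A. \<phi> (f a))"
    and ahom_of_int: "\<phi> (of_int k) = of_int k"
proof -
  note a = assms[unfolded ahom_def]
  show add: "\<phi> (x + y) = \<phi> x + \<phi> y" for x y using a by blast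
  show mult: "\<phi> (x * y) = \<phi> x * \<phi> y" for x y using a by blast
  show e: "\<phi> (emb c) = emb c" for c using a by blast
  show zero: "\<phi> 0 = 0" using e[of 0] by simp
  show one: "\<phi> 1 = 1" using e[of 1] by simp
  show minus: "\<phi> (- x) = - \<phi> x" for x
    using add[of x "-x"] zero by (intro minus_unique[symmetric]) simp
  show "\<phi> (x - y) = \<phi> x - \<phi> y" using add[of x "-y"] minus by simp
  show "\<phi> (x ^ n) = \<phi> x ^ n" by (induction n) (auto simp: one mult)
  show "\<phi> (sum f A) = (\<Sum>a\<in>A. \<phi> (f a))"
    by (induction A rule: infinite_finite_induct) (auto simp: zero add)
  show "\<phi> (prod f A) = (\<Prod>a\<in>A. \<phi> (f a))"
    by (induction A rule: infinite_finite_induct) (auto simp: one mult)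
  show "\<phi> (of_int k) = of_int k" using e[of "of_int k"] by (simp add: emb_of_int)
qed

lemma ahom_comp: "ahom \<phi> \<Longrightarrow> ahom \<psi> \<Longrightarrow> ahom (\<lambda>x. \<phi> (\<psi> x))"
  by (auto simp: ahom_def)

lemma ahom_poly: "ahom (\<lambda>p. poly p (x :: 'a :: complex_alg))"
  by (auto simp: ahom_def emb_poly_def)

lemma ahom_map_poly:
  assumes "ahom \<phi>" shows "ahom (map_poly \<phi>)"
proof -
  note h = ahom_add[OF assms] ahom_mult[OF assms] ahom_0[OF assms] ahom_sum[OF assms] ahom_emb[OF assms]
  have c: "coeff (map_poly \<phi> p) n = \<phi> (coeff p n)" for p n
    by (simp add: coeff_map_poly h)
  show ?thesis
    by (rule ahomI; rule poly_eqI; (simp only: c coeff_add coeff_mult h)?)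
       (auto simp: c emb_poly_def h coeff_pCons split: nat.splits)
qed

definition mval :: "(nat \<Rightarrow> 'a :: comm_ring_1) \<Rightarrow> (nat \<Rightarrow>\<^sub>0 nat) \<Rightarrow> 'a" where
  "mval y m = (\<Prod>i\<in>Poly_Mapping.keys m. y i ^ Poly_Mapping.lookup m i)"

lemma mval_superset:
  assumes "finite A" "Poly_Mapping.keys m \<subseteq> A"
  shows "mval y m = (\<Prod>i\<in>A. y i ^ Poly_Mapping.lookup m i)"
  unfolding mval_def using assms
  by (intro prod.mono_neutral_left) (auto simp: in_keys_iff)

lemma mval_0 [simp]: "mval y 0 = 1"
  by (simp add: mval_def)

lemma mval_add: "mval y (m + n) = mval y m * mval y n"
proof -
  let ?A = "Poly_Mapping.keys m \<union> Poly_Mapping.keys n"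
  have "Poly_Mapping.keys (m + n) \<subseteq> ?A" by (rule Poly_Mapping.keys_add)
  thus ?thesis
    by (simp add: mval_superset[of ?A] prod.distrib[symmetric] lookup_add power_add)
qed

text \<open>The target is an arbitrary complex algebra: this covers points with complex coordinates,
  substitution of polynomials, and points over \<open>complex poly\<close>, that is, parametrised
  curves.\<close>

definition ev :: "(nat \<Rightarrow> 'a :: complex_alg) \<Rightarrow> mpoly \<Rightarrow> 'a" where
  "ev y P = (\<Sum>m\<in>Poly_Mapping.keys P. emb (Poly_Mapping.lookup P m) * mval y m)"

lemma ev_superset:
  assumes "finite A" "Poly_Mapping.keys P \<subseteq> A"
  shows "ev y P = (\<Sum>m\<in>A. emb (Poly_Mapping.lookup P m) * mval y m)"
  unfolding ev_def using assms
  by (intro sum.mono_neutral_left) (auto simp: in_keys_iff)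

lemma ev_add: "ev y (P + Q) = ev y P + ev y Q"
proof -
  let ?A = "Poly_Mapping.keys P \<union> Poly_Mapping.keys Q"
  have "Poly_Mapping.keys (P + Q) \<subseteq> ?A" by (rule Poly_Mapping.keys_add)
  thus ?thesis
    by (simp add: ev_superset[of ?A] sum.distrib[symmetric] lookup_add emb_add ring_distribs)
qed

lemma ev_0 [simp]: "ev y 0 = 0" by (simp add: ev_def)

lemma ev_sum: "ev y (sum f A) = (\<Sum>a\<in>A. ev y (f a))"
  by (induction A rule: infinite_finite_induct) (auto simp: ev_add)

lemma ev_single: "ev y (Poly_Mapping.single m c) = emb c * mval y m"
  by (cases "c = 0") (simp_all add: ev_def)

lemma mpoly_sum_single: "(P :: mpoly) = (\<Sum>m\<in>Poly_Mapping.keys P. Poly_Mapping.single m (Poly_Mapping.lookup P m))"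
  by (rule poly_mapping_eqI)
     (auto simp: lookup_sum lookup_single when_def in_keys_iff)

lemma ev_mult: "ev y (P * Q) = ev y P * ev y Q"
proof -
  let ?s = Poly_Mapping.single and ?l = Poly_Mapping.lookup and ?k = Poly_Mapping.keys
  have "P * Q = (\<Sum>m\<in>?k P. ?s m (?l P m)) * (\<Sum>n\<in>?k Q. ?s n (?l Q n))"
    by (simp flip: mpoly_sum_single)
  also have "\<dots> = (\<Sum>m\<in>?k P. \<Sum>n\<in>?k Q. ?s (m + n) (?l P m * ?l Q n))"
    by (simp add: sum_product mult_single)
  also have "ev y \<dots> = (\<Sum>m\<in>?k P. \<Sum>n\<in>?k Q. (emb (?l P m) * mval y m) * (emb (?l Q n) * mval y n))"
    by (simp add: ev_sum ev_single emb_mult mval_add mult_ac)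
  also have "\<dots> = ev y P * ev y Q"
    by (simp add: ev_def sum_product)
  finally show ?thesis .
qed

lemma ev_emb [simp]: "ev y (emb c) = emb c"
  by (simp add: emb_poly_mapping_def ev_single)

lemma ahom_ev: "ahom (ev y)"
  by (rule ahomI) (auto simp: ev_add ev_mult)

lemma ev_Var [simp]: "ev y (Var i) = y i"
  by (simp add: Var_def ev_single mval_def)

lemmas ev_simps = ahom_add[OF ahom_ev] ahom_mult[OF ahom_ev] ahom_0[OF ahom_ev] ahom_1[OF ahom_ev]
  ahom_minus[OF ahom_ev] ahom_diff[OF ahom_ev] ahom_power[OF ahom_ev] ahom_sum[OF ahom_ev]
  ahom_prod[OF ahom_ev] ahom_of_int[OF ahom_ev]

lemma single_eq_mval: "Poly_Mapping.single m c = emb c * mval Var m"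
proof -
  have pow: "Var i ^ n = Poly_Mapping.single (Poly_Mapping.single i n) 1" for i n
  proof (induction n)
    case (Suc n)
    thus ?case by (simp add: Var_def mult_single flip: single_add)
  qed simp
  have prd: "(\<Prod>i\<in>A. Poly_Mapping.single (f i) (1::complex)) = Poly_Mapping.single (\<Sum>i\<in>A. f i) 1"
    for A and f :: "nat \<Rightarrow> nat \<Rightarrow>\<^sub>0 nat"
    by (induction A rule: infinite_finite_induct) (auto simp: mult_single)
  have "(\<Sum>i\<in>Poly_Mapping.keys m. Poly_Mapping.single i (Poly_Mapping.lookup m i)) = m"
    by (rule poly_mapping_eqI) (auto simp: lookup_sum lookup_single when_def in_keys_iff)
  thus ?thesis
    by (simp add: mval_def pow prd emb_poly_mapping_def mult_single)
qed

text \<open>Constants and variables generate the ring. Two homomorphisms therefore agree once they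
  agree on the variables that occur.\<close>

lemma mpoly_induct [consumes 1, case_names emb Var add mult]:
  assumes "vars P \<subseteq> V"
    and emb: "\<And>c. Q (emb c)" and Var: "\<And>i. i \<in> V \<Longrightarrow> Q (Var i)"
    and add: "\<And>A B. Q A \<Longrightarrow> Q B \<Longrightarrow> Q (A + B)" and mult: "\<And>A B. Q A \<Longrightarrow> Q B \<Longrightarrow> Q (A * B)"
  shows "Q P"
proof -
  have pow: "Q (X ^ n)" if "Q X" for X n
    using that emb[of 1] by (induction n) (auto intro: mult)
  have prd: "Q (prod f A)" if "\<And>a. a \<in> A \<Longrightarrow> Q (f a)" for A and f :: "nat \<Rightarrow> mpoly"
    using that emb[of 1] by (induction A rule: infinite_finite_induct) (auto intro: mult)
  have sm: "Q (sum f A)" if "\<And>a. a \<in> A \<Longrightarrow> Q (f a)" for A and f :: "(nat \<Rightarrow>\<^sub>0 nat) \<Rightarrow> mpoly"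
    using that emb[of 0] by (induction A rule: infinite_finite_induct) (auto intro: add)
  have "Q (Poly_Mapping.single m (Poly_Mapping.lookup P m))" if "m \<in> Poly_Mapping.keys P" for m
  proof -
    have "Poly_Mapping.keys m \<subseteq> V" using that assms(1) by (auto simp: vars_def)
    thus ?thesis unfolding single_eq_mval mval_def by (intro mult emb prd pow Var) auto
  qed
  hence "Q (\<Sum>m\<in>Poly_Mapping.keys P. Poly_Mapping.single m (Poly_Mapping.lookup P m))"
    by (rule sm)
  thus ?thesis by (simp flip: mpoly_sum_single)
qed

lemma ahom_ev_comp: "ahom \<phi> \<Longrightarrow> \<phi> (ev y P) = ev (\<lambda>i. \<phi> (y i)) P"
  by (simp add: ev_def mval_def ahom_sum ahom_mult ahom_emb ahom_prod ahom_power)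

lemma ev_Var_id [simp]: "ev Var P = P"
  using subset_refl[of "vars P"] by (induction rule: mpoly_induct) (auto simp: ev_simps)

lemma ev_ev: "ev y (ev z P) = ev (\<lambda>i. ev y (z i)) P"
  by (rule ahom_ev_comp[OF ahom_ev])

lemma ev_cong:
  assumes "\<And>i. i \<in> vars P \<Longrightarrow> y i = z i" shows "ev y P = ev z P"
  using subset_refl[of "vars P"] by (induction rule: mpoly_induct) (auto simp: ev_simps assms)

lemma vars_add: "vars P \<subseteq> V \<Longrightarrow> vars Q \<subseteq> V \<Longrightarrow> vars (P + Q) \<subseteq> V"
  using Poly_Mapping.keys_add[of P Q] unfolding vars_def by blast

lemma vars_mult:
  assumes "vars P \<subseteq> V" "vars Q \<subseteq> V" shows "vars (P * Q) \<subseteq> V"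
proof
  fix i assume "i \<in> vars (P * Q)"
  then obtain k where k: "k \<in> Poly_Mapping.keys (P * Q)" "i \<in> Poly_Mapping.keys k"
    by (auto simp: vars_def)
  then obtain m n where mn: "k = m + n" "m \<in> Poly_Mapping.keys P" "n \<in> Poly_Mapping.keys Q"
    using Poly_Mapping.keys_mult[of P Q] by blast
  have "i \<in> Poly_Mapping.keys m \<union> Poly_Mapping.keys n"
    using Poly_Mapping.keys_add[of m n] k(2) mn(1) by blast
  thus "i \<in> V" using assms mn(2,3) by (auto simp: vars_def)
qed

lemma vars_emb [simp]: "vars (emb c) = {}"
  by (cases "c = 0") (auto simp: vars_def emb_poly_mapping_def)

lemma vars_Var [simp]: "vars (Var i) = {i}"
  by (auto simp: vars_def Var_def)

lemma vars_1 [simp]: "vars 1 = {}" and vars_0 [simp]: "vars 0 = {}"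
  using vars_emb[of 1] vars_emb[of 0] by simp_all

lemma vars_minus [simp]: "vars (- P) = vars P"
  by (simp add: vars_def)

lemma vars_diff: "vars P \<subseteq> V \<Longrightarrow> vars Q \<subseteq> V \<Longrightarrow> vars (P - Q) \<subseteq> V"
  using vars_add[of P V "- Q"] by simp

lemma vars_power: "vars P \<subseteq> V \<Longrightarrow> vars (P ^ n) \<subseteq> V"
  by (induction n) (simp_all add: vars_mult)

lemma vars_sum: "(\<And>a. a \<in> A \<Longrightarrow> vars (f a) \<subseteq> V) \<Longrightarrow> vars (sum f A) \<subseteq> V"
  by (induction A rule: infinite_finite_induct) (simp_all add: vars_add)

lemma vars_prod: "(\<And>a. a \<in> A \<Longrightarrow> vars (f a) \<subseteq> V) \<Longrightarrow> vars (prod f A) \<subseteq> V"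
  by (induction A rule: infinite_finite_induct) (simp_all add: vars_mult)

lemma vars_ev:
  assumes "\<And>i. i \<in> vars P \<Longrightarrow> vars (y i) \<subseteq> V" shows "vars (ev y P) \<subseteq> V"
  using subset_refl[of "vars P"]
  by (induction rule: mpoly_induct) (simp_all add: ev_simps assms vars_add vars_mult)

lemma ev_mpoly_emb: "ev (\<lambda>i. emb (y i)) P = (emb (ev y P) :: 'a :: complex_alg)"
  using subset_refl[of "vars P"]
  by (induction rule: mpoly_induct) (simp_all add: ev_simps emb_add emb_mult)

text \<open>P read as a univariate polynomial in x_j. The coefficients stay in the type
  \<open>mpoly\<close>, so the same operations apply again after a variable has been
  removed.\<close>

definition Theta :: "nat \<Rightarrow> mpoly \<Rightarrow> mpoly poly" where
  "Theta j = ev (\<lambda>i. if i = j then [:0, 1:] else [:Var i:])"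

definition Tz :: "nat \<Rightarrow> mpoly \<Rightarrow> mpoly" where
  "Tz j = ev (\<lambda>i. if i = j then 0 else Var i)"

definition Lc :: "nat \<Rightarrow> mpoly \<Rightarrow> mpoly" where
  "Lc j P = lead_coeff (Theta j P)"

lemma ahom_Theta: "ahom (Theta j)" and ahom_Tz: "ahom (Tz j)"
  by (simp_all add: Theta_def Tz_def ahom_ev)

lemma poly_Theta: "poly (Theta j P) q = ev (\<lambda>i. if i = j then q else Var i) P"
  unfolding Theta_def ahom_ev_comp[OF ahom_poly] by (intro arg_cong2[where f = ev]) auto

lemma poly_Theta_Var: "poly (Theta j P) (Var j) = P"
proof -
  have "(\<lambda>i. if i = j then Var j else Var i) = Var" by auto
  thus ?thesis by (simp add: poly_Theta)
qed

lemma Theta_eq_0_iff [simp]: "Theta j P = 0 \<longleftrightarrow> P = 0"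
  by (metis poly_Theta_Var poly_0 ahom_0[OF ahom_Theta])

lemma Tz_eq_coeff: "Tz j P = coeff (Theta j P) 0"
  by (simp add: Tz_def poly_0_coeff_0[symmetric] poly_Theta)

lemma map_poly_Theta:
  "ahom \<phi> \<Longrightarrow> map_poly \<phi> (Theta j P) = ev (\<lambda>i. if i = j then [:0, 1:] else [:\<phi> (Var i):]) P"
  unfolding Theta_def ahom_ev_comp[OF ahom_map_poly]
  by (intro arg_cong2[where f = ev] ext) (auto simp: map_poly_pCons ahom_0 ahom_1)

lemma vars_coeff_Theta:
  assumes "vars P \<subseteq> V" shows "vars (coeff (Theta j P) n) \<subseteq> V - {j}"
  using assms
proof (induction arbitrary: n rule: mpoly_induct)
  case (emb c)
  have "coeff (Theta j (emb c)) n = (if n = 0 then emb c else 0)"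
    by (simp add: ahom_emb[OF ahom_Theta] emb_poly_def coeff_pCons split: nat.splits)
  thus ?case by simp
next
  case (Var i)
  have "coeff (Theta j (Var i)) n = (if i = j then (if n = 1 then 1 else 0) else if n = 0 then Var i else 0)"
    by (simp add: Theta_def coeff_pCons split: nat.splits)
  thus ?case using Var by simp
next
  case (mult A B)
  thus ?case by (simp add: ahom_mult[OF ahom_Theta] coeff_mult vars_sum vars_mult)
qed (simp add: ahom_add[OF ahom_Theta] vars_add)

text \<open>Induction on the number of variables: at fixed values of the other variables a
  univariate complex polynomial vanishes everywhere, so each of its coefficients does.\<close>

lemma ev_eq_0:
  assumes "\<And>y :: nat \<Rightarrow> complex. ev y P = 0" shows "P = 0"
proof -
  have *: "P = 0" if "vars P \<subseteq> {..<n}" "\<And>y :: nat \<Rightarrow> complex. ev y P = 0" for n P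
    using that
  proof (induction n arbitrary: P)
    case 0
    have "P = ev (\<lambda>i. emb 0) P"
      using 0 ev_cong[of P Var "\<lambda>i. emb 0"] by simp
    thus ?case using 0 by (simp only: ev_mpoly_emb) simp
  next
    case (Suc n)
    have "coeff (Theta n P) k = 0" for k
    proof (rule Suc.IH)
      show "vars (coeff (Theta n P) k) \<subseteq> {..<n}"
        using vars_coeff_Theta[OF Suc.prems(1), of n k] by auto
      fix y :: "nat \<Rightarrow> complex"
      have "poly (map_poly (ev y) (Theta n P)) x = 0" for x
        unfolding map_poly_Theta[OF ahom_ev] ahom_ev_comp[OF ahom_poly] by (rule Suc.prems)
      hence "map_poly (ev y) (Theta n P) = 0"
        by (metis poly_all_0_iff_0)
      hence "coeff (map_poly (ev y) (Theta n P)) k = 0" by simp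
      thus "ev y (coeff (Theta n P) k) = 0" by (simp add: coeff_map_poly)
    qed
    hence "Theta n P = 0" by (intro poly_eqI) simp
    thus ?case by simp
  qed
  have "finite (vars P)"
  proof -
    have "vars P = (\<Union>m\<in>Poly_Mapping.keys P. Poly_Mapping.keys m)" by (auto simp: vars_def)
    thus ?thesis by simp
  qed
  then obtain n where "vars P \<subseteq> {..<n}" by (metis finite_nat_iff_bounded)
  thus ?thesis using * assms by blast
qed

text \<open>The product P * Q vanishes at every point, and the ring is a domain.\<close>

lemma ev_eq_0_off:
  assumes "Q \<noteq> 0" "\<And>y :: nat \<Rightarrow> complex. ev y Q \<noteq> 0 \<Longrightarrow> ev y P = 0" shows "P = 0"
proof -
  have "ev y (P * Q) = 0" for y :: "nat \<Rightarrow> complex"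
    using assms(2)[of y] by (cases "ev y Q = 0") (simp_all add: ev_mult)
  hence "P * Q = 0" by (rule ev_eq_0)
  thus ?thesis using assms by simp
qed

lemma Lc_mult: "Lc j (P * Q) = Lc j P * Lc j Q"
  by (simp add: Lc_def ahom_mult[OF ahom_Theta] lead_coeff_mult)

lemma Lc_eq_0_iff [simp]: "Lc j P = 0 \<longleftrightarrow> P = 0"
  by (simp add: Lc_def)

lemma Lc_1 [simp]: "Lc j 1 = 1"
  by (simp add: Lc_def ahom_1[OF ahom_Theta])

lemma Lc_prod: "Lc j (prod f A) = (\<Prod>a\<in>A. Lc j (f a))"
  by (induction A rule: infinite_finite_induct) (auto simp: Lc_mult)

lemma Lc_emb: "Lc j (emb c) = emb c"
  by (simp add: Lc_def ahom_emb[OF ahom_Theta] emb_poly_def)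

lemma Theta_Tz: "i \<noteq> j \<Longrightarrow> Theta i (Tz j P) = map_poly (Tz j) (Theta i P)"
  unfolding map_poly_Theta[OF ahom_Tz] unfolding Theta_def Tz_def ev_ev
  by (intro arg_cong2[where f = ev] ext) (auto simp: Tz_def ev_simps)

text \<open>The side condition excludes a drop of the degree in x_i on x_j = 0, which would bring up
  a lower coefficient.\<close>

lemma Tz_Lc:
  assumes "i \<noteq> j" "Tz j (Lc i P) \<noteq> 0" shows "Tz j (Lc i P) = Lc i (Tz j P)"
  using assms unfolding Lc_def
  by (simp add: Theta_Tz lead_coeff_map_poly_nz ahom_0[OF ahom_Tz])

section \<open>Linear factors and homogeneity\<close>

text \<open>The diagonal case u = v encodes a variable, so that one index type covers binomial and
  monomial factors alike.\<close>

definition lin :: "nat \<times> nat \<times> complex \<Rightarrow> mpoly" where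
  "lin = (\<lambda>(u, v, z). if u = v then Var u else Var u - emb z * Var v)"

text \<open>The hyperplane \<open>lin t\<close> = 0, solved for x_u.\<close>

definition lsub :: "nat \<times> nat \<times> complex \<Rightarrow> nat \<Rightarrow> mpoly" where
  "lsub = (\<lambda>(u, v, z) i. if i = u then (if u = v then 0 else emb z * Var v) else Var i)"

text \<open>Modulo \<open>lin t\<close> every variable is congruent to its image under
  \<open>lsub t\<close>, hence so is every polynomial. Divisibility is thus the kernel of a map into
  a domain, which makes \<open>lin t\<close> prime.\<close>

lemma lin_dvd_iff: "lin t dvd P \<longleftrightarrow> ev (lsub t) P = 0"
proof
  assume "lin t dvd P"
  then obtain Q where "P = lin t * Q" by blast
  moreover have "ev (lsub t) (lin t) = 0"
    by (cases t) (auto simp: lin_def lsub_def ev_simps)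
  ultimately show "ev (lsub t) P = 0" by (simp add: ev_simps)
next
  have "lin t dvd P - ev (lsub t) P"
    using subset_UNIV[of "vars P"]
  proof (induction rule: mpoly_induct)
    case (Var i)
    show ?case by (cases t) (auto simp: lin_def lsub_def)
  next
    case (add A B)
    have "A + B - ev (lsub t) (A + B) = (A - ev (lsub t) A) + (B - ev (lsub t) B)"
      by (simp add: ev_simps)
    thus ?case using add by (metis dvd_add)
  next
    case (mult A B)
    have "A * B - ev (lsub t) (A * B) = A * (B - ev (lsub t) B) + (A - ev (lsub t) A) * ev (lsub t) B"
      by (simp add: ev_simps algebra_simps)
    thus ?case using mult by (metis dvd_add dvd_mult dvd_mult2)
  qed simp
  moreover assume "ev (lsub t) P = 0"
  ultimately show "lin t dvd P" by simp
qed

lemma lin_prime: "lin t dvd A * B \<Longrightarrow> lin t dvd A \<or> lin t dvd B"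
  by (auto simp: lin_dvd_iff ev_simps)

lemma ev_lin: "ev y (lin (u, v, z)) = (if u = v then y u else y u - emb z * y v)"
  by (simp add: lin_def ev_simps)

lemma lin_nonzero: "lin t \<noteq> 0"
proof -
  obtain u v z where t: "t = (u, v, z)" by (cases t)
  have "ev (\<lambda>i. if i = u then 1 else 0 :: complex) (lin t) \<noteq> 0"
    by (simp add: t ev_lin)
  thus ?thesis by auto
qed

text \<open>The primes are removed one at a time from a factor that they divide; J records those
  that go to A. Nothing is assumed about the cofactor K.\<close>

lemma prime_split:
  fixes p :: "'i \<Rightarrow> 'a :: idom"
  assumes "finite I" "\<And>i X Y. i \<in> I \<Longrightarrow> p i dvd X * Y \<Longrightarrow> p i dvd X \<or> p i dvd Y"
    and "\<And>i. i \<in> I \<Longrightarrow> p i \<noteq> 0" and "A * B = K * (\<Prod>i\<in>I. p i)"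
  shows "\<exists>J A' B'. J \<subseteq> I \<and> A = A' * (\<Prod>i\<in>J. p i) \<and> B = B' * (\<Prod>i\<in>I - J. p i) \<and> A' * B' = K"
  using assms
proof (induction I arbitrary: A B rule: finite_induct)
  case empty
  thus ?case by auto
next
  case (insert x I)
  have "p x dvd A * B" using insert by auto
  hence "p x dvd A \<or> p x dvd B" using insert.prems(1) by blast
  thus ?case
  proof
    assume "p x dvd A"
    then obtain A1 where A1: "A = p x * A1" by blast
    have "p x * (A1 * B) = p x * (K * (\<Prod>i\<in>I. p i))"
      using insert.prems(3) insert.hyps A1 by (simp add: algebra_simps)
    hence "A1 * B = K * (\<Prod>i\<in>I. p i)" using insert.prems(2) by simp
    then obtain J A' B' where *: "J \<subseteq> I" "A1 = A' * (\<Prod>i\<in>J. p i)" "B = B' * (\<Prod>i\<in>I - J. p i)" "A' * B' = K"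
      using insert.IH[of A1 B] insert.prems by auto
    have "x \<notin> J" "finite J" using * insert.hyps finite_subset by auto
    hence "A = A' * (\<Prod>i\<in>insert x J. p i)" using A1 * by (simp add: algebra_simps)
    moreover have "insert x I - insert x J = I - J" using insert.hyps by auto
    ultimately show ?thesis using * by (intro exI[of _ "insert x J"] exI[of _ A'] exI[of _ B']) auto
  next
    assume "p x dvd B"
    then obtain B1 where B1: "B = p x * B1" by blast
    have "p x * (A * B1) = p x * (K * (\<Prod>i\<in>I. p i))"
      using insert.prems(3) insert.hyps B1 by (simp add: algebra_simps)
    hence "A * B1 = K * (\<Prod>i\<in>I. p i)" using insert.prems(2) by simp
    then obtain J A' B' where *: "J \<subseteq> I" "A = A' * (\<Prod>i\<in>J. p i)" "B1 = B' * (\<Prod>i\<in>I - J. p i)" "A' * B' = K"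
      using insert.IH[of A B1] insert.prems by auto
    have J: "x \<notin> J" "finite (I - J)" using * insert.hyps by auto
    hence e: "insert x I - J = insert x (I - J)" using insert.hyps by auto
    have "B = B' * (\<Prod>i\<in>insert x I - J. p i)"
      unfolding e using B1 * J insert.hyps by (simp add: algebra_simps)
    thus ?thesis using * by (intro exI[of _ J] exI[of _ A'] exI[of _ B']) auto
  qed
qed

lemma lin_split:
  assumes "finite I" "A * B = K * (\<Prod>t\<in>I. lin t)"
  shows "\<exists>J A' B'. J \<subseteq> I \<and> A = A' * (\<Prod>t\<in>J. lin t) \<and> B = B' * (\<Prod>t\<in>I - J. lin t) \<and> A' * B' = K"
  using assms by (intro prime_split lin_prime lin_nonzero) auto

text \<open>A prime that divides none of the others does not divide their product, so it must divide
  the cofactor.\<close>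

lemma prod_dvd_of_prime:
  fixes p :: "'i \<Rightarrow> 'a :: idom"
  assumes "finite I" "\<And>i X Y. i \<in> I \<Longrightarrow> p i dvd X * Y \<Longrightarrow> p i dvd X \<or> p i dvd Y"
    and "\<And>i j. i \<in> I \<Longrightarrow> j \<in> I \<Longrightarrow> p i dvd p j \<Longrightarrow> i = j"
    and "\<And>i. i \<in> I \<Longrightarrow> \<not> p i dvd 1"
    and "\<And>i. i \<in> I \<Longrightarrow> p i dvd P"
  shows "(\<Prod>i\<in>I. p i) dvd P"
  using assms
proof (induction I rule: finite_induct)
  case (insert x I)
  have "(\<Prod>i\<in>I. p i) dvd P" using insert by auto
  then obtain Q where Q: "P = (\<Prod>i\<in>I. p i) * Q" by blast
  note pr = insert.prems(1) and ne = insert.prems(2) and u = insert.prems(3)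
  have *: "J \<subseteq> I \<longrightarrow> \<not> p x dvd prod p J" if "finite J" for J
    using that
  proof (induction J rule: finite_induct)
    case empty thus ?case using u[of x] by simp
  next
    case (insert j J)
    show ?case
    proof
      assume J: "insert j J \<subseteq> I"
      have "\<not> p x dvd p j" using ne[of x j] J \<open>x \<notin> I\<close> by auto
      thus "\<not> p x dvd prod p (insert j J)" using insert.IH J insert.hyps pr[of x "p j" "prod p J"] by auto
    qed
  qed
  have "p x dvd Q" using insert.prems(1)[of x "prod p I" Q] insert.prems(4)[of x] *[OF insert.hyps(1)] Q by auto
  thus ?case using Q insert.hyps by (auto simp: mult.commute mult_dvd_mono)
qed auto

section \<open>Variables of factors, and factors of constants\<close>

lemma degree_Theta_pos: "i \<in> vars P \<Longrightarrow> degree (Theta i P) > 0"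
proof (rule ccontr)
  assume i: "i \<in> vars P" and "\<not> degree (Theta i P) > 0"
  then obtain c where c: "Theta i P = [:c:]" by (auto elim: degree_eq_zeroE)
  hence "P = c" using poly_Theta_Var[of i P] by simp
  moreover have "vars c \<subseteq> vars P - {i}" using vars_coeff_Theta[of P "vars P" i 0] c by simp
  ultimately show False using i by auto
qed

lemma degree_Theta_0: "i \<notin> vars P \<Longrightarrow> Theta i P = [:P:]"
proof -
  assume *: "i \<notin> vars P"
  have "Theta i P = ev (\<lambda>i. [:Var i:]) P"
    unfolding Theta_def using * by (intro ev_cong) auto
  also have "\<dots> = [:ev Var P:]"
    by (rule ahom_ev_comp[symmetric]) (auto simp: ahom_def emb_poly_def)
  finally show ?thesis by simp
qed

text \<open>Degrees in x_i add up in a domain, so a variable cannot disappear by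
  multiplication.\<close>

lemma vars_factor: "A * B \<noteq> 0 \<Longrightarrow> vars A \<subseteq> vars (A * B)"
proof
  fix i assume nz: "A * B \<noteq> 0" and i: "i \<in> vars A"
  show "i \<in> vars (A * B)"
  proof (rule ccontr)
    assume "i \<notin> vars (A * B)"
    hence "degree (Theta i (A * B)) = 0" by (simp add: degree_Theta_0)
    moreover have "degree (Theta i (A * B)) = degree (Theta i A) + degree (Theta i B)"
      using nz by (simp add: ahom_mult[OF ahom_Theta] degree_mult_eq)
    ultimately show False using degree_Theta_pos[OF i] by simp
  qed
qed

lemma vars_empty_emb: "vars P \<subseteq> {} \<Longrightarrow> \<exists>c. P = emb c"
proof -
  assume *: "vars P \<subseteq> {}"
  have "P = ev Var P" by simp
  also have "\<dots> = ev (\<lambda>i. emb 0) P" using * by (intro ev_cong) auto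
  also have "\<dots> = emb (ev (\<lambda>i. 0) P)" by (rule ev_mpoly_emb)
  finally show ?thesis by blast
qed

lemma emb_factor:
  assumes "A * B = (emb c :: mpoly)" "c \<noteq> 0" shows "\<exists>a. A = emb a \<and> a \<noteq> 0"
proof -
  have "vars A \<subseteq> {}" using vars_factor[of A B] assms by simp
  then obtain a where "A = emb a" using vars_empty_emb by blast
  thus ?thesis using assms by (cases "a = 0") auto
qed

section \<open>Homogeneous polynomials\<close>

definition PhiH :: "mpoly \<Rightarrow> mpoly poly" where "PhiH = ev (\<lambda>i. [:0, Var i:])"

text \<open>Homogeneity is read off the substitution x_i to x_i T. Products and factors of
  homogeneous polynomials then reduce to arithmetic of monomials in T.\<close>

definition homog :: "nat \<Rightarrow> mpoly \<Rightarrow> bool" where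
  "homog k P \<longleftrightarrow> PhiH P = monom P k"

lemma ahom_PhiH: "ahom PhiH" by (simp add: PhiH_def ahom_ev)

lemma poly_PhiH_1: "poly (PhiH P) 1 = P"
  by (simp add: PhiH_def ahom_ev_comp[OF ahom_poly])

lemma hom_mult: "homog k A \<Longrightarrow> homog l B \<Longrightarrow> homog (k + l) (A * B)"
  by (simp add: homog_def ahom_mult[OF ahom_PhiH] mult_monom)

lemma hom_add: "homog k A \<Longrightarrow> homog k B \<Longrightarrow> homog k (A + B)"
  by (simp add: homog_def ahom_add[OF ahom_PhiH] add_monom)

lemma hom_minus: "homog k A \<Longrightarrow> homog k (- A)"
  by (simp add: homog_def ahom_minus[OF ahom_PhiH] minus_monom)

lemma hom_0 [simp]: "homog k 0" by (simp add: homog_def ahom_0[OF ahom_PhiH])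

lemma hom_emb [simp]: "homog 0 (emb c)"
  by (simp add: homog_def ahom_emb[OF ahom_PhiH] emb_poly_def monom_0)

lemma hom_1 [simp]: "homog 0 1" using hom_emb[of 1] by simp

lemma hom_Var [simp]: "homog (Suc 0) (Var i)"
  by (simp add: homog_def PhiH_def monom_altdef)

lemma hom_sum: "(\<And>a. a \<in> A \<Longrightarrow> homog k (f a)) \<Longrightarrow> homog k (sum f A)"
  by (induction A rule: infinite_finite_induct) (auto simp: hom_add)

lemma hom_prod: "(\<And>a. a \<in> A \<Longrightarrow> homog (k a) (f a)) \<Longrightarrow> homog (sum k A) (prod f A)"
  by (induction A rule: infinite_finite_induct) (auto simp: hom_mult)

lemma hom_power: "homog k A \<Longrightarrow> homog (n * k) (A ^ n)"
  by (induction n) (auto simp: hom_mult)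

lemma hom_lin: "homog (Suc 0) (lin t)"
proof -
  obtain u v z where t: "t = (u, v, z)" by (cases t)
  have "homog (Suc 0) (emb z * Var v)" using hom_mult[OF hom_emb hom_Var] by simp
  hence "homog (Suc 0) (Var u + - (emb z * Var v))" by (intro hom_add hom_minus) auto
  thus ?thesis by (simp add: t lin_def)
qed

text \<open>Splitting off the powers of X from both factors leaves two cofactors with constant
  product, hence of degree 0.\<close>

lemma monom_factor:
  fixes a b :: "'a :: idom poly"
  assumes "a * b = monom c k" "c \<noteq> 0"
  shows "\<exists>l a0. a = monom a0 l \<and> l \<le> k"
proof -
  have nz: "a \<noteq> 0" "b \<noteq> 0" using assms by auto
  define ka kb where "ka = order 0 a" and "kb = order 0 b"
  obtain q where q: "a = [:0, 1:] ^ ka * q"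
    using order_decomp[OF nz(1), of 0] by (auto simp: ka_def)
  obtain r where r: "b = [:0, 1:] ^ kb * r"
    using order_decomp[OF nz(2), of 0] by (auto simp: kb_def)
  have "order 0 (a * b) = k" using assms by (simp add: order_0_monom)
  hence k: "ka + kb = k" using nz by (simp add: order_mult ka_def kb_def)
  have "[:0, 1:] ^ k * (q * r) = a * b"
    unfolding q r k[symmetric] power_add by (simp only: mult_ac)
  also have "\<dots> = [:0, 1:] ^ k * [:c:]" using assms(1) by (simp add: monom_altdef)
  finally have "[:0, 1:] ^ k * (q * r) = [:0, 1:] ^ k * [:c:]" .
  hence "q * r = [:c:]" by (subst (asm) mult_left_cancel) auto
  hence "degree q = 0" using assms(2) 
    by (metis add_is_0 degree_mult_eq degree_pCons_0 pCons_eq_0_iff mult_eq_0_iff)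
  then obtain q0 where "q = [:q0:]" by (auto elim: degree_eq_zeroE)
  hence "a = monom q0 ka" using q by (simp add: monom_altdef)
  thus ?thesis using k by auto
qed

lemma hom_factor:
  assumes "homog k (A * B)" "A * B \<noteq> (0 :: mpoly)"
  obtains l where "l \<le> k" "homog l A"
proof -
  have "PhiH A * PhiH B = monom (A * B) k"
    using assms(1) by (simp add: homog_def ahom_mult[OF ahom_PhiH])
  then obtain l a0 where l: "PhiH A = monom a0 l" "l \<le> k" using monom_factor assms(2) by blast
  have "A = a0" using poly_PhiH_1[of A] l by (simp add: poly_monom)
  thus ?thesis using that l by (simp add: homog_def)
qed

lemma hom_unique: "homog k P \<Longrightarrow> homog l P \<Longrightarrow> P \<noteq> 0 \<Longrightarrow> k = l"
  by (auto simp: homog_def monom_eq_iff')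

lemma hom_scale:
  assumes "homog k P" shows "ev (\<lambda>i. t * y i) P = t ^ k * ev y P"
proof -
  have a: "ahom (\<lambda>p. poly (map_poly (ev y) p) t)"
    by (rule ahom_comp[OF ahom_poly ahom_map_poly[OF ahom_ev]])
  have "poly (map_poly (ev y) (PhiH P)) t = ev (\<lambda>i. t * y i) P"
    unfolding PhiH_def ahom_ev_comp[OF a] by (simp add: map_poly_pCons mult.commute)
  thus ?thesis using assms by (simp add: homog_def map_poly_monom poly_monom mult.commute)
qed

lemma hom_0_emb: "homog 0 P \<Longrightarrow> P = emb (ev (\<lambda>_. 0) P)"
  using hom_scale[of 0 P 0 Var] ev_mpoly_emb[of "\<lambda>_. 0" P, where 'a=mpoly] by simp

lemma hom_emb_eq_0: "homog k (emb c) \<Longrightarrow> c \<noteq> 0 \<Longrightarrow> k = 0"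
  using hom_unique[OF _ hom_emb] by auto

lemma hom_Tz: "homog k P \<Longrightarrow> homog k (Tz j P)"
proof -
  assume "homog k P"
  have "PhiH (Tz j P) = map_poly (Tz j) (PhiH P)"
    unfolding PhiH_def ahom_ev_comp[OF ahom_map_poly[OF ahom_Tz]] unfolding Tz_def ev_ev
    by (intro arg_cong2[where f = ev] ext) (auto simp: map_poly_pCons ev_simps)
  thus ?thesis using \<open>homog k P\<close> by (simp add: homog_def map_poly_monom ahom_0[OF ahom_Tz])
qed

lemma pCons_0_power: "[:0, c :: 'a :: comm_ring_1:] ^ n = monom (c ^ n) n"
  by (induction n) (simp_all add: monom_Suc smult_monom monom_0 one_pCons)

text \<open>Leads back from \<open>PhiH\<close> to exponents: the coefficient of T^k in
  \<open>PhiH P\<close> collects the monomials of total degree k.\<close>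

lemma hom_keys:
  assumes "homog k P" "m \<in> Poly_Mapping.keys P"
  shows "(\<Sum>i\<in>Poly_Mapping.keys m. Poly_Mapping.lookup m i) = k"
proof -
  define dg where "dg m = (\<Sum>i\<in>Poly_Mapping.keys m. Poly_Mapping.lookup m i)" for m :: "nat \<Rightarrow>\<^sub>0 nat"
  have pr: "(\<Prod>i\<in>A. [:0, Var i:] ^ f i) = monom (\<Prod>i\<in>A. Var i ^ f i) (sum f A)" for A f
  proof (induction A rule: infinite_finite_induct)
    case (insert x A)
    thus ?case by (simp add: mult_monom pCons_0_power)
  qed (auto simp: monom_0 one_pCons)
  have "PhiH P = (\<Sum>m\<in>Poly_Mapping.keys P. monom (Poly_Mapping.single m (Poly_Mapping.lookup P m)) (dg m))"
    unfolding PhiH_def ev_def mval_def pr dg_def single_eq_mval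
    by (intro sum.cong) (auto simp: emb_poly_def smult_monom mval_def)
  hence "P = coeff (\<Sum>m\<in>Poly_Mapping.keys P. monom (Poly_Mapping.single m (Poly_Mapping.lookup P m)) (dg m)) k"
    using assms(1) by (simp add: homog_def)
  also have "\<dots> = (\<Sum>n\<in>Poly_Mapping.keys P. if dg n = k then Poly_Mapping.single n (Poly_Mapping.lookup P n) else 0)"
    by (simp add: coeff_sum)
  finally have "Poly_Mapping.lookup P m = Poly_Mapping.lookup (\<Sum>n\<in>Poly_Mapping.keys P. if dg n = k then Poly_Mapping.single n (Poly_Mapping.lookup P n) else 0) m"
    by simp
  also have "\<dots> = (\<Sum>n\<in>Poly_Mapping.keys P. if n = m then (if dg m = k then Poly_Mapping.lookup P m else 0) else 0)"
    unfolding lookup_sum by (intro sum.cong) (auto simp: lookup_single)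
  also have "\<dots> = (if dg m = k then Poly_Mapping.lookup P m else 0)" using assms(2) by simp
  finally show ?thesis using assms(2) by (auto simp: in_keys_iff dg_def split: if_splits)
qed

text \<open>When the variables in J are scaled by X, a monomial of degree k reaches X^k exactly if
  all its variables lie in J. With J a singleton this detects pure powers; with two of three
  variables it gives the form at infinity.\<close>

lemma hom_top:
  fixes y :: "nat \<Rightarrow> 'a :: {idom, complex_alg}" and J :: "nat set"
  assumes "homog k P"
  defines "A \<equiv> ev (\<lambda>i. if i \<in> J then [:0, y i:] else [:y i:]) P"
  shows "degree A \<le> k" "coeff A k = ev (\<lambda>i. if i \<in> J then y i else 0) P"
proof -
  define jd where "jd m = (\<Sum>i\<in>Poly_Mapping.keys m. if i \<in> J then Poly_Mapping.lookup m i else 0)" for m :: "nat \<Rightarrow>\<^sub>0 nat"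
  have pr: "(\<Prod>i\<in>B. (if i \<in> J then [:0, y i:] else [:y i:]) ^ f i) = monom (\<Prod>i\<in>B. y i ^ f i) (\<Sum>i\<in>B. if i \<in> J then f i else 0)" for B f
  proof (induction B rule: infinite_finite_induct)
    case (insert x B)
    have "[:y x:] ^ f x = monom (y x ^ f x) 0" by (simp add: monom_0 poly_const_pow)
    thus ?case using insert by (simp add: mult_monom pCons_0_power)
  qed (auto simp: monom_0 one_pCons)
  have A: "A = (\<Sum>m\<in>Poly_Mapping.keys P. monom (emb (Poly_Mapping.lookup P m) * mval y m) (jd m))"
    unfolding A_def ev_def mval_def pr jd_def
    by (intro sum.cong) (auto simp: emb_poly_def smult_monom)
  have le: "jd m \<le> k" if "m \<in> Poly_Mapping.keys P" for m
    unfolding jd_def hom_keys[OF assms(1) that, symmetric] by (intro sum_mono) auto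
  have eq: "jd m = k \<longleftrightarrow> Poly_Mapping.keys m \<subseteq> J" if "m \<in> Poly_Mapping.keys P" for m
  proof
    assume "Poly_Mapping.keys m \<subseteq> J"
    thus "jd m = k" unfolding jd_def hom_keys[OF assms(1) that, symmetric] by (intro sum.cong) auto
  next
    assume j: "jd m = k"
    show "Poly_Mapping.keys m \<subseteq> J"
    proof (rule ccontr)
      assume "\<not> Poly_Mapping.keys m \<subseteq> J"
      then obtain i where "i \<in> Poly_Mapping.keys m" "i \<notin> J" by auto
      hence "jd m < k" unfolding jd_def hom_keys[OF assms(1) that, symmetric]
        by (intro sum_strict_mono_ex1) (auto simp: in_keys_iff intro!: bexI[of _ i])
      thus False using j by simp
    qed
  qed
  show "degree A \<le> k" unfolding A
    by (intro degree_sum_le) (auto intro!: order.trans[OF degree_monom_le] le)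
  have "coeff A k = (\<Sum>m\<in>Poly_Mapping.keys P. if jd m = k then emb (Poly_Mapping.lookup P m) * mval y m else 0)"
    unfolding A by (simp add: coeff_sum)
  also have "\<dots> = ev (\<lambda>i. if i \<in> J then y i else 0) P" unfolding ev_def
  proof (intro sum.cong refl)
    fix m assume m: "m \<in> Poly_Mapping.keys P"
    have "mval (\<lambda>i. if i \<in> J then y i else 0) m = (if Poly_Mapping.keys m \<subseteq> J then mval y m else 0)"
    proof (cases "Poly_Mapping.keys m \<subseteq> J")
      case True
      hence "mval (\<lambda>i. if i \<in> J then y i else 0) m = mval y m"
        unfolding mval_def by (intro prod.cong) auto
      thus ?thesis using True by simp
    next
      case False
      then obtain i where "i \<in> Poly_Mapping.keys m" "i \<notin> J" by auto
      hence "mval (\<lambda>i. if i \<in> J then y i else 0) m = 0" unfolding mval_def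
        by (intro prod_zero) (auto simp: in_keys_iff intro!: bexI[of _ i])
      thus ?thesis using False by simp
    qed
    thus "(if jd m = k then emb (Poly_Mapping.lookup P m) * mval y m else 0) =
      emb (Poly_Mapping.lookup P m) * mval (\<lambda>i. if i \<in> J then y i else 0) m"
      using eq[OF m] by auto
  qed
  finally show "coeff A k = ev (\<lambda>i. if i \<in> J then y i else 0) P" .
qed

section \<open>Generalised Vandermonde determinants\<close>

text \<open>The determinant over an arbitrary ring: specialising S amounts to specialising the nodes
  y.\<close>

definition gd :: "nat \<Rightarrow> (nat \<Rightarrow> 'a :: comm_ring_1) \<Rightarrow> (nat \<Rightarrow> nat) \<Rightarrow> 'a" where
  "gd r y b = det (mat r r (\<lambda>(i, j). y i ^ b j))"

lemma gd_leibniz: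
  "gd r y b = (\<Sum>\<sigma> | \<sigma> permutes {..<r}. of_int (sign \<sigma>) * (\<Prod>i<r. y i ^ b (\<sigma> i)))"
proof -
  have "gd r y b = (\<Sum>\<sigma> | \<sigma> permutes {0..<r}. of_int (sign \<sigma>) * (\<Prod>i = 0..<r. (mat r r (\<lambda>(i, j). y i ^ b j)) $$ (i, \<sigma> i)))"
    by (simp add: gd_def det_def)
  also have "\<dots> = (\<Sum>\<sigma> | \<sigma> permutes {0..<r}. of_int (sign \<sigma>) * (\<Prod>i = 0..<r. y i ^ b (\<sigma> i)))"
    by (intro sum.cong refl arg_cong2[where f = "(*)"] prod.cong)
       (use permutes_in_image in fastforce)
  finally show ?thesis by (simp add: atLeast0LessThan)
qed

lemma S_gd: "S r b = gd r Var b"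
  by (simp add: S_def gd_leibniz)

lemma ahom_gd: "ahom \<phi> \<Longrightarrow> \<phi> (gd r y b) = gd r (\<lambda>i. \<phi> (y i)) b"
  by (simp add: gd_leibniz ahom_sum ahom_mult ahom_of_int ahom_prod ahom_power)

lemma ev_S: "ev y (S r b) = gd r y b"
  by (simp add: S_gd ahom_gd[OF ahom_ev])

lemma gd_cong:
  assumes "\<And>i. i < r \<Longrightarrow> y i = z i" "\<And>j. j < r \<Longrightarrow> b j = c j" shows "gd r y b = gd r z c"
  unfolding gd_def using assms by (intro arg_cong[where f = det] eq_matI) auto

lemma S_cong: "(\<And>j. j < r \<Longrightarrow> b j = c j) \<Longrightarrow> S r b = S r c"
  unfolding S_gd by (rule gd_cong) auto

lemma gd_perm:
  assumes "p permutes {..<r}"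
  shows "gd r (\<lambda>i. y (p i)) b = of_int (sign p) * gd r y b"
proof -
  have p: "p permutes {0..<r}" using assms by (simp add: atLeast0LessThan)
  let ?A = "mat r r (\<lambda>(i, j). y i ^ b j)"
  have pi: "p i < r" if "i < r" for i
    using permutes_in_image[OF assms, of i] that by simp
  have "mat r r (\<lambda>(i, j). y (p i) ^ b j) = mat r r (\<lambda>(i, j). ?A $$ (p i, j))"
    by (rule eq_matI) (simp_all add: pi)
  hence "gd r (\<lambda>i. y (p i)) b = det (mat r r (\<lambda>(i, j). ?A $$ (p i, j)))"
    unfolding gd_def by (rule arg_cong)
  also have "\<dots> = of_int (sign p) * det ?A" by (rule det_permute_rows[OF _ p]) simp
  finally show ?thesis unfolding gd_def .
qed

lemma gd_rows_eq:
  assumes "u < r" "v < r" "u \<noteq> v" "\<And>j. j < r \<Longrightarrow> y u ^ b j = y v ^ b j"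
  shows "gd r y b = 0"
  unfolding gd_def
  by (rule det_identical_rows[of _ r u v]) (use assms in \<open>auto intro!: eq_vecI\<close>)

text \<open>A kernel vector of the matrix is a polynomial with exponents b_j that vanishes at all
  nodes.\<close>

lemma gd_eq_0_iff:
  fixes y :: "nat \<Rightarrow> 'a :: idom"
  shows "gd r y b = 0 \<longleftrightarrow> (\<exists>c. (\<exists>j<r. c j \<noteq> 0) \<and> (\<forall>i<r. (\<Sum>j<r. c j * y i ^ b j) = 0))"
proof -
  let ?A = "mat r r (\<lambda>(i, j). y i ^ b j)"
  have A: "?A \<in> carrier_mat r r" by simp
  have mv: "?A *\<^sub>v v = 0\<^sub>v r \<longleftrightarrow> (\<forall>i<r. (\<Sum>j<r. v $ j * y i ^ b j) = 0)" if "v \<in> carrier_vec r" for v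
  proof -
    have *: "(?A *\<^sub>v v) $ i = (\<Sum>j<r. v $ j * y i ^ b j)" if "i < r" for i
      using that \<open>v \<in> _\<close> by (auto simp: scalar_prod_def atLeast0LessThan mult.commute intro!: sum.cong)
    show ?thesis
    proof
      assume "?A *\<^sub>v v = 0\<^sub>v r"
      thus "\<forall>i<r. (\<Sum>j<r. v $ j * y i ^ b j) = 0" using * by (metis index_zero_vec(1))
    next
      assume h: "\<forall>i<r. (\<Sum>j<r. v $ j * y i ^ b j) = 0"
      show "?A *\<^sub>v v = 0\<^sub>v r"
      proof (rule eq_vecI)
        fix i assume "i < dim_vec (0\<^sub>v r :: 'a vec)"
        hence i: "i < r" by simp
        show "(?A *\<^sub>v v) $ i = 0\<^sub>v r $ i" unfolding *[OF i] using h i by simp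
      qed simp
    qed
  qed
  show ?thesis unfolding gd_def det_0_iff_vec_prod_zero[OF A]
  proof safe
    fix v assume v: "v \<in> carrier_vec r" "v \<noteq> 0\<^sub>v r" "?A *\<^sub>v v = 0\<^sub>v r"
    have "\<exists>j<r. v $ j \<noteq> 0" using v(1,2) by (metis carrier_vecD eq_vecI index_zero_vec)
    thus "\<exists>c. (\<exists>j<r. c j \<noteq> 0) \<and> (\<forall>i<r. (\<Sum>j<r. c j * y i ^ b j) = 0)"
      using mv[OF v(1)] v(3) by (intro exI[of _ "\<lambda>j. v $ j"]) auto
  next
    fix c j assume c: "j < r" "c j \<noteq> 0" "\<forall>i<r. (\<Sum>j<r. c j * y i ^ b j) = 0"
    let ?v = "vec r c"
    have "?v \<in> carrier_vec r" by simp
    moreover have "?v \<noteq> 0\<^sub>v r" using c by (metis index_vec index_zero_vec(1))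
    moreover have "?A *\<^sub>v ?v = 0\<^sub>v r" using mv[of ?v] c by simp
    ultimately show "\<exists>v. v \<in> carrier_vec r \<and> v \<noteq> 0\<^sub>v r \<and> ?A *\<^sub>v v = 0\<^sub>v r" by blast
  qed
qed

section \<open>Expansion of S along its last variable\<close>

definition skip :: "nat \<Rightarrow> (nat \<Rightarrow> nat) \<Rightarrow> nat \<Rightarrow> nat" where
  "skip k b j = b (if j < k then j else Suc j)"

lemma gd_expand:
  "gd (Suc n) y b = (\<Sum>k\<le>n. y n ^ b k * ((-1) ^ (n + k) * gd n y (skip k b)))"
proof -
  let ?A = "mat (Suc n) (Suc n) (\<lambda>(i, j). y i ^ b j)"
  have "gd (Suc n) y b = (\<Sum>j<Suc n. ?A $$ (n, j) * cofactor ?A n j)"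
    unfolding gd_def by (rule laplace_expansion_row[of _ "Suc n"]) auto
  also have "\<dots> = (\<Sum>k\<le>n. y n ^ b k * ((-1) ^ (n + k) * gd n y (skip k b)))"
    unfolding lessThan_Suc_atMost
  proof (intro sum.cong refl)
    fix k assume k: "k \<in> {..n}"
    have "mat_delete ?A n k = mat n n (\<lambda>(i, j). y i ^ skip k b j)"
      using k by (intro eq_matI) (auto simp: mat_delete_def skip_def)
    thus "?A $$ (n, k) * cofactor ?A n k = y n ^ b k * ((-1) ^ (n + k) * gd n y (skip k b))"
      using k by (simp add: cofactor_def gd_def)
  qed
  finally show ?thesis .
qed

lemma gd_shift: "gd n y (\<lambda>j. b j + c) = (\<Prod>i<n. y i ^ c) * gd n y b"
  by (simp add: gd_leibniz power_add prod.distrib sum_distrib_left mult_ac)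

text \<open>A kernel vector would be a nonzero polynomial of degree at most r - 1 in x^d with the r
  distinct roots y_i^d.\<close>

lemma gd_drho_nonzero:
  fixes y :: "nat \<Rightarrow> 'a :: idom"
  assumes "\<And>i j. i < j \<Longrightarrow> j < r \<Longrightarrow> y i ^ d \<noteq> y j ^ d"
  shows "gd r y (drho r d) \<noteq> 0"
proof
  assume "gd r y (drho r d) = 0"
  then obtain c where c: "\<exists>j<r. c j \<noteq> 0" "\<And>i. i < r \<Longrightarrow> (\<Sum>j<r. c j * y i ^ drho r d j) = 0"
    unfolding gd_eq_0_iff by blast
  \<comment> \<open>The exponents of \<open>drho\<close> decrease, so the coefficients are
    reversed.\<close>
  define p where "p = (\<Sum>j<r. monom (c (r - 1 - j)) j)"
  have pe: "poly p (x ^ d) = (\<Sum>j<r. c j * x ^ drho r d j)" for x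
  proof -
    have "poly p (x ^ d) = (\<Sum>j<r. c (r - 1 - j) * (x ^ d) ^ j)"
      by (simp add: p_def poly_sum poly_monom)
    also have "\<dots> = (\<Sum>j<r. c (r - 1 - (r - Suc j)) * (x ^ d) ^ (r - Suc j))"
      by (rule sum.nat_diff_reindex[symmetric])
    also have "\<dots> = (\<Sum>j<r. c j * x ^ drho r d j)"
      by (intro sum.cong) (auto simp: drho_def power_mult)
    finally show ?thesis .
  qed
  obtain j where j: "j < r" "c j \<noteq> 0" using c by blast
  have "coeff p (r - 1 - j) = (\<Sum>i<r. if i = r - 1 - j then c (r - 1 - i) else 0)"
    unfolding p_def coeff_sum by (intro sum.cong) auto
  also have "\<dots> = c j" using j by simp
  finally have p0: "p \<noteq> 0" using j by auto
  have inj: "inj_on (\<lambda>i. y i ^ d) {..<r}"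
    using assms by (intro inj_onI) (metis lessThan_iff nat_neq_iff)
  have "r = card ((\<lambda>i. y i ^ d) ` {..<r})" using inj by (simp add: card_image)
  also have "\<dots> \<le> card {x. poly p x = 0}"
    using p0 pe c by (intro card_mono poly_roots_finite) auto
  also have "\<dots> \<le> degree p" by (rule card_poly_roots_bound[OF p0])
  also have "\<dots> \<le> r - 1" unfolding p_def
    by (intro degree_sum_le) (auto intro!: order.trans[OF degree_monom_le])
  finally show False using j by simp
qed

definition dec :: "nat \<Rightarrow> (nat \<Rightarrow> nat) \<Rightarrow> bool" where
  "dec r b \<longleftrightarrow> (\<forall>i j. i < j \<longrightarrow> j < r \<longrightarrow> b j < b i)"

lemma dec_drho: "d > 0 \<Longrightarrow> dec r (drho r d)"
  by (auto simp: dec_def drho_def)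

lemma dec_Suc: "dec (Suc n) b \<Longrightarrow> dec n (\<lambda>j. b (Suc j))"
  by (auto simp: dec_def)

lemma dec_sub: "dec (Suc n) b \<Longrightarrow> dec n b"
  by (auto simp: dec_def)

lemma dec_shift: "dec n b \<Longrightarrow> (\<And>j. j < n \<Longrightarrow> c \<le> b j) \<Longrightarrow> dec n (\<lambda>j. b j - c)"
  by (auto simp: dec_def diff_less_mono less_imp_le dest: order.strict_trans)

lemma Theta_S: "Theta n (S (Suc n) b) = (\<Sum>k\<le>n. monom ((-1) ^ (n + k) * S n (skip k b)) (b k))"
proof -
  let ?y = "\<lambda>i. if i = n then [:0, 1:] else [:Var i:]"
  have C: "ahom (\<lambda>p :: mpoly. [:p:])" by (auto simp: ahom_def emb_poly_def)
  have "gd n ?y c = [:S n c:]" for c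
    by (subst S_gd, subst ahom_gd[OF C], intro gd_cong) auto
  hence "Theta n (S (Suc n) b) = (\<Sum>k\<le>n. [:0, 1:] ^ b k * ((-1) ^ (n + k) * [:S n (skip k b):]))"
    by (simp add: Theta_def ev_S gd_expand)
  also have "\<dots> = (\<Sum>k\<le>n. monom ((-1) ^ (n + k) * S n (skip k b)) (b k))"
  proof (intro sum.cong refl)
    fix k
    have "(-1 :: mpoly poly) ^ m = [:(-1) ^ m:]" for m by (induction m) (auto simp: one_pCons)
    thus "[:0, 1:] ^ b k * ((-1) ^ (n + k) * [:S n (skip k b):]) = monom ((-1) ^ (n + k) * S n (skip k b)) (b k)"
      by (simp add: pCons_0_power smult_monom)
  qed
  finally show ?thesis .
qed

lemma skip_0: "skip 0 b = (\<lambda>j. b (Suc j))"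
  by (auto simp: skip_def)

lemma coeff_Theta_S_0:
  assumes "dec (Suc n) b"
  shows "coeff (Theta n (S (Suc n) b)) (b 0) = (-1) ^ n * S n (\<lambda>j. b (Suc j))"
proof -
  have "coeff (Theta n (S (Suc n) b)) (b 0) = (\<Sum>k\<le>n. if k = 0 then (-1) ^ n * S n (\<lambda>j. b (Suc j)) else 0)"
    unfolding Theta_S coeff_sum
  proof (intro sum.cong refl)
    fix k assume "k \<in> {..n}"
    hence "k \<noteq> 0 \<Longrightarrow> b k < b 0" using assms by (auto simp: dec_def)
    thus "coeff (monom ((-1) ^ (n + k) * S n (skip k b)) (b k)) (b 0)
        = (if k = 0 then (-1) ^ n * S n (\<lambda>j. b (Suc j)) else 0)"
      by (cases "k = 0") (auto simp: skip_0)
  qed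
  thus ?thesis by simp
qed

lemma degree_Theta_S_le:
  assumes "dec (Suc n) b" shows "degree (Theta n (S (Suc n) b)) \<le> b 0"
  unfolding Theta_S
proof (intro degree_sum_le)
  fix k assume "k \<in> {..n}"
  hence "b k \<le> b 0" using assms by (cases k) (auto simp: dec_def less_imp_le)
  thus "degree (monom ((-1) ^ (n + k) * S n (skip k b)) (b k)) \<le> b 0"
    using degree_monom_le order.trans by blast
qed auto

lemma S_nonzero: "dec n b \<Longrightarrow> S n b \<noteq> 0"
proof (induction n arbitrary: b)
  case 0
  show ?case by (simp add: S_gd gd_def)
next
  case (Suc n)
  hence "coeff (Theta n (S (Suc n) b)) (b 0) \<noteq> 0"
    by (simp add: coeff_Theta_S_0 dec_Suc)
  thus ?case by (auto simp: ahom_0[OF ahom_Theta])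
qed

lemma Lc_S:
  assumes "dec (Suc n) b" shows "Lc n (S (Suc n) b) = (-1) ^ n * S n (\<lambda>j. b (Suc j))"
    and "degree (Theta n (S (Suc n) b)) = b 0"
proof -
  have "coeff (Theta n (S (Suc n) b)) (b 0) \<noteq> 0"
    using assms by (simp add: coeff_Theta_S_0 dec_Suc S_nonzero)
  hence "b 0 \<le> degree (Theta n (S (Suc n) b))" by (rule le_degree)
  thus d: "degree (Theta n (S (Suc n) b)) = b 0" using degree_Theta_S_le[OF assms] by simp
  show "Lc n (S (Suc n) b) = (-1) ^ n * S n (\<lambda>j. b (Suc j))"
    by (simp add: Lc_def d coeff_Theta_S_0[OF assms])
qed

text \<open>Only the exponent 0 survives in the last row; it sits in column n, where the cofactor
  sign is 1.\<close>

lemma Tz_S: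
  assumes "dec (Suc n) b" "b n = 0" shows "Tz n (S (Suc n) b) = S n b"
proof -
  let ?z = "\<lambda>i. if i = n then 0 else Var i"
  have "gd n ?z (skip n b) = S n b"
    unfolding S_gd by (intro gd_cong) (auto simp: skip_def)
  moreover have "b k \<noteq> 0" if "k < n" for k
    using assms(1)[unfolded dec_def, rule_format, of k n] that by auto
  hence "(\<Sum>k<n. (0::mpoly) ^ b k * ((-1) ^ (n + k) * gd n ?z (skip k b))) = 0"
    by (intro sum.neutral) auto
  ultimately show ?thesis using assms(2)
    by (simp add: Tz_def ev_S gd_expand flip: lessThan_Suc_atMost mult_2)
qed

lemma S_shift: "S n (\<lambda>j. b j + c) = (\<Prod>i<n. Var i ^ c) * S n b"
  by (simp add: S_gd gd_shift)

lemma vars_S: "vars (S r b) \<subseteq> {..<r}"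
  unfolding S_def by (intro vars_sum vars_mult vars_prod vars_power)
    (use vars_emb[of "of_int _"] in \<open>auto simp: emb_of_int\<close>)

lemma hom_S: "homog (\<Sum>j<r. b j) (S r b)"
  unfolding S_def
proof (intro hom_sum)
  fix \<sigma> assume "\<sigma> \<in> {\<sigma>. \<sigma> permutes {..<r}}"
  hence s: "(\<Sum>i<r. b (\<sigma> i)) = (\<Sum>j<r. b j)"
    by (simp add: sum.permute[of \<sigma> "{..<r}" b] comp_def)
  have "homog (0 + (\<Sum>i<r. b (\<sigma> i) * Suc 0)) (of_int (sign \<sigma>) * (\<Prod>i<r. Var i ^ b (\<sigma> i)))"
    by (intro hom_mult hom_prod hom_power hom_Var) (metis emb_of_int hom_emb)
  thus "homog (\<Sum>j<r. b j) (of_int (sign \<sigma>) * (\<Prod>i<r. Var i ^ b (\<sigma> i)))"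
    using s by simp
qed

text \<open>Both determinants lose their largest exponent and pick up the same sign. The quotient
  for n + 1 variables thus passes to one for n variables with the same d.\<close>

lemma Lc_step:
  assumes "F * S (Suc n) (drho (Suc n) d) = S (Suc n) b" "dec (Suc n) b" "d > 0"
  shows "Lc n F * S n (drho n d) = S n (\<lambda>j. b (Suc j))"
proof -
  have d: "(\<lambda>j. drho (Suc n) d (Suc j)) = drho n d" by (auto simp: drho_def)
  have "Lc n F * Lc n (S (Suc n) (drho (Suc n) d)) = Lc n (S (Suc n) b)"
    using assms(1) by (metis Lc_mult)
  hence "(-1) ^ n * (Lc n F * S n (drho n d)) = (-1) ^ n * S n (\<lambda>j. b (Suc j))"
    using assms by (simp add: Lc_S dec_drho d algebra_simps)
  thus ?thesis by simp
qed

text \<open>On x_n = 0 the smallest remaining exponents are d on one side and b_{n-1} on the other.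
  Both come out as powers of the product of the variables, and their difference is the monomial left
  over.\<close>

lemma Tz_step:
  assumes "F * S (Suc n) (drho (Suc n) d) = S (Suc n) b" "dec (Suc n) b" "d > 0" "b n = 0" "n > 0"
    and "d \<le> b (n - 1)"
  shows "Tz n F * S n (drho n d) = (\<Prod>i<n. Var i ^ (b (n - 1) - d)) * S n (\<lambda>j. b j - b (n - 1))"
proof -
  have ge: "b (n - 1) \<le> b j" if "j < n" for j
    using assms(2) that by (cases "j = n - 1") (auto simp: dec_def less_imp_le)
  have "Tz n F * Tz n (S (Suc n) (drho (Suc n) d)) = Tz n (S (Suc n) b)"
    using assms(1) by (metis ahom_mult[OF ahom_Tz])
  hence "Tz n F * S n (drho (Suc n) d) = S n b"
    using assms by (simp add: Tz_S dec_drho) (simp add: drho_def Tz_S dec_drho)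
  moreover have "S n (drho (Suc n) d) = S n (\<lambda>j. drho n d j + d)"
    by (intro S_cong) (auto simp: drho_def dest!: less_imp_Suc_add)
  moreover have "S n b = S n (\<lambda>j. (b j - b (n - 1)) + b (n - 1))"
    by (intro S_cong) (use ge in auto)
  ultimately have "(\<Prod>i<n. Var i ^ d) * (Tz n F * S n (drho n d)) =
     (\<Prod>i<n. Var i ^ b (n - 1)) * S n (\<lambda>j. b j - b (n - 1))"
    by (simp add: S_shift mult_ac)
  also have "(\<Prod>i<n. Var i ^ b (n - 1)) = (\<Prod>i<n. Var i ^ d) * (\<Prod>i<n. Var i ^ (b (n - 1) - d))"
    using assms(6) by (simp flip: prod.distrib power_add)
  finally have "(\<Prod>i<n. Var i ^ d) * (Tz n F * S n (drho n d)) = (\<Prod>i<n. Var i ^ d) *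
      ((\<Prod>i<n. Var i ^ (b (n - 1) - d)) * S n (\<lambda>j. b j - b (n - 1)))"
    by (simp add: mult_ac)
  moreover have "(\<Prod>i<n. Var i ^ d) \<noteq> 0"
    using lin_nonzero[of "(i, i, 0)" for i] by (auto simp: lin_def)
  ultimately show ?thesis by simp
qed

text \<open>Indexes the linear factors of the product of x_u^e - x_v^e over u < v.\<close>

definition Lset :: "nat \<Rightarrow> nat \<Rightarrow> (nat \<times> nat \<times> complex) set" where
  "Lset r e = {(u, v, z). u < v \<and> v < r \<and> z ^ e = 1}"

lemma Lset_eq: "Lset r e = (\<lambda>(v, u, z). (u, v, z)) ` (SIGMA v:{..<r}. {..<v} \<times> {z. z ^ e = 1})"
  by (force simp: Lset_def)

lemma finite_Lset: "e > 0 \<Longrightarrow> finite (Lset r e)"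
  unfolding Lset_eq by (intro finite_imageI finite_SigmaI finite_cartesian_product)
    (auto intro: finite_roots_unity)

lemma card_Lset: "e > 0 \<Longrightarrow> card (Lset r e) = (\<Sum>j<r. drho r e j)"
proof -
  assume e: "e > 0"
  have "card (Lset r e) = card (SIGMA v:{..<r}. {..<v} \<times> {z::complex. z ^ e = 1})"
    unfolding Lset_eq by (intro card_image) (auto simp: inj_on_def)
  also have "\<dots> = (\<Sum>v<r. v * e)"
    using e by (subst card_SigmaI) (auto simp: card_cartesian_product card_roots_unity_eq intro: finite_roots_unity)
  also have "\<dots> = (\<Sum>v<r. (r - Suc v) * e)" by (rule sum.nat_diff_reindex[symmetric])
  also have "\<dots> = (\<Sum>j<r. drho r e j)" by (intro sum.cong) (auto simp: drho_def mult.commute)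
  finally show ?thesis .
qed

text \<open>The test point lies on x_u = z x_v, and its remaining coordinates have pairwise distinct
  absolute values above 1. Hence it lies on no other hyperplane x_u' = z' x_v' with z' of absolute
  value 1.\<close>

lemma lin_ndvd:
  assumes "u < v" "u' < v'" "z \<noteq> 0" "norm z = 1" "norm z' = 1" "lin (u, v, z) dvd lin (u', v', z')"
  shows "(u, v, z) = (u', v', z')"
proof -
  define y where "y = (\<lambda>i. if i = u then z else if i = v then 1 else of_nat i + 2)"
  have "ev y (lin (u, v, z)) = 0" using assms by (simp add: ev_lin y_def)
  hence "ev y (lin (u', v', z')) = 0" using assms(6) by (auto simp: ev_simps)
  hence eq: "y u' = z' * y v'" using assms by (simp add: ev_lin)
  have n: "norm (y i) = (if i = u \<or> i = v then 1 else of_nat i + 2)" for i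
    using assms by (auto simp: y_def) (metis norm_of_nat of_nat_Suc of_nat_add of_nat_numeral)
  have "norm (y u') = norm (y v')" using eq assms by (simp add: norm_mult)
  hence "u' = u" "v' = v" using assms(1,2) unfolding n by (auto split: if_splits)
  moreover have "z = z'" using eq assms(1) by (simp add: y_def \<open>u' = u\<close> \<open>v' = v\<close>)
  ultimately show ?thesis by simp
qed

lemma norm_unity: "z ^ e = 1 \<Longrightarrow> e > 0 \<Longrightarrow> norm (z :: complex) = 1"
  by (metis norm_power norm_one norm_ge_zero power_eq_1_iff zero_less_iff_neq_zero abs_norm_cancel)

lemma lin_not_unit: "\<not> lin t dvd 1"
  by (simp add: lin_dvd_iff ev_simps)

text \<open>On x_u = z x_v with z^e = 1 the rows u and v coincide, since e divides every
  exponent.\<close>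

lemma S_dvd:
  assumes "e > 0" "\<And>j. j < r \<Longrightarrow> e dvd a j"
  shows "(\<Prod>t\<in>Lset r e. lin t) dvd S r a"
proof (rule prod_dvd_of_prime)
  fix t assume t: "t \<in> Lset r e"
  then obtain u v z where uvz: "t = (u, v, z)" "u < v" "v < r" "z ^ e = 1" by (auto simp: Lset_def)
  show "lin t dvd S r a"
    unfolding lin_dvd_iff ev_S
  proof (rule gd_rows_eq[of u _ v])
    fix j assume "j < r"
    then obtain k where "a j = e * k" using assms(2) by (meson dvdE)
    hence "z ^ a j = 1" using uvz by (simp add: power_mult)
    thus "lsub t u ^ a j = lsub t v ^ a j"
      using uvz by (simp add: lsub_def power_mult_distrib flip: emb_power)
  qed (use uvz in auto)
next
  fix i j assume ij: "i \<in> Lset r e" "j \<in> Lset r e" "lin i dvd lin j"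
  obtain u v z where i: "i = (u, v, z)" "u < v" "z ^ e = 1" using ij by (auto simp: Lset_def)
  obtain u' v' z' where j: "j = (u', v', z')" "u' < v'" "z' ^ e = 1" using ij by (auto simp: Lset_def)
  have "z \<noteq> 0" using i assms(1) by (auto simp: power_0_left)
  thus "i = j" using lin_ndvd[of u v u' v' z z'] i j ij norm_unity assms(1) by auto
qed (use finite_Lset[OF assms(1)] lin_prime lin_not_unit in auto)

lemma hom_prod_lin: "finite A \<Longrightarrow> homog (card A) (\<Prod>t\<in>A. lin t)"
  using hom_prod[of A "\<lambda>_. Suc 0" lin] hom_lin by simp

lemma prod_lin_nonzero: "finite A \<Longrightarrow> (\<Prod>t\<in>A. lin t) \<noteq> 0"
  using lin_nonzero by simp

text \<open>The product divides S and has the same degree, so the cofactor is homogeneous of degree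
  0.\<close>

lemma S_drho_prod:
  assumes "e > 0"
  obtains \<kappa> where "\<kappa> \<noteq> 0" "S r (drho r e) = emb \<kappa> * (\<Prod>t\<in>Lset r e. lin t)"
proof -
  let ?p = "\<Prod>t\<in>Lset r e. lin t"
  have "?p dvd S r (drho r e)" using assms by (intro S_dvd) (auto simp: drho_def)
  then obtain K where K: "S r (drho r e) = K * ?p" by (metis dvdE mult.commute)
  have nz: "S r (drho r e) \<noteq> 0" using S_nonzero dec_drho assms by blast
  have "homog (card (Lset r e)) (K * ?p)"
    using hom_S[of "drho r e" r] card_Lset[OF assms, of r] K by metis
  then obtain l where l: "homog l K" using hom_factor nz K by metis
  have "homog (l + card (Lset r e)) (K * ?p)"
    by (intro hom_mult l hom_prod_lin finite_Lset assms)
  hence "l = 0" using hom_unique[OF _ \<open>homog (card (Lset r e)) (K * ?p)\<close>] nz K by force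
  hence "K = emb (ev (\<lambda>_. 0) K)" using l hom_0_emb by simp
  thus ?thesis using that[of "ev (\<lambda>_. 0) K"] K nz by (metis emb_0 mult_zero_left)
qed

section \<open>Factorisations and their extreme coefficients\<close>

definition is_const :: "mpoly \<Rightarrow> bool" where "is_const P \<longleftrightarrow> (\<exists>c. P = emb c)"

text \<open>A factorisation G H of C(a), with the division by S(d rho) multiplied out.\<close>

definition fact_pair :: "nat \<Rightarrow> nat \<Rightarrow> (nat \<Rightarrow> nat) \<Rightarrow> mpoly \<Rightarrow> mpoly \<Rightarrow> bool" where
  "fact_pair r d a G H \<longleftrightarrow> dec r a \<and> a (r - 1) = 0 \<and> d = Gcd (a ` {..<r}) \<and> d > 0 \<and>
     vars G \<subseteq> {..<r} \<and> vars H \<subseteq> {..<r} \<and> G * H * S r (drho r d) = S r a"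

definition Irr :: "nat \<Rightarrow> bool" where
  "Irr r \<longleftrightarrow> (\<forall>d a G H. fact_pair r d a G H \<longrightarrow> is_const G \<or> is_const H)"

lemma fact_pairD:
  assumes "fact_pair r d a G H"
  shows "dec r a" "a (r - 1) = 0" "d = Gcd (a ` {..<r})" "d > 0" "vars G \<subseteq> {..<r}" "vars H \<subseteq> {..<r}"
    "G * H * S r (drho r d) = S r a"
  using assms unfolding fact_pair_def by blast+

lemma fact_pair_swap: "fact_pair r d a G H \<Longrightarrow> fact_pair r d a H G"
  unfolding fact_pair_def by (simp only: mult.commute[of H G]) blast

section \<open>Permutations of the variables\<close>

definition pact :: "(nat \<Rightarrow> nat) \<Rightarrow> mpoly \<Rightarrow> mpoly" where
  "pact \<rho> = ev (\<lambda>i. Var (\<rho> i))"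

lemma ahom_pact: "ahom (pact \<rho>)"
  by (simp add: pact_def ahom_ev)

lemma ev_pact: "ev y (pact \<rho> P) = ev (\<lambda>i. y (\<rho> i)) P"
  by (simp add: pact_def ev_ev)

lemma pact_pact: "pact \<rho> (pact \<tau> P) = pact (\<lambda>i. \<rho> (\<tau> i)) P"
  by (simp add: pact_def ev_ev)

lemma pact_id: "pact (\<lambda>i. i) P = P"
  by (simp add: pact_def)

lemma pact_eq_0_iff: assumes "bij \<rho>" shows "pact \<rho> P = 0 \<longleftrightarrow> P = 0"
proof
  assume "pact \<rho> P = 0"
  hence "pact (inv_into UNIV \<rho>) (pact \<rho> P) = 0" by (simp add: ahom_0[OF ahom_pact])
  thus "P = 0" using assms by (simp add: pact_pact bij_is_inj pact_id)
qed (simp add: ahom_0[OF ahom_pact])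

lemma Theta_pact:
  assumes "bij \<rho>" shows "Theta (\<rho> i) (pact \<rho> P) = map_poly (pact \<rho>) (Theta i P)"
  unfolding map_poly_Theta[OF ahom_pact] unfolding Theta_def pact_def ev_ev
  using assms by (intro arg_cong2[where f = ev] ext) (auto simp: bij_def inj_eq)

lemma Lc_pact: assumes "bij \<rho>" shows "Lc (\<rho> i) (pact \<rho> P) = pact \<rho> (Lc i P)"
proof (cases "P = 0")
  case False
  thus ?thesis unfolding Lc_def Theta_pact[OF assms]
    by (intro lead_coeff_map_poly_nz) (simp_all add: pact_eq_0_iff assms ahom_0[OF ahom_pact])
qed (simp add: ahom_0[OF ahom_pact] Lc_def ahom_0[OF ahom_Theta])

lemma Tz_pact: assumes "bij \<rho>" shows "Tz (\<rho> i) (pact \<rho> P) = pact \<rho> (Tz i P)"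
  unfolding Tz_eq_coeff Theta_pact[OF assms] by (simp add: coeff_map_poly ahom_0[OF ahom_pact])

lemma pact_emb [simp]: "pact \<rho> (emb c) = emb c" by (simp add: pact_def)

lemma pact_const: assumes "bij \<rho>" "is_const (pact \<rho> P)" shows "is_const P"
proof -
  obtain c where "pact \<rho> P = emb c" using assms by (auto simp: is_const_def)
  hence "pact (inv_into UNIV \<rho>) (pact \<rho> P) = emb c" by simp
  thus ?thesis using assms by (auto simp: pact_pact bij_is_inj pact_id is_const_def)
qed

lemma pact_lin: "inj \<rho> \<Longrightarrow> pact \<rho> (lin (u, v, z)) = lin (\<rho> u, \<rho> v, z)"
  by (auto simp: lin_def pact_def ev_simps inj_eq)

lemma pact_S: "\<rho> permutes {..<r} \<Longrightarrow> pact \<rho> (S r b) = of_int (sign \<rho>) * S r b"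
  unfolding pact_def ev_S by (simp add: gd_perm S_gd)

lemma vars_pact: "\<rho> permutes {..<r} \<Longrightarrow> vars P \<subseteq> {..<r} \<Longrightarrow> vars (pact \<rho> P) \<subseteq> {..<r}"
  unfolding pact_def by (intro vars_ev) (auto dest: permutes_in_image)

text \<open>S(a) and S(d rho) change by the same sign, so that permuting the variables keeps a and
  d. Statements about the last variable extend to all variables in this way.\<close>

lemma fact_pair_pact:
  assumes "fact_pair r d a G H" "\<rho> permutes {..<r}"
  shows "fact_pair r d a (pact \<rho> G) (pact \<rho> H)"
proof -
  have "pact \<rho> (G * H * S r (drho r d)) = pact \<rho> (S r a)" by (simp only: fact_pairD(7)[OF assms(1)])
  hence "of_int (sign \<rho>) * (pact \<rho> G * pact \<rho> H * S r (drho r d)) = of_int (sign \<rho>) * S r a"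
    by (simp add: ahom_mult[OF ahom_pact] pact_S[OF assms(2)] mult_ac)
  hence "pact \<rho> G * pact \<rho> H * S r (drho r d) = S r a"
    by (subst (asm) mult_left_cancel) (auto simp: sign_def)
  thus ?thesis using assms vars_pact unfolding fact_pair_def by blast
qed

lemma perm_pair:
  assumes "i \<in> A" "j \<in> A" "m \<in> A" "n \<in> A" "i \<noteq> j" "m \<noteq> n"
  obtains \<rho> where "\<rho> permutes A" "\<rho> i = m" "\<rho> j = n" "bij \<rho>"
proof -
  \<comment> \<open>The first transposition moves i to m, the second moves the image of j to n and
    fixes m.\<close>
  let ?\<rho> = "Transposition.transpose (Transposition.transpose i m j) n \<circ> Transposition.transpose i m"
  have "?\<rho> permutes A"
    by (intro permutes_compose permutes_swap_id) (use assms in \<open>auto simp: Transposition.transpose_def\<close>)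
  moreover have "?\<rho> i = m" "?\<rho> j = n" using assms by (auto simp: Transposition.transpose_def)
  ultimately show ?thesis using that permutes_bij by blast
qed

lemma fact_pair_hom:
  assumes "fact_pair r d a G H" obtains k where "homog k G"
proof -
  have nz: "S r a \<noteq> 0" by (rule S_nonzero[OF fact_pairD(1)[OF assms]])
  have "G * (H * S r (drho r d)) = S r a" using fact_pairD(7)[OF assms] by (simp only: mult.assoc)
  hence "homog (\<Sum>j<r. a j) (G * (H * S r (drho r d)))" "G * (H * S r (drho r d)) \<noteq> 0"
    using hom_S[of a r] nz by simp_all
  thus ?thesis using hom_factor that by blast
qed

lemma fact_pair_nz:
  assumes "fact_pair r d a G H" shows "G \<noteq> 0" "H \<noteq> 0"
proof -
  have "G * H * S r (drho r d) \<noteq> 0"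
    unfolding fact_pairD(7)[OF assms] by (rule S_nonzero[OF fact_pairD(1)[OF assms]])
  thus "G \<noteq> 0" "H \<noteq> 0" by auto
qed

lemma dec_pos: "dec r a \<Longrightarrow> j < r - 1 \<Longrightarrow> a j > 0"
  using gr_implies_not0 by (fastforce simp: dec_def dest: spec[of _ j] spec[of _ "r - 1"])

lemma fact_pair_dvd: "fact_pair r d a G H \<Longrightarrow> j < r \<Longrightarrow> d dvd a j"
  by (drule fact_pairD(3)) simp

text \<open>This is degeneracy: a nonzero constant times linear factors in the variables V with
  ratios in Z, where M also admits variables as factors. As J is a set, repeated variables must be
  told apart by their third component.\<close>

definition LM :: "nat set \<Rightarrow> complex set \<Rightarrow> bool \<Rightarrow> mpoly \<Rightarrow> bool" where
  "LM V Z M P \<longleftrightarrow> (\<exists>c J. c \<noteq> 0 \<and> finite J \<and> P = emb c * (\<Prod>t\<in>J. lin t) \<and>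
     (\<forall>u v z. (u, v, z) \<in> J \<longrightarrow> u \<in> V \<and> v \<in> V \<and> (if u = v then M else z \<in> Z)))"

lemma LM_pact:
  assumes "LM V Z M P" "bij \<rho>" shows "LM (\<rho> ` V) Z M (pact \<rho> P)"
proof -
  obtain c J where c: "c \<noteq> 0" "finite J" "P = emb c * (\<Prod>t\<in>J. lin t)"
     "\<And>u v z. (u, v, z) \<in> J \<Longrightarrow> u \<in> V \<and> v \<in> V \<and> (if u = v then M else z \<in> Z)"
    using assms(1) unfolding LM_def by blast
  let ?f = "\<lambda>(u, v, z :: complex). (\<rho> u, \<rho> v, z)"
  have inj: "inj \<rho>" using assms(2) by (simp add: bij_is_inj)
  have "inj_on ?f J" using inj by (auto simp: inj_on_def)
  hence "(\<Prod>t\<in>?f ` J. lin t) = (\<Prod>t\<in>J. lin (?f t))" by (simp add: prod.reindex)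
  also have "\<dots> = (\<Prod>t\<in>J. pact \<rho> (lin t))" by (intro prod.cong) (auto simp: pact_lin inj)
  finally have "pact \<rho> P = emb c * (\<Prod>t\<in>?f ` J. lin t)"
    by (simp add: c(3) ahom_mult[OF ahom_pact] ahom_prod[OF ahom_pact])
  moreover have "\<rho> u \<in> \<rho> ` V \<and> \<rho> v \<in> \<rho> ` V \<and> (if \<rho> u = \<rho> v then M else z \<in> Z)" if "(u, v, z) \<in> J" for u v z
    using c(4)[OF that] inj by (auto simp: inj_eq)
  ultimately show ?thesis unfolding LM_def using c(1,2)
    by (intro exI[of _ c] exI[of _ "?f ` J"]) auto
qed

text \<open>The constant k is moved into A, and the bound on the variables is inherited from S(b),
  so that the induction hypothesis applies.\<close>

lemma irr_use:
  assumes "Irr n" "A * B = emb k * C" "k \<noteq> 0" "C * S n (drho n d) = S n b"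
    and "dec n b" "b (n - 1) = 0" "n \<ge> 2" "d = Gcd (b ` {..<n})"
  shows "is_const A \<or> is_const B"
proof -
  have b0: "b 0 > 0" using dec_pos[OF assms(5), of 0] assms(7) by simp
  have d0: "d > 0"
  proof (rule ccontr)
    assume "\<not> d > 0"
    hence "Gcd (b ` {..<n}) = 0" using assms(8) by simp
    moreover have "b 0 \<in> b ` {..<n}" using assms(7) by (intro imageI) simp
    ultimately have "b 0 = 0" unfolding Gcd_0_iff by blast
    thus False using b0 by simp
  qed
  let ?A = "emb (1 / k) * A"
  have "emb (1 / k) * (emb k :: mpoly) = 1" using assms(3) by (simp flip: emb_mult)
  hence "emb (1 / k) * (emb k * C) = C" by (simp flip: mult.assoc)
  hence "?A * B = C" using assms(2) by (simp add: mult.assoc)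
  hence eq: "?A * B * S n (drho n d) = S n b" using assms(4) by simp
  have nz: "S n b \<noteq> 0" using S_nonzero assms(5) by blast
  have eqs: "?A * (B * S n (drho n d)) = S n b" "B * (?A * S n (drho n d)) = S n b"
    using eq by (simp_all only: mult_ac)
  have v: "vars ?A \<subseteq> vars (S n b)" "vars B \<subseteq> vars (S n b)"
    using vars_factor[of ?A "B * S n (drho n d)", unfolded eqs(1), OF nz]
      vars_factor[of B "?A * S n (drho n d)", unfolded eqs(2), OF nz] by simp_all
  have "fact_pair n d b ?A B"
    unfolding fact_pair_def by (intro conjI assms(5,6,8) d0 eq order.trans[OF v(1) vars_S] order.trans[OF v(2) vars_S])
  hence "is_const ?A \<or> is_const B" using assms(1) by (auto simp: Irr_def)
  moreover have "is_const A" if ca: "is_const ?A"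
  proof -
    obtain c where "?A = emb c" using ca by (auto simp: is_const_def)
    hence "emb k * ?A = emb (k * c)" by (simp add: emb_mult)
    moreover have "emb k * ?A = A" using assms(3) by (simp add: mult.assoc[symmetric] flip: emb_mult)
    ultimately show ?thesis by (auto simp: is_const_def)
  qed
  ultimately show ?thesis by blast
qed

section \<open>Structure of the specialised factors\<close>

lemma exists_C:
  assumes "e > 0" "\<And>j. j < n \<Longrightarrow> e dvd b j" shows "\<exists>C. C * S n (drho n e) = S n b"
proof -
  obtain \<kappa> where k: "\<kappa> \<noteq> 0" "S n (drho n e) = emb \<kappa> * (\<Prod>t\<in>Lset n e. lin t)"
    by (rule S_drho_prod[OF assms(1)])
  have "(\<Prod>t\<in>Lset n e. lin t) dvd S n b" using assms by (rule S_dvd)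
  then obtain K where "S n b = (\<Prod>t\<in>Lset n e. lin t) * K" by blast
  hence "emb (1 / \<kappa>) * K * S n (drho n e) = emb (1 / \<kappa>) * emb \<kappa> * S n b"
    by (simp add: k mult_ac)
  thus ?thesis using k(1) by (auto simp flip: emb_mult)
qed

lemma Lset_mono: "d dvd e \<Longrightarrow> Lset n d \<subseteq> Lset n e"
  by (auto simp: Lset_def power_mult elim!: dvdE)

text \<open>For d dividing e the roots of z^d = 1 are among those of z^e = 1; the new ones supply
  the quotient.\<close>

lemma S_drho_quot:
  assumes "d > 0" "e > 0" "d dvd e"
  obtains \<kappa> where "\<kappa> \<noteq> 0"
    "S n (drho n e) = emb \<kappa> * (\<Prod>t\<in>Lset n e - Lset n d. lin t) * S n (drho n d)"
proof -
  obtain k1 where k1: "k1 \<noteq> 0" "S n (drho n e) = emb k1 * (\<Prod>t\<in>Lset n e. lin t)"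
    by (rule S_drho_prod[OF assms(2)])
  obtain k2 where k2: "k2 \<noteq> 0" "S n (drho n d) = emb k2 * (\<Prod>t\<in>Lset n d. lin t)"
    by (rule S_drho_prod[OF assms(1)])
  have "(\<Prod>t\<in>Lset n e. lin t) = (\<Prod>t\<in>Lset n e - Lset n d. lin t) * (\<Prod>t\<in>Lset n d. lin t)"
    by (rule prod.subset_diff) (use Lset_mono assms finite_Lset in auto)
  hence "S n (drho n e) = emb (k1 / k2) * emb k2 * (\<Prod>t\<in>Lset n e - Lset n d. lin t) * (\<Prod>t\<in>Lset n d. lin t)"
    using k1 k2(1) by (simp add: mult_ac flip: emb_mult)
  hence "S n (drho n e) = emb (k1 / k2) * (\<Prod>t\<in>Lset n e - Lset n d. lin t) * S n (drho n d)"
    by (simp add: k2 mult_ac)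
  thus ?thesis using that[of "k1 / k2"] k1 k2 by simp
qed

definition Zr :: "nat \<Rightarrow> nat \<Rightarrow> complex set" where
  "Zr e d = {z. z ^ e = 1 \<and> z ^ d \<noteq> 1}"

lemma LM_of_prod:
  assumes "P = emb c * (\<Prod>t\<in>J. lin t)" "P \<noteq> 0" "finite J"
    "\<And>u v z. (u, v, z) \<in> J \<Longrightarrow> u \<in> V \<and> v \<in> V \<and> (if u = v then M else z \<in> Z)"
  shows "LM V Z M P"
proof -
  have "c \<noteq> 0" using assms(1,2) by auto
  thus ?thesis using assms unfolding LM_def by blast
qed

text \<open>The monomial factor is encoded by the triples with equal first components; the third
  component is only a counter for the multiplicity.\<close>

definition Mset :: "nat \<Rightarrow> nat \<Rightarrow> (nat \<times> nat \<times> complex) set" where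
  "Mset n k = (\<lambda>(u, j). (u, u, of_nat j)) ` ({..<n} \<times> {..<k})"

lemma prod_Mset: "(\<Prod>t\<in>Mset n k. lin t) = (\<Prod>u<n. Var u ^ k)"
proof -
  have "inj_on (\<lambda>(u, j :: nat). (u :: nat, u, complex_of_nat j)) ({..<n} \<times> {..<k})" by (auto simp: inj_on_def)
  hence "(\<Prod>t\<in>Mset n k. lin t) = (\<Prod>(u, j)\<in>{..<n} \<times> {..<k}. Var u)"
    unfolding Mset_def by (subst prod.reindex) (auto simp: lin_def intro!: prod.cong)
  also have "\<dots> = (\<Prod>u<n. \<Prod>j<k. Var u)" by (rule prod.cartesian_product[symmetric])
  finally show ?thesis by simp
qed

text \<open>On x_n = 0 the exponents are a_j - Q, with gcd d' instead of d. Besides their own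
  quotient C, which the induction hypothesis controls, the product G H therefore contains S(d' rho)
  / S(d rho) and a monomial. These linear factors are indexed by I and distributed between G and H
  by J.\<close>

lemma struct_Tz:
  assumes "fact_pair (Suc n) d a G H" "Irr n" "n \<ge> 2"
  defines "Q \<equiv> a (n - 1)" defines "d' \<equiv> Gcd ((\<lambda>j. a j - Q) ` {..<n})"
  defines "I \<equiv> (Lset n d' - Lset n d) \<union> Mset n (Q - d)"
  obtains C J A B k where "C * S n (drho n d') = S n (\<lambda>j. a j - Q)" "J \<subseteq> I" "finite I"
    "Tz n G = A * (\<Prod>t\<in>J. lin t)" "Tz n H = B * (\<Prod>t\<in>I - J. lin t)" "A * B = emb k * C" "k \<noteq> 0"
    "is_const A \<or> is_const B" "d' > 0" "Tz n G * Tz n H \<noteq> 0"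
    "Tz n G * Tz n H * S n (drho n d) = (\<Prod>i<n. Var i ^ (Q - d)) * S n (\<lambda>j. a j - Q)"
proof -
  note f = fact_pairD[OF assms(1), simplified diff_Suc_1]
  have d0: "d > 0" by (rule f(4))
  have ge: "Q \<le> a j" if "j < n" for j
    using f(1) that unfolding Q_def dec_def by (cases "j = n - 1") (auto simp: less_imp_le)
  have Q0: "Q > 0" unfolding Q_def using dec_pos[of "Suc n" a "n - 1"] f(1) assms(3) by auto
  have dQ: "d dvd Q" unfolding Q_def using fact_pair_dvd[OF assms(1)] by auto
  have dec': "dec n (\<lambda>j. a j - Q)"
    by (rule dec_shift[OF dec_sub[OF f(1)] ge])
  have step: "Tz n (G * H) * S n (drho n d) = (\<Prod>i<n. Var i ^ (Q - d)) * S n (\<lambda>j. a j - Q)"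
    unfolding Q_def using f(1,2,4,7) assms(3) dvd_imp_le[OF dQ Q0, unfolded Q_def] by (intro Tz_step) auto
  have "a 0 - Q > 0" using dec_pos[OF dec', of 0] assms(3) by simp
  moreover have "d' dvd a 0 - Q" unfolding d'_def using assms(3) by (auto intro!: Gcd_dvd)
  ultimately have d'0: "d' > 0" by (auto intro: Nat.gr0I)
  have dd': "d dvd d'" unfolding d'_def
    using dQ fact_pair_dvd[OF assms(1)] by (intro Gcd_greatest) (auto intro!: dvd_diff_nat)
  obtain \<kappa> where kap: "\<kappa> \<noteq> 0"
    "S n (drho n d') = emb \<kappa> * (\<Prod>t\<in>Lset n d' - Lset n d. lin t) * S n (drho n d)"
    by (rule S_drho_quot[OF d0 d'0 dd'])
  obtain C where C: "C * S n (drho n d') = S n (\<lambda>j. a j - Q)"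
    using exists_C[OF d'0, of n "\<lambda>j. a j - Q"] by (auto simp: d'_def intro!: Gcd_dvd)
  have nz: "S n (drho n d) \<noteq> 0" using S_nonzero dec_drho d0 by blast
  have finI: "finite I" using d'0 by (auto simp: I_def finite_Lset Mset_def)
  have "Lset n d' \<inter> Mset n (Q - d) = {}" by (auto simp: Lset_def Mset_def)
  hence I: "(\<Prod>t\<in>I. lin t) = (\<Prod>t\<in>Lset n d' - Lset n d. lin t) * (\<Prod>i<n. Var i ^ (Q - d))"
    unfolding I_def prod_Mset[symmetric] using d'0
    by (intro prod.union_disjoint) (auto simp: finite_Lset Mset_def)
  have "Tz n (G * H) * S n (drho n d) = (emb \<kappa> * C * (\<Prod>t\<in>I. lin t)) * S n (drho n d)"
    unfolding step C[symmetric] kap I by (simp add: mult_ac)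
  hence eq: "Tz n G * Tz n H = emb \<kappa> * C * (\<Prod>t\<in>I. lin t)"
    using nz by (simp add: ahom_mult[OF ahom_Tz])
  obtain J A B where J: "J \<subseteq> I" "Tz n G = A * (\<Prod>t\<in>J. lin t)"
    "Tz n H = B * (\<Prod>t\<in>I - J. lin t)" "A * B = emb \<kappa> * C"
    using lin_split[OF finI eq] by (elim exE conjE) (rule that)
  have "is_const A \<or> is_const B"
    by (rule irr_use[OF assms(2) J(4) kap(1) C dec' _ assms(3)]) (simp_all add: Q_def d'_def)
  moreover have "C \<noteq> 0" using C S_nonzero[OF dec'] by auto
  hence "Tz n G * Tz n H \<noteq> 0" unfolding eq using kap prod_lin_nonzero[OF finI] by simp
  ultimately show ?thesis using that[OF C J(1) finI J(2,3,4) kap(1)] d'0 step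
    by (simp add: ahom_mult[OF ahom_Tz])
qed

text \<open>The analogue for the leading coefficient. The exponents a_1, ..., a_n still end in 0, so
  no monomial appears.\<close>

lemma struct_Lc:
  assumes "fact_pair (Suc n) d a G H" "Irr n" "n \<ge> 2"
  defines "d'' \<equiv> Gcd ((\<lambda>j. a (Suc j)) ` {..<n})"
  defines "I \<equiv> Lset n d'' - Lset n d"
  obtains C J A B k where "C * S n (drho n d'') = S n (\<lambda>j. a (Suc j))" "J \<subseteq> I" "finite I"
    "Lc n G = A * (\<Prod>t\<in>J. lin t)" "Lc n H = B * (\<Prod>t\<in>I - J. lin t)" "A * B = emb k * C" "k \<noteq> 0"
    "is_const A \<or> is_const B" "d'' > 0"
proof -
  note f = fact_pairD[OF assms(1), simplified diff_Suc_1]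
  have d0: "d > 0" by (rule f(4))
  have dec': "dec n (\<lambda>j. a (Suc j))" using f(1) by (rule dec_Suc)
  have step: "Lc n (G * H) * S n (drho n d) = S n (\<lambda>j. a (Suc j))"
    using f(1,4,7) by (intro Lc_step) auto
  have "a (Suc 0) > 0" using dec_pos[OF dec', of 0] assms(3) by simp
  moreover have "d'' dvd a (Suc 0)" unfolding d''_def using assms(3) by (auto intro!: Gcd_dvd)
  ultimately have d0'': "d'' > 0" by (auto intro: Nat.gr0I)
  have dd: "d dvd d''" unfolding d''_def
    using fact_pair_dvd[OF assms(1)] by (intro Gcd_greatest) auto
  obtain \<kappa> where kap: "\<kappa> \<noteq> 0"
    "S n (drho n d'') = emb \<kappa> * (\<Prod>t\<in>Lset n d'' - Lset n d. lin t) * S n (drho n d)"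
    by (rule S_drho_quot[OF d0 d0'' dd])
  obtain C where C: "C * S n (drho n d'') = S n (\<lambda>j. a (Suc j))"
    using exists_C[OF d0'', of n "\<lambda>j. a (Suc j)"] by (auto simp: d''_def intro!: Gcd_dvd)
  have nz: "S n (drho n d) \<noteq> 0" using S_nonzero dec_drho d0 by blast
  have finI: "finite I" using d0'' by (auto simp: I_def finite_Lset)
  have "Lc n (G * H) * S n (drho n d) = (emb \<kappa> * C * (\<Prod>t\<in>I. lin t)) * S n (drho n d)"
    unfolding step C[symmetric] kap I_def by (simp add: mult_ac)
  hence eq: "Lc n G * Lc n H = emb \<kappa> * C * (\<Prod>t\<in>I. lin t)"
    using nz by (simp add: Lc_mult)
  obtain J A B where J: "J \<subseteq> I" "Lc n G = A * (\<Prod>t\<in>J. lin t)"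
    "Lc n H = B * (\<Prod>t\<in>I - J. lin t)" "A * B = emb \<kappa> * C"
    using lin_split[OF finI eq] by (elim exE conjE) (rule that)
  have "is_const A \<or> is_const B"
    by (rule irr_use[OF assms(2) J(4) kap(1) C dec' _ assms(3)])
       (use f(2) assms(3) in \<open>simp_all add: d''_def\<close>)
  thus ?thesis using that[OF C J(1) finI J(2,3,4) kap(1)] d0'' by simp
qed

lemma Tz_LM_last:
  assumes "fact_pair (Suc n) d a G H" "Irr n" "n \<ge> 2"
  defines "d' \<equiv> Gcd ((\<lambda>j. a j - a (n - 1)) ` {..<n})"
  shows "LM {..<n} (Zr d' d) True (Tz n G) \<or> LM {..<n} (Zr d' d) True (Tz n H)"
proof -
  let ?I = "(Lset n d' - Lset n d) \<union> Mset n (a (n - 1) - d)"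
  obtain C J A B k where *: "J \<subseteq> ?I" "finite ?I"
    "Tz n G = A * (\<Prod>t\<in>J. lin t)" "Tz n H = B * (\<Prod>t\<in>?I - J. lin t)"
    "is_const A \<or> is_const B" "Tz n G * Tz n H \<noteq> 0"
    by (rule struct_Tz[OF assms(1-3), folded d'_def]) blast
  have I: "u \<in> {..<n} \<and> v \<in> {..<n} \<and> (if u = v then True else z \<in> Zr d' d)" if "(u, v, z) \<in> ?I" for u v z
    using that by (auto simp: Lset_def Mset_def Zr_def)
  from *(5) show ?thesis
  proof
    assume "is_const A"
    then obtain c where "A = emb c" by (auto simp: is_const_def)
    have "LM {..<n} (Zr d' d) True (Tz n G)"
    proof (rule LM_of_prod)
      show "Tz n G = emb c * (\<Prod>t\<in>J. lin t)" using *(3) \<open>A = emb c\<close> by simp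
      show "Tz n G \<noteq> 0" using *(6) by auto
      show "finite (J)" by (rule finite_subset[OF *(1,2)])
    qed (rule I, use *(1) in blast)
    thus ?thesis ..
  next
    assume "is_const B"
    then obtain c where "B = emb c" by (auto simp: is_const_def)
    have "LM {..<n} (Zr d' d) True (Tz n H)"
    proof (rule LM_of_prod)
      show "Tz n H = emb c * (\<Prod>t\<in>?I - J. lin t)" using *(4) \<open>B = emb c\<close> by simp
      show "Tz n H \<noteq> 0" using *(6) by auto
      show "finite (?I - J)" using *(2) by blast
    qed (rule I, use *(1) in blast)
    thus ?thesis ..
  qed
qed

lemma Lc_LM_last:
  assumes "fact_pair (Suc n) d a G H" "Irr n" "n \<ge> 2"
  defines "d'' \<equiv> Gcd ((\<lambda>j. a (Suc j)) ` {..<n})"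
  shows "LM {..<n} (Zr d'' d) False (Lc n G) \<or> LM {..<n} (Zr d'' d) False (Lc n H)"
proof -
  let ?I = "Lset n d'' - Lset n d"
  obtain C J A B k where *: "J \<subseteq> ?I" "finite ?I"
    "Lc n G = A * (\<Prod>t\<in>J. lin t)" "Lc n H = B * (\<Prod>t\<in>?I - J. lin t)"
    "is_const A \<or> is_const B"
    by (rule struct_Lc[OF assms(1-3), folded d''_def]) blast
  have I: "u \<in> {..<n} \<and> v \<in> {..<n} \<and> (if u = v then False else z \<in> Zr d'' d)" if "(u, v, z) \<in> ?I" for u v z
    using that by (auto simp: Lset_def Zr_def)
  note nz = fact_pair_nz[OF assms(1)]
  from *(5) show ?thesis
  proof
    assume "is_const A"
    then obtain c where "A = emb c" by (auto simp: is_const_def)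
    have "LM {..<n} (Zr d'' d) False (Lc n G)"
    proof (rule LM_of_prod)
      show "Lc n G = emb c * (\<Prod>t\<in>J. lin t)" using *(3) \<open>A = emb c\<close> by simp
      show "Lc n G \<noteq> 0" using nz by simp
      show "finite (J)" by (rule finite_subset[OF *(1,2)])
    qed (rule I, use *(1) in blast)
    thus ?thesis ..
  next
    assume "is_const B"
    then obtain c where "B = emb c" by (auto simp: is_const_def)
    have "LM {..<n} (Zr d'' d) False (Lc n H)"
    proof (rule LM_of_prod)
      show "Lc n H = emb c * (\<Prod>t\<in>?I - J. lin t)" using *(4) \<open>B = emb c\<close> by simp
      show "Lc n H \<noteq> 0" using nz by simp
      show "finite (?I - J)" using *(2) by blast
    qed (rule I, use *(1) in blast)
    thus ?thesis ..
  qed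
qed

lemma swap_last:
  assumes "j \<le> n"
  defines "\<rho> \<equiv> Transposition.transpose j n"
  shows "\<rho> permutes {..<Suc n}" "bij \<rho>" "\<rho> ` {..<n} = {..n} - {j}" "\<rho> n = j" "\<And>i. \<rho> (\<rho> i) = i"
proof -
  show p: "\<rho> permutes {..<Suc n}" unfolding \<rho>_def using assms(1) by (intro permutes_swap_id) auto
  show "bij \<rho>" using p permutes_bij by blast
  show rn: "\<rho> n = j" by (simp add: \<rho>_def)
  have "{..<n} = {..<Suc n} - {n}" by auto
  hence "\<rho> ` {..<n} = \<rho> ` {..<Suc n} - \<rho> ` {n}"
    using permutes_inj[OF p] by (simp add: image_set_diff)
  thus "\<rho> ` {..<n} = {..n} - {j}" using permutes_image[OF p] rn by (simp add: lessThan_Suc_atMost)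
  show "\<rho> (\<rho> i) = i" for i by (simp add: \<rho>_def)
qed

lemma Tz_LM:
  assumes "fact_pair (Suc n) d a G H" "Irr n" "n \<ge> 2" "j \<le> n"
  defines "d' \<equiv> Gcd ((\<lambda>j. a j - a (n - 1)) ` {..<n})"
  shows "LM ({..n} - {j}) (Zr d' d) True (Tz j G) \<or> LM ({..n} - {j}) (Zr d' d) True (Tz j H)"
proof -
  define \<rho> where "\<rho> = Transposition.transpose j n"
  note r = swap_last[OF assms(4), folded \<rho>_def]
  have bk: "LM ({..n} - {j}) (Zr d' d) True (Tz j P)" if "LM {..<n} (Zr d' d) True (Tz n (pact \<rho> P))" for P
  proof -
    have "pact \<rho> (Tz n (pact \<rho> P)) = Tz (\<rho> n) (pact \<rho> (pact \<rho> P))" by (rule Tz_pact[OF r(2), symmetric])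
    also have "\<dots> = Tz j P" by (simp add: r pact_pact pact_id)
    finally show ?thesis using LM_pact[OF that r(2)] r(3) by simp
  qed
  show ?thesis
    using Tz_LM_last[OF fact_pair_pact[OF assms(1) r(1)] assms(2,3)] bk unfolding d'_def by blast
qed

lemma Lc_LM:
  assumes "fact_pair (Suc n) d a G H" "Irr n" "n \<ge> 2" "j \<le> n"
  defines "d'' \<equiv> Gcd ((\<lambda>j. a (Suc j)) ` {..<n})"
  shows "LM ({..n} - {j}) (Zr d'' d) False (Lc j G) \<or> LM ({..n} - {j}) (Zr d'' d) False (Lc j H)"
proof -
  define \<rho> where "\<rho> = Transposition.transpose j n"
  note r = swap_last[OF assms(4), folded \<rho>_def]
  have bk: "LM ({..n} - {j}) (Zr d'' d) False (Lc j P)" if "LM {..<n} (Zr d'' d) False (Lc n (pact \<rho> P))" for P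
  proof -
    have "pact \<rho> (Lc n (pact \<rho> P)) = Lc (\<rho> n) (pact \<rho> (pact \<rho> P))" by (rule Lc_pact[OF r(2), symmetric])
    also have "\<dots> = Lc j P" by (simp add: r pact_pact pact_id)
    finally show ?thesis using LM_pact[OF that r(2)] r(3) by simp
  qed
  show ?thesis
    using Lc_LM_last[OF fact_pair_pact[OF assms(1) r(1)] assms(2,3)] bk unfolding d''_def by blast
qed

section \<open>Large middle gaps\<close>

lemma Lc_notin: "i \<notin> vars P \<Longrightarrow> Lc i P = P"
  by (simp add: Lc_def degree_Theta_0)

lemma Lc_Var_self: "Lc i (Var i) = 1"
  by (simp add: Lc_def Theta_def)

lemma vars_lin: "vars (lin (u, v, z)) \<subseteq> {u, v}"
  by (cases "u = v") (simp_all add: lin_def vars_diff vars_mult)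

lemma Lc_lin:
  assumes "z \<noteq> 0"
  shows "Lc i (lin (u, v, z)) = (if u = v then (if u = i then 1 else Var u)
    else if u = i then 1 else if v = i then emb (- z) else lin (u, v, z))"
proof -
  have *: "Lc i (lin (u, v, z)) = lin (u, v, z)" if "i \<noteq> u" "i \<noteq> v"
    using that vars_lin by (intro Lc_notin) blast
  have "Lc u (lin (u, v, z)) = 1" if "u \<noteq> v"
    using that by (simp add: Lc_def Theta_def lin_def ev_simps emb_poly_def)
  moreover have "Lc v (lin (u, v, z)) = emb (- z)" if "u \<noteq> v"
    using that assms by (simp add: Lc_def Theta_def lin_def ev_simps emb_poly_def emb_minus)
  moreover have "Lc u (lin (u, u, z)) = 1" by (simp add: lin_def Lc_Var_self)
  moreover have "Lc i (lin (u, u, z)) = Var u" if "i \<noteq> u"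
    using *[OF that] by (auto simp: lin_def Lc_notin that)
  ultimately show ?thesis using * by auto
qed

lemma ev_Tz_zero: "y j = 0 \<Longrightarrow> ev y (Tz j P) = ev y P"
  unfolding Tz_def ev_ev by (intro arg_cong2[where f = ev] ext) (auto simp: ev_simps)

lemma LM_nonzero_at:
  fixes y :: "nat \<Rightarrow> complex"
  assumes "LM V Z M P" "\<And>u. u \<in> V \<Longrightarrow> M \<Longrightarrow> y u \<noteq> 0"
    "\<And>u v z. u \<in> V \<Longrightarrow> v \<in> V \<Longrightarrow> u \<noteq> v \<Longrightarrow> z \<in> Z \<Longrightarrow> y u \<noteq> z * y v"
  shows "ev y P \<noteq> 0"
proof -
  obtain c J where c: "c \<noteq> 0" "finite J" "P = emb c * (\<Prod>t\<in>J. lin t)"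
     "\<And>u v z. (u, v, z) \<in> J \<Longrightarrow> u \<in> V \<and> v \<in> V \<and> (if u = v then M else z \<in> Z)"
    using assms(1) unfolding LM_def by blast
  have "ev y (lin t) \<noteq> 0" if "t \<in> J" for t
  proof -
    obtain u v z where t: "t = (u, v, z)" by (cases t)
    show ?thesis using c(4)[of u v z] that assms(2)[of u] assms(3)[of u v z]
      by (auto simp: t ev_lin split: if_splits)
  qed
  thus ?thesis using c by (simp add: ev_simps)
qed

text \<open>The leading coefficient in x_i turns each factor containing x_i into 1 or -z. What
  remains is to avoid the factors without x_i and the ratio 0.\<close>

lemma LM_Lc_nonzero_at:
  fixes y :: "nat \<Rightarrow> complex"
  assumes "LM V Z M P" "\<And>u. u \<in> V \<Longrightarrow> u \<noteq> i \<Longrightarrow> M \<Longrightarrow> y u \<noteq> 0" "0 \<notin> Z"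
    "\<And>u v z. u \<in> V \<Longrightarrow> v \<in> V \<Longrightarrow> u \<noteq> i \<Longrightarrow> v \<noteq> i \<Longrightarrow> u \<noteq> v \<Longrightarrow> z \<in> Z \<Longrightarrow> y u \<noteq> z * y v"
  shows "ev y (Lc i P) \<noteq> 0"
proof -
  obtain c J where c: "c \<noteq> 0" "finite J" "P = emb c * (\<Prod>t\<in>J. lin t)"
     "\<And>u v z. (u, v, z) \<in> J \<Longrightarrow> u \<in> V \<and> v \<in> V \<and> (if u = v then M else z \<in> Z)"
    using assms(1) unfolding LM_def by blast
  have "ev y (Lc i (lin t)) \<noteq> 0" if "t \<in> J" for t
  proof -
    obtain u v z where t: "t = (u, v, z)" by (cases t)
    note h = c(4)[of u v z, folded t, OF that]
    show ?thesis
    proof (cases "u = v")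
      case True
      \<comment> \<open>On the diagonal z is a counter and may be 0, whereas \<open>Lc_lin\<close>
        asks for a nonzero ratio.\<close>
      have "lin (u, v, z) = lin (u, v, 1)" using True by (simp add: lin_def)
      thus ?thesis using h assms(2)[of u] True by (auto simp: t Lc_lin ev_simps)
    next
      case False
      hence "z \<in> Z" "z \<noteq> 0" using h assms(3) by auto
      thus ?thesis using h assms(4)[of u v z] False by (auto simp: t Lc_lin ev_simps ev_lin)
    qed
  qed
  thus ?thesis using c by (simp add: Lc_mult Lc_prod Lc_emb ev_simps)
qed

lemma primitive_root:
  assumes "N > 0" obtains \<omega> :: complex where "\<And>k. \<omega> ^ k = 1 \<longleftrightarrow> N dvd k"
proof -
  let ?f = "\<lambda>k. cis (2 * pi * real k / real N)"
  have bij: "bij_betw ?f {..<N} {z. z ^ N = 1}" by (rule bij_betw_roots_unity[OF assms])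
  let ?w = "?f 1"
  have pw: "?w ^ k = ?f k" for k by (simp add: DeMoivre field_simps)
  have "?f N = 1" using assms by (simp add: cis.ctr complex_eq_iff)
  hence wN: "?w ^ N = 1" using pw by simp
  have "?w ^ k = 1 \<longleftrightarrow> N dvd k" for k
  proof
    assume "N dvd k" thus "?w ^ k = 1" using wN by (auto simp: power_mult)
  next
    assume k: "?w ^ k = 1"
    have "?w ^ k = (?w ^ N) ^ (k div N) * ?w ^ (k mod N)"
      by (metis mult_div_mod_eq power_add power_mult)
    hence "?w ^ (k mod N) = 1" unfolding k wN by simp
    hence e: "?f (k mod N) = ?f 0" unfolding pw by simp
    have "inj_on ?f {..<N}" using bij by (simp add: bij_betw_def)
    from inj_onD[OF this e] have "k mod N = 0" using assms by simp
    thus "N dvd k" by auto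
  qed
  thus ?thesis using that by blast
qed

text \<open>The double specialisation of S(a) is, up to sign, the nonzero determinant with exponents
  a_1, ..., a_{n-1}. This is the side condition of \<open>Tz_Lc\<close>.\<close>

lemma Tz_Lc_nz:
  assumes "fact_pair (Suc n) d a G H" "n \<ge> 2" "i \<le> n" "j \<le> n" "i \<noteq> j"
  shows "Tz j (Lc i H) \<noteq> 0"
proof -
  obtain m where n: "n = Suc m" using assms(2) by (cases n) auto
  obtain \<rho> where r: "\<rho> permutes {..<Suc n}" "\<rho> i = n" "\<rho> j = m" "bij \<rho>"
    by (rule perm_pair[of i "{..<Suc n}" j n m]) (use assms n in auto)
  note f = fact_pairD[OF fact_pair_pact[OF assms(1) r(1)], simplified diff_Suc_1]
  have "Lc n (pact \<rho> G * pact \<rho> H) * S n (drho n d) = S n (\<lambda>j. a (Suc j))"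
    by (rule Lc_step[OF f(7,1,4)])
  hence "Tz m (Lc n (pact \<rho> G * pact \<rho> H)) * Tz m (S n (drho n d)) = Tz m (S (Suc m) (\<lambda>j. a (Suc j)))"
    by (metis ahom_mult[OF ahom_Tz] n)
  also have "\<dots> = S m (\<lambda>j. a (Suc j))"
    using f(1,2) by (intro Tz_S) (simp_all add: n dec_Suc)
  also have "\<dots> \<noteq> 0" using f(1) by (intro S_nonzero dec_sub[of m] dec_Suc) (simp add: n)
  finally have "Tz m (Lc n (pact \<rho> H)) \<noteq> 0"
    by (auto simp: Lc_mult ahom_mult[OF ahom_Tz])
  also have "Tz m (Lc n (pact \<rho> H)) = pact \<rho> (Tz j (Lc i H))"
    using Lc_pact[OF r(4), of i H] Tz_pact[OF r(4), of j "Lc i H"] r(2,3) by simp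
  finally show ?thesis by (auto simp: ahom_0[OF ahom_pact])
qed

text \<open>Let w have order N and put x_i = w^i for i < m = n - 1. The shifted exponents N and 0
  give equal columns, so the doubly specialised determinant vanishes. But neither G nor H does: a
  linear factor with ratio z, z^e = 1, would require (w^k)^e = 1 for some 0 < k < m, while 0 < k e <
  m e \<le> N.\<close>

lemma Lc_Tz_core:
  assumes "fact_pair (Suc n) d a G H" "Irr n" "n \<ge> 3"
  defines "d' \<equiv> Gcd ((\<lambda>j. a j - a (n - 1)) ` {..<n})"
  defines "d'' \<equiv> Gcd ((\<lambda>j. a (Suc j)) ` {..<n})"
  defines "N \<equiv> a (Suc 0) - a (n - 1)"
  assumes "(n - 1) * d' \<le> N" "(n - 1) * d'' \<le> N" "d' > 0" "d'' > 0"
    and "LM ({..n} - {n - 1}) (Zr d'' d) False (Lc (n - 1) H)"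
    and "LM ({..n} - {n}) (Zr d' d) True (Tz n G)"
  shows False
proof -
  obtain m where n: "n = Suc m" using assms(3) by (cases n) auto
  have m: "m \<ge> 2" using assms(3) n by simp
  define Q where "Q = a m"
  note f = fact_pairD[OF assms(1), simplified diff_Suc_1]
  have "2 * d' \<le> (n - 1) * d'" using m n by simp
  hence N0: "N > 0" using assms(7,9) by linarith
  obtain \<omega> :: complex where w: "\<And>k. \<omega> ^ k = 1 \<longleftrightarrow> N dvd k" by (rule primitive_root[OF N0]) blast
  have w0: "\<omega> \<noteq> 0" using w[of N] N0 by (auto simp: power_0_left)
  \<comment> \<open>Coordinate m disappears with \<open>Lc m\<close>, so 1 is an arbitrary choice;
    coordinate n is 0 so that \<open>Tz n\<close> can be inserted freely.\<close>
  define y where "y = (\<lambda>v. if v < m then \<omega> ^ v else if v = m then 1 else 0)"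
  have sep: "(\<omega> ^ u) ^ e \<noteq> (\<omega> ^ v) ^ e" if uv: "u < m" "v < m" "u \<noteq> v" and e: "(n - 1) * e \<le> N" "e > 0" for u v e
  proof -
    have *: "(\<omega> ^ u) ^ e \<noteq> (\<omega> ^ v) ^ e" if "u < v" "v < m" for u v
    proof
      assume "(\<omega> ^ u) ^ e = (\<omega> ^ v) ^ e"
      hence "\<omega> ^ (u * e) = \<omega> ^ (v * e)" by (simp add: power_mult)
      also have "v * e = u * e + (v - u) * e" using that(1) by (simp flip: distrib_right)
      finally have "\<omega> ^ (u * e) * 1 = \<omega> ^ (u * e) * \<omega> ^ ((v - u) * e)"
        by (simp add: power_add)
      hence "\<omega> ^ ((v - u) * e) = 1" using w0 by simp
      hence "N dvd (v - u) * e" using w by simp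
      hence "N \<le> (v - u) * e" using that e by (intro dvd_imp_le) auto
      moreover have "(v - u) * e < m * e" using that e by simp
      moreover have "m * e \<le> N" using e n by simp
      ultimately show False by linarith
    qed
    show ?thesis using *[of u v] *[of v u] uv by (metis nat_neq_iff)
  qed
  have sep': "y u \<noteq> z * y v" if uv: "u < m" "v < m" "u \<noteq> v" and e: "(n - 1) * e \<le> N" "e > 0" and z: "z \<in> Zr e d" for u v e z
  proof
    assume "y u = z * y v"
    hence "y u ^ e = y v ^ e" using z by (simp add: power_mult_distrib Zr_def)
    thus False using sep[OF uv e] uv by (simp add: y_def)
  qed
  have ynz: "y u \<noteq> 0" if "u < n" for u using that n w0 by (auto simp: y_def add.commute)
  have z0: "z \<noteq> 0" if "z \<in> Zr e d" "e > 0" for z e using that by (auto simp: Zr_def power_0_left)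
  have nm: "n - 1 = m" using n by simp
  have "ev y (Lc m H) \<noteq> 0"
  proof (rule LM_nonzero_at[OF assms(11)[unfolded nm]])
    fix u v z assume uv: "u \<in> {..n} - {m}" "v \<in> {..n} - {m}" "u \<noteq> v" "z \<in> Zr d'' d"
    have z: "z \<noteq> 0" using z0[OF uv(4) assms(10)] .
    consider "u < m" "v < m" | "u = n" "v < m" | "u < m" "v = n"
      using uv n by fastforce
    thus "y u \<noteq> z * y v"
    proof cases
      case 1 thus ?thesis using sep'[OF _ _ uv(3) assms(8,10) uv(4)] by blast
    next
      case 2 thus ?thesis using z n ynz[of v] by (simp add: y_def)
    next
      case 3 thus ?thesis using z n ynz[of u] by (simp add: y_def)
    qed
  qed (simp add: n)
  moreover have "ev y (Tz n (Lc m H)) = ev y (Lc m H)"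
    by (rule ev_Tz_zero) (simp add: y_def n)
  moreover have "Tz n (Lc m H) = Lc m (Tz n H)"
    using Tz_Lc_nz[OF assms(1), of m n] n m by (intro Tz_Lc) auto
  ultimately have H: "ev y (Lc m (Tz n H)) \<noteq> 0" by simp
  have G: "ev y (Lc m (Tz n G)) \<noteq> 0"
  proof (rule LM_Lc_nonzero_at[OF assms(12)])
    fix u assume "u \<in> {..n} - {n}" thus "y u \<noteq> 0" using ynz by auto
  next
    show "0 \<notin> Zr d' d" using z0 assms(9) by blast
  next
    fix u v z assume uv: "u \<in> {..n} - {n}" "v \<in> {..n} - {n}" "u \<noteq> m" "v \<noteq> m" "u \<noteq> v" "z \<in> Zr d' d"
    hence "u < m" "v < m" using n by auto
    thus "y u \<noteq> z * y v" using sep'[OF _ _ uv(5) assms(7,9) uv(6)] by blast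
  qed
  have n2: "n \<ge> 2" using assms(3) by simp
  have st: "Tz n G * Tz n H * S n (drho n d) = (\<Prod>i<n. Var i ^ (Q - d)) * S n (\<lambda>j. a j - Q)"
    by (rule struct_Tz[OF assms(1,2) n2]) (simp add: Q_def n)
  have ge: "Q \<le> a j" if "j < n" for j
    using f(1) that unfolding Q_def n dec_def by (cases "j = m") (auto simp: less_imp_le)
  have dec1: "dec n (\<lambda>j. a j - Q)" by (rule dec_shift[OF dec_sub[OF f(1)] ge])
  have "Lc m (Tz n G) * Lc m (Tz n H) * Lc m (S n (drho n d)) =
      Lc m (\<Prod>i<n. Var i ^ (Q - d)) * Lc m (S n (\<lambda>j. a j - Q))"
    using arg_cong[OF st, of "Lc m"] by (simp add: Lc_mult)
  also have "Lc m (S n (drho n d)) = (-1) ^ m * S m (drho m d)"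
  proof -
    have "(\<lambda>j. drho (Suc m) d (Suc j)) = drho m d" by (auto simp: drho_def)
    thus ?thesis using Lc_S(1)[OF dec_drho[OF f(4)], of m] n by simp
  qed
  also have "Lc m (S n (\<lambda>j. a j - Q)) = (-1) ^ m * S m (\<lambda>j. a (Suc j) - Q)"
    using Lc_S(1)[of m "\<lambda>j. a j - Q"] dec1 n by simp
  finally have "(-1) ^ m * (Lc m (Tz n G) * Lc m (Tz n H) * S m (drho m d)) =
     (-1) ^ m * (Lc m (\<Prod>i<n. Var i ^ (Q - d)) * S m (\<lambda>j. a (Suc j) - Q))"
    by (simp only: mult_ac)
  hence "Lc m (Tz n G) * Lc m (Tz n H) * S m (drho m d) = Lc m (\<Prod>i<n. Var i ^ (Q - d)) * S m (\<lambda>j. a (Suc j) - Q)"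
    by simp
  hence "ev y (Lc m (Tz n G)) * ev y (Lc m (Tz n H)) * gd m y (drho m d) =
     ev y (Lc m (\<Prod>i<n. Var i ^ (Q - d))) * gd m y (\<lambda>j. a (Suc j) - Q)"
    by (metis ev_mult ev_S)
  moreover have "gd m y (\<lambda>j. a (Suc j) - Q) = 0"
    unfolding gd_eq_0_iff
  proof (intro exI[of _ "\<lambda>j. if j = 0 then 1 else if j = m - 1 then - 1 else 0"] conjI allI impI)
    show "\<exists>j<m. (if j = 0 then 1 else if j = m - 1 then - 1 else 0) \<noteq> (0 :: complex)"
      using m by (intro exI[of _ 0]) auto
    fix i assume i: "i < m"
    have "(\<Sum>j<m. (if j = 0 then 1 else if j = m - 1 then - 1 else 0) * y i ^ (a (Suc j) - Q))
      = (\<Sum>j\<in>{0, m - 1}. (if j = 0 then 1 else if j = m - 1 then - 1 else 0) * y i ^ (a (Suc j) - Q))"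
      using m by (intro sum.mono_neutral_right) auto
    also have "\<dots> = y i ^ N - 1"
      using m by (simp add: N_def Q_def n)
    also have "\<dots> = 0" using i w[of N] by (simp add: y_def) (metis mult.commute power_mult power_one)
    finally show "(\<Sum>j<m. (if j = 0 then 1 else if j = m - 1 then - 1 else 0) * y i ^ (a (Suc j) - Q)) = 0" .
  qed
  moreover have "gd m y (drho m d) \<noteq> 0"
  proof (rule gd_drho_nonzero)
    have "d dvd d'" unfolding d'_def
      using fact_pair_dvd[OF assms(1)] n by (intro Gcd_greatest) (auto intro!: dvd_diff_nat)
    hence dd: "d \<le> d'" using assms(9) by (intro dvd_imp_le)
    fix i j assume "i < j" "j < m"
    moreover have "(n - 1) * d \<le> N" using dd assms(7) by (meson mult_le_mono2 order.trans)
    ultimately show "y i ^ d \<noteq> y j ^ d" using sep[of i j d] f(4) by (simp add: y_def)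
  qed
  ultimately show False using G H by simp
qed

lemma Lc_Tz_excl:
  assumes "fact_pair (Suc n) d a G H" "Irr n" "n \<ge> 3" "i \<le> n" "j \<le> n" "i \<noteq> j"
  defines "d' \<equiv> Gcd ((\<lambda>j. a j - a (n - 1)) ` {..<n})"
  defines "d'' \<equiv> Gcd ((\<lambda>j. a (Suc j)) ` {..<n})"
  defines "N \<equiv> a (Suc 0) - a (n - 1)"
  assumes "(n - 1) * d' \<le> N" "(n - 1) * d'' \<le> N" "d' > 0" "d'' > 0"
  shows "\<not> (LM ({..n} - {i}) (Zr d'' d) False (Lc i H) \<and> LM ({..n} - {j}) (Zr d' d) True (Tz j G))"
proof
  assume LM: "LM ({..n} - {i}) (Zr d'' d) False (Lc i H) \<and> LM ({..n} - {j}) (Zr d' d) True (Tz j G)"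
  obtain \<rho> where r: "\<rho> permutes {..<Suc n}" "\<rho> i = n - 1" "\<rho> j = n" "bij \<rho>"
    by (rule perm_pair[of i "{..<Suc n}" j "n - 1" n]) (use assms(3-6) in auto)
  have im: "\<rho> ` ({..n} - {k}) = {..n} - {\<rho> k}" for k
    using permutes_image[OF r(1)] bij_is_inj[OF r(4)]
    by (simp add: image_set_diff lessThan_Suc_atMost)
  show False
  proof (rule Lc_Tz_core[OF fact_pair_pact[OF assms(1) r(1)] assms(2,3)])
    show "LM ({..n} - {n - 1}) (Zr (Gcd ((\<lambda>j. a (Suc j)) ` {..<n})) d) False (Lc (n - 1) (pact \<rho> H))"
      using LM_pact[OF conjunct1[OF LM] r(4)] Lc_pact[OF r(4), of i H] by (simp add: im r d''_def)
    show "LM ({..n} - {n}) (Zr (Gcd ((\<lambda>j. a j - a (n - 1)) ` {..<n})) d) True (Tz n (pact \<rho> G))"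
      using LM_pact[OF conjunct2[OF LM] r(4)] Tz_pact[OF r(4), of j G] by (simp add: im r d'_def)
  qed (use assms(10-) in \<open>simp_all add: d'_def d''_def N_def\<close>)
qed

text \<open>For homogeneous H, \<open>ev (unitv i) H\<close> is the coefficient of the pure power of
  x_i.\<close>

definition unitv :: "nat \<Rightarrow> nat \<Rightarrow> complex" where "unitv i = (\<lambda>v. if v = i then 1 else 0)"

text \<open>With all other variables 0, homogeneity leaves the pure power alone. A constant leading
  coefficient in x_i survives this specialisation.\<close>

lemma pure_power:
  assumes "homog k H" "Lc i H = emb c" "c \<noteq> 0" shows "ev (unitv i) H \<noteq> 0"
proof
  assume z: "ev (unitv i) H = 0"
  have "map_poly (ev (\<lambda>_. 0 :: complex)) (Theta i H) = ev (\<lambda>v. [:0, 1:] * emb (unitv i v)) H"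
    unfolding map_poly_Theta[OF ahom_ev] by (intro ev_cong) (auto simp: unitv_def)
  also have "\<dots> = 0"
    unfolding hom_scale[OF assms(1)] ev_mpoly_emb z by simp
  finally have "coeff (map_poly (ev (\<lambda>_. 0 :: complex)) (Theta i H)) (degree (Theta i H)) = 0" by simp
  thus False using assms(2,3) by (simp add: coeff_map_poly Lc_def)
qed

text \<open>Among the four variables 0, ..., 3 one index i differs from j, u and v. At the i-th unit
  vector the linear factor vanishes, but H does not. This is why three variables are treated
  separately.\<close>

lemma pure_no_lin:
  assumes "\<And>i. i \<le> n \<Longrightarrow> ev (unitv i) H \<noteq> 0" "j \<le> n" "n \<ge> 3"
    and "Tz j H = K * (\<Prod>t\<in>J. lin t)" "finite J"
  shows "J = {}"
proof (rule ccontr)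
  assume "J \<noteq> {}"
  then obtain u v z where t: "(u, v, z) \<in> J" by (metis ex_in_conv prod_cases3)
  have "\<not> {0, 1, 2, 3} \<subseteq> {j, u, v}"
  proof
    assume "{0, 1, 2, 3} \<subseteq> {j, u, v}"
    hence "card {0, 1, 2, 3 :: nat} \<le> card {j, u, v}" by (intro card_mono) auto
    also have "\<dots> \<le> 3" using card_length[of "[j, u, v]"] by simp
    finally show False by simp
  qed
  then obtain i where i: "i \<in> {0, 1, 2, 3}" "i \<notin> {j, u, v}" by blast
  have "ev (unitv i) (lin (u, v, z)) = 0" using i by (auto simp: ev_lin unitv_def)
  hence "ev (unitv i) (Tz j H) = 0" using t assms(5) by (auto simp: assms(4) ev_simps)
  moreover have "ev (unitv i) (Tz j H) = ev (unitv i) H"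
    by (rule ev_Tz_zero) (use i in \<open>auto simp: unitv_def\<close>)
  moreover have "i \<le> n" using i assms(3) by auto
  ultimately show False using assms(1) by simp
qed

lemma const_of_Tz:
  assumes "homog k H" "Tz j H = emb c" "c \<noteq> 0" shows "is_const H"
proof -
  have "homog k (emb c)" using hom_Tz[OF assms(1), of j] assms(2) by simp
  hence "k = 0" using assms(3) hom_emb_eq_0 by blast
  thus ?thesis using hom_0_emb assms(1) unfolding is_const_def by blast
qed

text \<open>A factor x_u - z x_v of \<open>Lc i H\<close> survives x_j = 0 for a fourth index j and
  must reappear in \<open>Lc i (Tz j H)\<close>. So z^d' = 1 besides z^d'' = 1, whence z^d = 1,
  which is excluded. Hence H contains all pure powers, its restriction to x_0 = 0 has no linear
  factors, and H is constant.\<close>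

lemma const_of_LM:
  assumes "fact_pair (Suc n) d a G H" "n \<ge> 3"
    and z: "\<And>z. z ^ d' = 1 \<Longrightarrow> z ^ d'' = 1 \<Longrightarrow> z ^ d = (1 :: complex)" and "d' > 0" "d'' > 0"
    and L: "\<And>i. i \<le> n \<Longrightarrow> LM ({..n} - {i}) (Zr d'' d) False (Lc i H)"
    and T: "\<And>i. i \<le> n \<Longrightarrow> LM ({..n} - {i}) (Zr d' d) True (Tz i H)"
  shows "is_const H"
proof -
  obtain k where k: "homog k H" using fact_pair_hom[OF fact_pair_swap[OF assms(1)]] by blast
  have pure: "ev (unitv i) H \<noteq> 0" if i: "i \<le> n" for i
  proof -
    obtain c J where c: "c \<noteq> 0" "finite J" "Lc i H = emb c * (\<Prod>t\<in>J. lin t)"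
     "\<And>u v z. (u, v, z) \<in> J \<Longrightarrow> u \<in> {..n} - {i} \<and> v \<in> {..n} - {i} \<and> (if u = v then False else z \<in> Zr d'' d)"
      using L[OF i] unfolding LM_def by blast
    have "J = {}"
    proof (rule ccontr)
      assume "J \<noteq> {}"
      then obtain u v z where t: "(u, v, z) \<in> J" by (metis ex_in_conv prod_cases3)
      hence uv: "u \<noteq> i" "v \<noteq> i" "u \<noteq> v" "z \<in> Zr d'' d" using c(4)[OF t] by (auto split: if_splits)
      have "\<not> {0, 1, 2, 3} \<subseteq> {i, u, v}"
      proof
        assume "{0, 1, 2, 3} \<subseteq> {i, u, v}"
        hence "card {0, 1, 2, 3 :: nat} \<le> card {i, u, v}" by (intro card_mono) auto
        also have "\<dots> \<le> 3" using card_length[of "[i, u, v]"] by simp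
        finally show False by simp
      qed
      then obtain j where j: "j \<in> {0, 1, 2, 3}" "j \<notin> {i, u, v}" by blast
      have jn: "j \<le> n" using j assms(2) by auto
      have nz: "norm z = 1" using uv(4) assms(5) norm_unity by (auto simp: Zr_def)
      \<comment> \<open>A point of x_u = z x_v with x_j = 0 whose other coordinates have distinct
        absolute values above 1, so that only this pair of coordinates can be related by a root of
        unity.\<close>
      define y where "y = (\<lambda>w. if w = u then z else if w = v then 1 else if w = j then 0 else of_nat w + 2)"
      have ny: "norm (y w) = (if w = u \<or> w = v then 1 else if w = j then 0 else of_nat w + 2)" for w
        using nz norm_of_nat[of "w + 2", where 'a=complex] by (auto simp: y_def add.commute)
      have "ev y (lin (u, v, z)) = 0" using uv by (simp add: ev_lin y_def)
      hence "ev y (Lc i H) = 0" using t c(2) by (auto simp: c(3) ev_simps)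
      moreover have "ev y (Tz j (Lc i H)) = ev y (Lc i H)"
        by (rule ev_Tz_zero) (use j in \<open>auto simp: y_def\<close>)
      moreover have "Tz j (Lc i H) = Lc i (Tz j H)"
        using Tz_Lc_nz[OF assms(1) _ i jn] assms(2) j by (intro Tz_Lc) auto
      ultimately have "ev y (Lc i (Tz j H)) = 0" by simp
      moreover have "ev y (Lc i (Tz j H)) \<noteq> 0"
      proof (rule LM_Lc_nonzero_at[OF T[OF jn]])
        fix w assume "w \<in> {..n} - {j}"
        hence "norm (y w) \<noteq> 0" unfolding ny by auto
        thus "y w \<noteq> 0" by auto
      next
        show "0 \<notin> Zr d' d" using assms(4) by (auto simp: Zr_def power_0_left)
      next
        fix u' v' z'
        assume h: "u' \<in> {..n} - {j}" "v' \<in> {..n} - {j}" "u' \<noteq> i" "v' \<noteq> i" "u' \<noteq> v'" "z' \<in> Zr d' d"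
        show "y u' \<noteq> z' * y v'"
        proof
          assume eq: "y u' = z' * y v'"
          have "norm z' = 1" using h(6) assms(4) norm_unity by (auto simp: Zr_def)
          hence "norm (y u') = norm (y v')" using eq by (simp add: norm_mult)
          hence "(u' = u \<and> v' = v) \<or> (u' = v \<and> v' = u)"
            using h unfolding ny by (auto split: if_splits)
          hence "z ^ d' = 1"
          proof
            assume "u' = u \<and> v' = v"
            hence "z = z'" using eq uv by (simp add: y_def)
            thus ?thesis using h(6) by (simp add: Zr_def)
          next
            assume "u' = v \<and> v' = u"
            hence "1 = z' * z" using eq uv by (simp add: y_def)
            hence "1 = z' ^ d' * z ^ d'" by (metis power_mult_distrib power_one)
            thus ?thesis using h(6) by (simp add: Zr_def)
          qed
          thus False using z uv(4) by (auto simp: Zr_def)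
        qed
      qed
      ultimately show False by simp
    qed
    hence "Lc i H = emb c" using c by simp
    thus ?thesis using pure_power[OF k] c(1) by blast
  qed
  obtain c J where c: "c \<noteq> 0" "finite J" "Tz 0 H = emb c * (\<Prod>t\<in>J. lin t)"
    using T[of 0] unfolding LM_def by blast
  have "J = {}" by (rule pure_no_lin[OF pure _ assms(2) c(3,2)]) auto
  thus ?thesis using const_of_Tz[OF k, of 0 c] c by simp
qed

lemma root_gcd:
  fixes z :: "'a :: field"
  assumes "z ^ m = 1" "z ^ n = 1" shows "z ^ gcd m n = 1"
proof (cases "m = 0")
  case False
  obtain x y where "m * x = n * y + gcd m n" using bezout_nat[OF False] by blast
  hence "z ^ (m * x) = z ^ (n * y) * z ^ gcd m n" by (simp add: power_add)
  thus ?thesis using assms by (simp add: power_mult)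
qed (use assms in simp)

text \<open>gcd(d', d'') divides a_1, ..., a_n through d'', and then also a_0 = (a_0 - a_{n-1}) +
  a_{n-1}; so it divides d.\<close>

lemma unity_gcd:
  assumes "fact_pair (Suc n) d a G H" "n \<ge> 2"
    and "z ^ Gcd ((\<lambda>j. a j - a (n - 1)) ` {..<n}) = 1" "z ^ Gcd ((\<lambda>j. a (Suc j)) ` {..<n}) = (1 :: complex)"
  shows "z ^ d = 1"
proof -
  let ?d' = "Gcd ((\<lambda>j. a j - a (n - 1)) ` {..<n})" and ?d'' = "Gcd ((\<lambda>j. a (Suc j)) ` {..<n})"
  note f = fact_pairD[OF assms(1), simplified diff_Suc_1]
  have 1: "gcd ?d' ?d'' dvd a j" if "j \<le> n" for j
  proof (cases j)
    case (Suc k)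
    hence "?d'' dvd a j" using that by (auto intro!: Gcd_dvd)
    thus ?thesis by (meson dvd_trans gcd_dvd2)
  next
    case 0
    have "?d' dvd a 0 - a (n - 1)" using assms(2) by (auto intro!: Gcd_dvd)
    moreover have "a (Suc (n - 2)) \<in> (\<lambda>j. a (Suc j)) ` {..<n}" using assms(2) by (intro imageI) auto
    hence "?d'' dvd a (Suc (n - 2))" by (rule Gcd_dvd)
    hence "?d'' dvd a (n - 1)" using assms(2) by (simp add: Suc_diff_Suc numeral_2_eq_2)
    moreover have "a (n - 1) \<le> a 0" using f(1) assms(2) by (auto simp: dec_def less_imp_le)
    ultimately have "gcd ?d' ?d'' dvd (a 0 - a (n - 1)) + a (n - 1)"
      by (meson dvd_add dvd_trans gcd_dvd1 gcd_dvd2)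
    thus ?thesis using \<open>a (n - 1) \<le> a 0\<close> 0 by simp
  qed
  have "gcd ?d' ?d'' dvd d" unfolding f(3) using 1 by (intro Gcd_greatest) auto
  moreover have "z ^ gcd ?d' ?d'' = 1" using assms(3,4) by (rule root_gcd)
  ultimately show ?thesis by (auto simp: power_mult elim!: dvdE)
qed

lemma general_case:
  assumes "fact_pair (Suc n) d a G H" "Irr n" "n \<ge> 3"
  defines "d' \<equiv> Gcd ((\<lambda>j. a j - a (n - 1)) ` {..<n})"
  defines "d'' \<equiv> Gcd ((\<lambda>j. a (Suc j)) ` {..<n})"
  defines "N \<equiv> a (Suc 0) - a (n - 1)"
  assumes "(n - 1) * d' \<le> N" "(n - 1) * d'' \<le> N" "d' > 0" "d'' > 0"
  shows "is_const G \<or> is_const H"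
proof -
  have n2: "n \<ge> 2" using assms(3) by simp
  define eH dH eG dG where "eH = (\<lambda>i. LM ({..n} - {i}) (Zr d'' d) False (Lc i H))"
    and "dH = (\<lambda>i. LM ({..n} - {i}) (Zr d' d) True (Tz i H))"
    and "eG = (\<lambda>i. LM ({..n} - {i}) (Zr d'' d) False (Lc i G))"
    and "dG = (\<lambda>i. LM ({..n} - {i}) (Zr d' d) True (Tz i G))"
  note defs = eH_def dH_def eG_def dG_def
  have 1: "eG i \<or> eH i" "dG i \<or> dH i" if "i \<le> n" for i
    using Lc_LM[OF assms(1,2) n2 that] Tz_LM[OF assms(1,2) n2 that] by (simp_all add: defs d'_def d''_def)
  have 2: "\<not> (eH i \<and> dG j)" "\<not> (eG i \<and> dH j)" if "i \<le> n" "j \<le> n" "i \<noteq> j" for i j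
    using Lc_Tz_excl[OF assms(1,2,3) that] Lc_Tz_excl[OF fact_pair_swap[OF assms(1)] assms(2,3) that] assms(7-)
    by (simp_all add: defs d'_def d''_def N_def)
  \<comment> \<open>Here e and f are degeneracy of leading coefficients and of restrictions for one
    factor, e' and f' for the other. Then e 0 excludes f' j for j \<noteq> 0, so f j holds there.
    With three or more indices every i has some j \<noteq> 0, i, and f j excludes e' i, so e i
    holds. Finally e 1 yields f 0.\<close>
  have all: "(\<forall>i\<le>n. e i \<and> f i)"
    if h: "e 0" "\<And>i. i \<le> n \<Longrightarrow> e' i \<or> e i" "\<And>i. i \<le> n \<Longrightarrow> f' i \<or> f i"
      "\<And>i j. i \<le> n \<Longrightarrow> j \<le> n \<Longrightarrow> i \<noteq> j \<Longrightarrow> \<not> (e i \<and> f' j)"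
      "\<And>i j. i \<le> n \<Longrightarrow> j \<le> n \<Longrightarrow> i \<noteq> j \<Longrightarrow> \<not> (e' i \<and> f j)" for e e' f f' :: "nat \<Rightarrow> bool"
  proof -
    have f: "f j" if "j \<le> n" "j \<noteq> 0" for j using h(1) h(3)[of j] h(4)[of 0 j] that by auto
    have e: "e i" if "i \<le> n" for i
    proof -
      obtain j where "j \<noteq> 0" "j \<noteq> i" "j \<le> n" using assms(3) using that assms(3) by (cases "i = 1") (auto intro: that[of 1] that[of 2])
      thus ?thesis using h(2)[OF that] h(5)[of i j] f that by blast
    qed
    have "f 0" using h(3)[of 0] h(4)[of 1 0] e[of 1] assms(3) by auto
    thus ?thesis using e f by (metis (full_types))
  qed
  have zz: "z ^ d = 1" if "z ^ d' = 1" "z ^ d'' = 1" for z :: complex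
    using unity_gcd[OF assms(1) n2] that by (simp add: d'_def d''_def)
  show ?thesis
  proof (cases "eH 0")
    case True
    have "\<forall>i\<le>n. eH i \<and> dH i" using 1 2 by (intro all[of eH eG dG dH] True) auto
    hence "is_const H" using const_of_LM[OF assms(1,3) zz assms(9,10)] by (simp add: defs)
    thus ?thesis ..
  next
    case False
    hence "eG 0" using 1(1)[of 0] by auto
    hence "\<forall>i\<le>n. eG i \<and> dG i" using 1 2 by (intro all[of eG eH dH dG]) auto
    hence "is_const G" using const_of_LM[OF fact_pair_swap[OF assms(1)] assms(3) zz assms(9,10)] by (simp add: defs)
    thus ?thesis ..
  qed
qed

section \<open>Three variables\<close>

lemma drho_case:
  assumes "fact_pair r d a G H" "\<And>j. j < r \<Longrightarrow> a j = drho r d j"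
  shows "is_const G" "is_const H"
proof -
  have "G * H * S r a = 1 * S r a"
    using fact_pairD(7)[OF assms(1)] S_cong[of r a "drho r d"] assms(2) by simp
  hence 1: "G * H = emb 1" using S_nonzero[OF fact_pairD(1)[OF assms(1)]] by simp
  show "is_const G" "is_const H"
    using emb_factor[OF 1] emb_factor[of H G 1] 1 by (auto simp: is_const_def mult.commute)
qed

text \<open>In two variables a = (d, 0) is d rho itself.\<close>

lemma Irr_2: "Irr 2"
  unfolding Irr_def
proof (intro allI impI)
  fix d a G H assume f: "fact_pair 2 d a G H"
  have "{..<2 :: nat} = {0, 1}" by auto
  hence "d = a 0" "a 1 = 0" using fact_pairD(2,3)[OF f] by auto
  hence "a j = drho 2 d j" if "j < 2" for j
    using that by (auto simp: drho_def less_Suc_eq numeral_2_eq_2)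
  thus "is_const G \<or> is_const H" using drho_case(1)[OF f] by blast
qed

lemma gd2: "gd 2 y b = y 0 ^ b 0 * y 1 ^ b 1 - y 0 ^ b 1 * (y 1 ^ b 0 :: 'a :: comm_ring_1)"
proof -
  have "gd 0 y c = 1" for c by (simp add: gd_def)
  hence 1: "gd (Suc 0) y c = y 0 ^ c 0" for c by (simp add: gd_expand)
  show ?thesis unfolding numeral_2_eq_2 gd_expand[of "Suc 0"] 1
    by (simp add: skip_def algebra_simps)
qed

lemma gd3: "gd 3 y b = y 0 ^ b 0 * (y 1 ^ b 1 * y 2 ^ b 2 - y 1 ^ b 2 * y 2 ^ b 1)
    - y 0 ^ b 1 * (y 1 ^ b 0 * y 2 ^ b 2 - y 1 ^ b 2 * y 2 ^ b 0)
    + y 0 ^ b 2 * (y 1 ^ b 0 * y 2 ^ b 1 - y 1 ^ b 1 * (y 2 ^ b 0 :: 'a :: comm_ring_1))"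
proof -
  have "gd 3 y b = gd (Suc 2) y b" by (simp add: numeral_3_eq_3 numeral_2_eq_2)
  also have "\<dots> = (\<Sum>k\<le>2. y 2 ^ b k * ((-1) ^ (2 + k) * gd 2 y (skip k b)))" by (rule gd_expand)
  also have "{..2 :: nat} = {0, 1, 2}" by auto
  finally have "gd 3 y b = y 2 ^ b 0 * gd 2 y (skip 0 b) - y 2 ^ b 1 * gd 2 y (skip 1 b) + y 2 ^ b 2 * gd 2 y (skip 2 b)"
    by simp
  thus ?thesis unfolding gd2 by (simp add: skip_def algebra_simps numeral_2_eq_2)
qed

lemma drho3: "drho 3 d 0 = 2 * d" "drho 3 d 1 = d" "drho 3 d (Suc 0) = d" "drho 3 d 2 = 0"
  by (simp_all add: drho_def)

lemma fact_pair3: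
  assumes "fact_pair 3 d a G H"
  shows "a 1 < a 0" "0 < a 1" "a 2 = 0" "d = gcd (a 0) (a 1)" "d dvd a 0" "d dvd a 1" "d \<le> a 1" "d > 0"
proof -
  note f = fact_pairD[OF assms]
  show 1: "a 1 < a 0" "0 < a 1" "a 2 = 0"
    using f(1)[unfolded dec_def, rule_format, of 0 1] f(1)[unfolded dec_def, rule_format, of 1 2] f(2)
    by simp_all
  have "{..<3 :: nat} = {0, 1, 2}" by auto
  thus 2: "d = gcd (a 0) (a 1)" using f(3) 1 by simp
  show "d dvd a 0" "d dvd a 1" "d > 0" using 2 f by simp_all
  thus "d \<le> a 1" using 1 by (intro dvd_imp_le) auto
qed

lemma fact_pair_ev:
  assumes "fact_pair r d a G H"
  shows "ev Y G * ev Y H * gd r Y (drho r d) = gd r Y a"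
  using arg_cong[OF fact_pairD(7)[OF assms], of "ev Y"] by (simp add: ev_mult ev_S)

definition pt3 :: "complex \<Rightarrow> nat \<Rightarrow> complex poly" where
  "pt3 z = (\<lambda>i. if i = 2 then [:0, 1:] else [:if i = 0 then z else 1:])"

lemma ev_pt3: "ev (pt3 z) P = map_poly (ev (\<lambda>i. if i = 0 then z else 1)) (Theta 2 P)"
  unfolding map_poly_Theta[OF ahom_ev] pt3_def by (intro ev_cong) auto

lemma ev_pt3_0: "poly (ev (pt3 z) P) 0 = ev (\<lambda>i. if i = 0 then z else if i = 2 then 0 else 1) P"
  unfolding ahom_ev_comp[OF ahom_poly] by (intro ev_cong) (auto simp: pt3_def)

lemma degree_ev_pt3: "degree (ev (pt3 z) P) \<le> degree (Theta 2 P)"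
  unfolding ev_pt3 by (rule map_poly_degree_leq)

text \<open>A trinomial in x_2 whose constant term is killed by z^(b_0 - b_1) = 1 and whose leading
  term is killed by z^(b_1) = 1. These are the roots of unity that occur on x_2 = 0 and in the
  leading coefficient.\<close>

lemma gd3_pt3:
  assumes "b 2 = 0"
  shows "gd 3 (pt3 z) b = monom (z ^ b 1 - 1) (b 0) - monom (z ^ b 0 - 1) (b 1) + [:z ^ b 0 - z ^ b 1:]"
proof -
  have "poly (gd 3 (pt3 z) b) x =
      poly (monom (z ^ b 1 - 1) (b 0) - monom (z ^ b 0 - 1) (b 1) + [:z ^ b 0 - z ^ b 1:]) x" for x
    unfolding ahom_gd[OF ahom_poly] gd3 using assms by (simp add: pt3_def poly_monom algebra_simps)
  thus ?thesis by (simp add: poly_eq_poly_eq_iff[symmetric] fun_eq_iff)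
qed

lemma struct_Tz3:
  assumes "fact_pair 3 d a G H"
  defines "I \<equiv> (Lset 2 (a 0 - a 1) - Lset 2 d) \<union> Mset 2 (a 1 - d)"
  obtains J c c' where "J \<subseteq> I" "finite I" "c \<noteq> 0" "c' \<noteq> 0"
    "Tz 2 G = emb c * (\<Prod>t\<in>J. lin t)" "Tz 2 H = emb c' * (\<Prod>t\<in>I - J. lin t)"
proof -
  have s3: "Suc 2 = 3" and l2: "{..<2 :: nat} = {0, 1}" by auto
  have g: "Gcd ((\<lambda>j. a j - a (2 - 1)) ` {..<2}) = a 0 - a 1" by (simp add: l2)
  have I2: "I = (Lset 2 (a 0 - a 1) - Lset 2 d) \<union> Mset 2 (a (2 - 1) - d)" by (simp add: I_def)
  obtain C J A B k where *: "C * S 2 (drho 2 (a 0 - a 1)) = S 2 (\<lambda>j. a j - a (2 - 1))" "J \<subseteq> I" "finite I"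
    "Tz 2 G = A * (\<Prod>t\<in>J. lin t)" "Tz 2 H = B * (\<Prod>t\<in>I - J. lin t)" "A * B = emb k * C" "k \<noteq> 0"
    "a 0 - a 1 > 0"
    by (rule struct_Tz[of 2 d a G H, unfolded s3 g, folded I2, OF assms(1) Irr_2 order_refl]) (rule that; assumption)
  have "S 2 (\<lambda>j. a j - a (2 - 1)) = S 2 (drho 2 (a 0 - a 1))"
    by (intro S_cong) (auto simp: drho_def less_Suc_eq numeral_2_eq_2)
  hence "C = 1" using *(1) S_nonzero[OF dec_drho[OF *(8)], of 2] by simp
  hence AB: "A * B = emb k" "B * A = emb k" using *(6) by (simp_all add: mult.commute)
  obtain c c' where "A = emb c" "B = emb c'" "c \<noteq> 0" "c' \<noteq> 0"
    using emb_factor[OF AB(1) *(7)] emb_factor[OF AB(2) *(7)] by blast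
  thus ?thesis using that * by blast
qed

lemma struct_Lc3:
  assumes "fact_pair 3 d a G H"
  defines "I \<equiv> Lset 2 (a 1) - Lset 2 d"
  obtains J c c' where "J \<subseteq> I" "finite I" "c \<noteq> 0" "c' \<noteq> 0"
    "Lc 2 G = emb c * (\<Prod>t\<in>J. lin t)" "Lc 2 H = emb c' * (\<Prod>t\<in>I - J. lin t)"
proof -
  have s3: "Suc 2 = 3" and l2: "{..<2 :: nat} = {0, 1}" by auto
  note f = fact_pair3[OF assms(1)]
  have g: "Gcd ((\<lambda>j. a (Suc j)) ` {..<2}) = a 1"
    using f(3) unfolding l2 by (simp add: numeral_2_eq_2)
  obtain C J A B k where *: "C * S 2 (drho 2 (a 1)) = S 2 (\<lambda>j. a (Suc j))" "J \<subseteq> I" "finite I"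
    "Lc 2 G = A * (\<Prod>t\<in>J. lin t)" "Lc 2 H = B * (\<Prod>t\<in>I - J. lin t)" "A * B = emb k * C" "k \<noteq> 0"
    "a 1 > 0"
    by (rule struct_Lc[of 2 d a G H, unfolded s3 g, folded I_def, OF assms(1) Irr_2 order_refl]) (rule that; assumption)
  have "S 2 (\<lambda>j. a (Suc j)) = S 2 (drho 2 (a 1))"
    using f(3) by (intro S_cong) (auto simp: drho_def less_Suc_eq numeral_2_eq_2)
  hence "C = 1" using *(1) S_nonzero[OF dec_drho[OF *(8)], of 2] by simp
  hence AB: "A * B = emb k" "B * A = emb k" using *(6) by (simp_all add: mult.commute)
  obtain c c' where "A = emb c" "B = emb c'" "c \<noteq> 0" "c' \<noteq> 0"
    using emb_factor[OF AB(1) *(7)] emb_factor[OF AB(2) *(7)] by blast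
  thus ?thesis using that * by blast
qed

section \<open>Both gaps different from d: the Newton polygon of C is a hexagon\<close>

lemma Lset2: "(u, v, z) \<in> Lset 2 e \<longleftrightarrow> u = 0 \<and> v = 1 \<and> z ^ e = 1"
  by (auto simp: Lset_def)

lemma Mset2: "(u, v, z) \<in> Mset 2 k \<Longrightarrow> u = v \<and> u < 2"
  by (auto simp: Mset_def)

lemma no_other_root:
  assumes "J \<subseteq> (Lset 2 e - Lset 2 d) \<union> Mset 2 k" "finite J" "(0, 1, z) \<notin> J" "z \<noteq> 0" "x 0 = z" "x 1 = 1"
  shows "ev x (\<Prod>t\<in>J. lin t) \<noteq> (0 :: complex)"
proof -
  have "ev x (lin t) \<noteq> 0" if "t \<in> J" for t
  proof -
    obtain u v w where t: "t = (u, v, w)" by (cases t)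
    have "(u, v, w) \<in> Lset 2 e \<or> (u, v, w) \<in> Mset 2 k" using that assms(1) t by blast
    thus ?thesis
    proof
      assume "(u, v, w) \<in> Lset 2 e"
      hence uv: "u = 0" "v = 1" by (auto simp: Lset2)
      hence "w \<noteq> z" using that assms(3) t by auto
      thus ?thesis using uv assms(5,6) by (simp add: t ev_lin)
    next
      assume "(u, v, w) \<in> Mset 2 k"
      hence "u = v" "u = 0 \<or> u = 1" using Mset2[of u v w k] by auto
      thus ?thesis using assms(4-6) by (auto simp: t ev_lin)
    qed
  qed
  thus ?thesis using assms(2) by (simp add: ev_simps)
qed

text \<open>On the line x_0 = z, x_1 = 1 the determinant S(a) has order exactly a_1 at x_2 = 0, and
  S(d rho) has order 0 as z^d \<noteq> 1. Since G does not vanish there, H accounts for the whole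
  order.\<close>

lemma Tz_root_degree:
  assumes "fact_pair 3 d a G H" "z ^ (a 0 - a 1) = 1" "z ^ d \<noteq> 1"
    and "ev (\<lambda>i. if i = 0 then z else if i = 2 then 0 else 1) G \<noteq> (0 :: complex)"
  shows "a 1 \<le> degree (Theta 2 H)"
proof -
  note f = fact_pair3[OF assms(1)]
  let ?g = "ev (pt3 z) G" and ?h = "ev (pt3 z) H" and ?w = "gd 3 (pt3 z) (drho 3 d)"
  have z0: "z \<noteq> 0" using assms(2) f(1) by (auto simp: power_0_left)
  have "z ^ a 0 = z ^ (a 0 - a 1) * z ^ a 1" using f(1) by (simp flip: power_add)
  hence za: "z ^ a 0 = z ^ a 1" using assms(2) by simp
  have z1: "z ^ a 1 \<noteq> 1"
  proof
    assume z1: "z ^ a 1 = 1"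
    hence "z ^ gcd (a 0) (a 1) = 1" using za by (intro root_gcd) auto
    thus False using assms(3) f(4) by simp
  qed
  have eq: "?g * ?h * ?w = gd 3 (pt3 z) a" by (rule fact_pair_ev[OF assms(1)])
  also have "\<dots> = smult (z ^ a 1 - 1) (monom 1 (a 0) - monom 1 (a 1))"
    using f(3) by (simp add: gd3_pt3 za smult_diff_right smult_monom)
  also have "monom 1 (a 0) - monom 1 (a 1) = monom 1 (a 1) * (monom 1 (a 0 - a 1) - 1 :: complex poly)"
    using f(1) by (simp add: algebra_simps mult_monom)
  finally have eq': "?g * ?h * ?w = smult (z ^ a 1 - 1) (monom 1 (a 1) * (monom 1 (a 0 - a 1) - 1))" .
  have q: "poly (monom 1 (a 0 - a 1) - 1 :: complex poly) 0 \<noteq> 0"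
    using f(1) by (simp add: poly_monom power_0_left)
  hence q0: "(monom 1 (a 0 - a 1) - 1 :: complex poly) \<noteq> 0" by auto
  have "order 0 (?g * ?h * ?w) = a 1"
    unfolding eq' using z1 q0 q by (simp add: order_smult order_mult order_0I order_0_monom)
  moreover have nz: "?g * ?h * ?w \<noteq> 0" unfolding eq' using z1 q0 by simp
  moreover have "order 0 ?g = 0"
    using assms(4) by (intro order_0I) (simp add: ev_pt3_0)
  moreover have "order 0 ?w = 0"
  proof (rule order_0I)
    have "poly ?w 0 = z ^ (2 * d) - z ^ d"
      using f(8) by (simp add: gd3_pt3 drho3 poly_monom power_0_left)
    also have "\<dots> = z ^ d * (z ^ d - 1)" unfolding mult_2 power_add by (simp add: algebra_simps)
    finally show "poly ?w 0 \<noteq> 0" using z0 assms(3) by simp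
  qed
  ultimately have "order 0 ?h = a 1" by (auto simp: order_mult)
  hence "a 1 \<le> degree ?h" using order_degree[of ?h 0] nz by auto
  thus ?thesis using degree_ev_pt3 order.trans by blast
qed

lemma degree_Theta_sum3:
  assumes "fact_pair 3 d a G H"
  shows "degree (Theta 2 G) + degree (Theta 2 H) + 2 * d = a 0"
proof -
  have s3: "Suc 2 = 3" by simp
  note f = fact_pairD[OF assms]
  have "degree (Theta 2 (G * H * S 3 (drho 3 d))) = a 0"
    using Lc_S(2)[of 2 a, unfolded s3, OF f(1)] f(7) by simp
  moreover have "degree (Theta 2 (S 3 (drho 3 d))) = 2 * d"
    using Lc_S(2)[of 2 "drho 3 d", unfolded s3, OF dec_drho[OF f(4)]] by (simp add: drho3)
  moreover have "S 3 (drho 3 d) \<noteq> 0" by (rule S_nonzero[OF dec_drho[OF f(4)]])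
  ultimately show ?thesis using fact_pair_nz[OF assms]
    by (simp add: ahom_mult[OF ahom_Theta] degree_mult_eq)
qed

text \<open>The counterpart at infinity: on the line the degree of S(a) drops from a_0 to a_1.
  Neither G nor S(d rho) loses degree, so H accounts for the whole drop.\<close>

lemma Lc_root_degree:
  assumes "fact_pair 3 d a G H" "z ^ a 1 = 1" "z ^ d \<noteq> 1"
    and "ev (\<lambda>i. if i = 0 then z else 1) (Lc 2 G) \<noteq> (0 :: complex)"
  shows "a 0 - a 1 \<le> degree (Theta 2 H)"
proof -
  note f = fact_pair3[OF assms(1)]
  let ?g = "ev (pt3 z) G" and ?h = "ev (pt3 z) H" and ?w = "gd 3 (pt3 z) (drho 3 d)"
  have z1: "z ^ a 0 \<noteq> 1"
  proof
    assume z1: "z ^ a 0 = 1"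
    hence "z ^ gcd (a 0) (a 1) = 1" using assms(2) by (intro root_gcd) auto
    thus False using assms(3) f(4) by simp
  qed
  have eq: "?g * ?h * ?w = gd 3 (pt3 z) a" by (rule fact_pair_ev[OF assms(1)])
  also have "\<dots> = smult (1 - z ^ a 0) (monom 1 (a 1) - 1)"
    unfolding gd3_pt3[of a, OF f(3)] assms(2)
    by (simp add: poly_eq_poly_eq_iff[symmetric] fun_eq_iff poly_monom algebra_simps)
  finally have eq': "?g * ?h * ?w = smult (1 - z ^ a 0) (monom 1 (a 1) - 1)" .
  have dq: "degree (monom 1 (a 1) - 1 :: complex poly) = a 1"
    using f(2) degree_add_eq_left[of "- 1" "monom 1 (a 1) :: complex poly"] by (simp add: degree_monom_eq)
  hence "degree (?g * ?h * ?w) = a 1" unfolding eq' using z1 by simp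
  moreover have nz: "?g * ?h * ?w \<noteq> 0" unfolding eq' using z1 dq f(2) by auto
  moreover have "degree ?g = degree (Theta 2 G)"
    unfolding ev_pt3 using assms(4) by (intro map_poly_degree_eq) (simp add: Lc_def)
  moreover have "2 * d \<le> degree ?w"
  proof (rule le_degree)
    show "coeff ?w (2 * d) \<noteq> 0"
      using f(8) assms(3) by (simp add: gd3_pt3 drho3 coeff_pCons split: nat.splits)
  qed
  ultimately have "degree (Theta 2 G) + degree ?h + 2 * d \<le> a 1"
    by (auto simp: degree_mult_eq)
  thus ?thesis using degree_Theta_sum3[OF assms(1)] by linarith
qed

text \<open>For homogeneous K the Newton polygon of K touches the side x_i = 0 in a single point and
  contains the opposite vertex.\<close>

definition monoat :: "nat \<Rightarrow> mpoly \<Rightarrow> bool" where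
  "monoat i K \<longleftrightarrow> LM ({..2} - {i}) {} True (Tz i K) \<and> ev (unitv i) K \<noteq> 0"

text \<open>A binomial factor on x_2 = 0 forces degree at least a_1 in x_2, one in the leading
  coefficient at least a_0 - a_1. The degrees of G and H sum to a_0 - 2d, so both kinds belong to
  the same factor, and the other factor has neither. Both kinds occur because no gap equals
  d.\<close>

lemma hexagon_last:
  assumes "fact_pair 3 d a G H" "a 0 - a 1 \<noteq> d" "a 1 \<noteq> d"
  shows "monoat 2 G \<or> monoat 2 H"
proof -
  note f = fact_pair3[OF assms(1)]
  let ?IT = "(Lset 2 (a 0 - a 1) - Lset 2 d) \<union> Mset 2 (a 1 - d)"
  let ?IL = "Lset 2 (a 1) - Lset 2 d"
  obtain J c c' where T: "J \<subseteq> ?IT" "finite ?IT" "c \<noteq> 0" "c' \<noteq> 0"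
    "Tz 2 G = emb c * (\<Prod>t\<in>J. lin t)" "Tz 2 H = emb c' * (\<Prod>t\<in>?IT - J. lin t)"
    by (rule struct_Tz3[OF assms(1)])
  obtain K e e' where L: "K \<subseteq> ?IL" "finite ?IL" "e \<noteq> 0" "e' \<noteq> 0"
    "Lc 2 G = emb e * (\<Prod>t\<in>K. lin t)" "Lc 2 H = emb e' * (\<Prod>t\<in>?IL - K. lin t)"
    by (rule struct_Lc3[OF assms(1)])
  have L': "?IL \<subseteq> (Lset 2 (a 1) - Lset 2 d) \<union> Mset 2 0" by (auto simp: Mset_def)
  have P0: "a 0 - a 1 > 0" using f(1) by simp
  have unz: "z \<noteq> 0" if "z ^ m = 1" "m > 0" for z :: complex and m using that by (auto simp: power_0_left)
  have tz: "ev (\<lambda>i. if i = 0 then z else if i = 2 then 0 else 1) (Tz 2 P) =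
      (ev (\<lambda>i. if i = 0 then z else if i = 2 then 0 else 1) P :: complex)" for z P
    by (rule ev_Tz_zero) simp
  define tG tH lG lH where "tG = (\<exists>z. (0, 1, z) \<in> J)" and "tH = (\<exists>z. (0, 1, z) \<in> ?IT - J)"
    and "lG = (\<exists>z. (0, 1, z) \<in> K)" and "lH = (\<exists>z. (0, 1, z) \<in> ?IL - K)"
  have IT: "z ^ (a 0 - a 1) = 1 \<and> z ^ d \<noteq> 1" if "(0, 1, z) \<in> ?IT" for z
    using that by (auto simp: Lset2 Mset_def)
  have IL: "z ^ a 1 = 1 \<and> z ^ d \<noteq> 1" if "(0, 1, z) \<in> ?IL" for z
    using that by (auto simp: Lset2)
  have tH: "a 1 \<le> degree (Theta 2 H)" if h: tH
  proof -
    obtain z where z: "(0, 1, z) \<in> ?IT - J" using h unfolding tH_def by blast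
    have "ev (\<lambda>i. if i = 0 then z else if i = 2 then 0 else 1) (\<Prod>t\<in>J. lin t) \<noteq> (0 :: complex)"
      by (rule no_other_root[OF T(1) finite_subset[OF T(1,2)] _ unz[OF conjunct1[OF IT] P0]]) (use z in auto)
    hence "ev (\<lambda>i. if i = 0 then z else if i = 2 then 0 else 1) G \<noteq> (0 :: complex)"
      using T(3) by (simp add: tz[of z G, symmetric] T(5) ev_simps)
    thus ?thesis using Tz_root_degree[OF assms(1)] IT[of z] z by blast
  qed
  have tG: "a 1 \<le> degree (Theta 2 G)" if h: tG
  proof -
    obtain z where z: "(0, 1, z) \<in> J" using h unfolding tG_def by blast
    hence zI: "(0, 1, z) \<in> ?IT" using T(1) by blast
    have "ev (\<lambda>i. if i = 0 then z else if i = 2 then 0 else 1) (\<Prod>t\<in>?IT - J. lin t) \<noteq> (0 :: complex)"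
      by (rule no_other_root[OF Diff_subset finite_Diff[OF T(2)] _ unz[OF conjunct1[OF IT[OF zI]] P0]]) (use z in auto)
    hence "ev (\<lambda>i. if i = 0 then z else if i = 2 then 0 else 1) H \<noteq> (0 :: complex)"
      using T(4) by (simp add: tz[of z H, symmetric] T(6) ev_simps)
    thus ?thesis using Tz_root_degree[OF fact_pair_swap[OF assms(1)]] IT[OF zI] by blast
  qed
  have lH: "a 0 - a 1 \<le> degree (Theta 2 H)" if h: lH
  proof -
    obtain z where z: "(0, 1, z) \<in> ?IL - K" using h unfolding lH_def by blast
    have "ev (\<lambda>i. if i = 0 then z else 1) (\<Prod>t\<in>K. lin t) \<noteq> (0 :: complex)"
      by (rule no_other_root[OF order.trans[OF L(1) L'] finite_subset[OF L(1,2)] _ unz[OF conjunct1[OF IL] f(2)]]) (use z in auto)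
    hence "ev (\<lambda>i. if i = 0 then z else 1) (Lc 2 G) \<noteq> (0 :: complex)"
      using L(3) unfolding L(5) by (simp add: ev_simps)
    thus ?thesis using Lc_root_degree[OF assms(1)] IL[of z] z by blast
  qed
  have lG: "a 0 - a 1 \<le> degree (Theta 2 G)" if h: lG
  proof -
    obtain z where z: "(0, 1, z) \<in> K" using h unfolding lG_def by blast
    hence zI: "(0, 1, z) \<in> ?IL" using L(1) by blast
    have "ev (\<lambda>i. if i = 0 then z else 1) (\<Prod>t\<in>?IL - K. lin t) \<noteq> (0 :: complex)"
      by (rule no_other_root[OF order.trans[OF Diff_subset L'] finite_Diff[OF L(2)] _ unz[OF conjunct1[OF IL[OF zI]] f(2)]]) (use z in auto)
    hence "ev (\<lambda>i. if i = 0 then z else 1) (Lc 2 H) \<noteq> (0 :: complex)"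
      using L(4) unfolding L(6) by (simp add: ev_simps)
    thus ?thesis using Lc_root_degree[OF fact_pair_swap[OF assms(1)]] IL[OF zI] by blast
  qed
  have prim: "\<exists>z :: complex. z ^ m = 1 \<and> z ^ d \<noteq> 1" if h: "d dvd m" "m \<noteq> d" "m > 0" for m
  proof -
    obtain w :: complex where w: "\<And>k. w ^ k = 1 \<longleftrightarrow> m dvd k" by (rule primitive_root[OF h(3)]) blast
    have "\<not> m dvd d" using h by (auto dest: dvd_antisym)
    thus ?thesis by (intro exI[of _ w]) (simp add: w)
  qed
  have "d dvd a 0 - a 1" using f(5,6) by (rule dvd_diff_nat)
  then obtain z where "z ^ (a 0 - a 1) = 1" "z ^ d \<noteq> (1 :: complex)" using prim[OF _ assms(2) P0] by blast
  hence "(0, 1, z) \<in> ?IT" by (auto simp: Lset2)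
  hence t: "tG \<or> tH" unfolding tG_def tH_def by blast
  obtain z where "z ^ a 1 = 1" "z ^ d \<noteq> (1 :: complex)" using prim[OF f(6) assms(3) f(2)] by blast
  hence "(0, 1, z) \<in> ?IL" by (auto simp: Lset2)
  hence l: "lG \<or> lH" unfolding lG_def lH_def by blast
  have sum: "degree (Theta 2 G) + degree (Theta 2 H) < a 0"
    using degree_Theta_sum3[OF assms(1)] f(8) by linarith
  have ex: "\<not> (tG \<and> lH)" "\<not> (tH \<and> lG)" using tG tH lG lH sum f(1) by force+
  have fin: "monoat 2 P"
    if P: "homog k P" "Tz 2 P = emb q * (\<Prod>t\<in>M. lin t)" "M \<subseteq> ?IT" "q \<noteq> 0" "\<And>z. (0, 1, z) \<notin> M"
      "Lc 2 P = emb q' * (\<Prod>t\<in>N. lin t)" "N \<subseteq> ?IL" "q' \<noteq> 0" "\<And>z. (0, 1, z) \<notin> N" for P q q' M N k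
  proof -
    have "N = {}"
    proof (rule ccontr)
      assume "N \<noteq> {}"
      then obtain u v z where "(u, v, z) \<in> N" by (metis ex_in_conv prod_cases3)
      thus False using P(7) P(9)[of z] by (auto simp: Lset2)
    qed
    hence "ev (unitv 2) P \<noteq> 0" using pure_power[OF P(1)] P(6,8) by simp
    moreover
    have m: "u \<in> {..2} - {2} \<and> v \<in> {..2} - {2} \<and> (if u = v then True else z \<in> {})"
      if "(u, v, z) \<in> M" for u v and z :: complex
    proof -
      have "(u, v, z) \<notin> Lset 2 (a 0 - a 1)" using that P(5) by (auto simp: Lset2)
      hence "(u, v, z) \<in> Mset 2 (a 1 - d)" using that P(3) by blast
      thus ?thesis using Mset2 by fastforce
    qed
    have "LM ({..2} - {2}) {} True (Tz 2 P)"
      by (rule LM_of_prod[OF P(2) _ finite_subset[OF P(3) T(2)] m])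
         (use P(4) prod_lin_nonzero[OF finite_subset[OF P(3) T(2)]] in \<open>auto simp: P(2)\<close>)
    ultimately show ?thesis by (simp add: monoat_def)
  qed
  obtain k where k: "homog k G" by (rule fact_pair_hom[OF assms(1)])
  obtain k' where k': "homog k' H" by (rule fact_pair_hom[OF fact_pair_swap[OF assms(1)]])
  show ?thesis
  proof (cases tG)
    case True
    hence "\<not> lH" "lG" using ex l by auto
    hence "\<not> tH" using ex by auto
    hence "monoat 2 H" using \<open>\<not> lH\<close> fin[OF k' T(6) _ T(4) _ L(6) _ L(4)] unfolding tH_def lH_def by blast
    thus ?thesis ..
  next
    case False
    hence "\<not> lG" using ex t by auto
    hence "monoat 2 G" using False fin[OF k T(5,1,3) _ L(5,1,3)] unfolding tG_def lG_def by blast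
    thus ?thesis ..
  qed
qed

lemma monoat_pact:
  assumes "monoat i K" "\<rho> permutes {..<3}"
  shows "monoat (\<rho> i) (pact \<rho> K)"
proof -
  have b: "bij \<rho>" using assms(2) permutes_bij by blast
  have e: "{..2} = {..<3 :: nat}" by auto
  have "\<rho> ` ({..2} - {i}) = {..2} - {\<rho> i}"
    using permutes_image[OF assms(2)] bij_is_inj[OF b] by (simp add: image_set_diff e)
  hence "LM ({..2} - {\<rho> i}) {} True (Tz (\<rho> i) (pact \<rho> K))"
    using LM_pact[of _ _ _ "Tz i K", OF _ b] assms(1) by (simp add: monoat_def Tz_pact[OF b]) metis
  moreover have "ev (unitv (\<rho> i)) (pact \<rho> K) = ev (unitv i) K"
    unfolding ev_pact using b by (intro ev_cong) (auto simp: unitv_def bij_def inj_eq)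
  ultimately show ?thesis using assms(1) by (simp add: monoat_def)
qed

lemma hexagon_any:
  assumes "fact_pair 3 d a G H" "a 0 - a 1 \<noteq> d" "a 1 \<noteq> d" "i \<le> 2"
  shows "monoat i G \<or> monoat i H"
proof -
  define \<rho> where "\<rho> = Transposition.transpose i 2"
  have s3: "Suc 2 = 3" by simp
  note r = swap_last[OF assms(4), folded \<rho>_def, unfolded s3]
  have bk: "monoat i P" if "monoat 2 (pact \<rho> P)" for P
    using monoat_pact[OF that r(1)] by (simp add: r pact_pact pact_id)
  show ?thesis using hexagon_last[OF fact_pair_pact[OF assms(1) r(1)] assms(2,3)] bk by blast
qed

text \<open>The pure power of x_j survives x_i = 0, so no other variable enters the
  monomial.\<close>

lemma monoat_power:
  assumes "monoat i K" "ev (unitv j) K \<noteq> 0" "i \<noteq> j"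
  obtains c k where "c \<noteq> 0" "Tz i K = emb c * Var j ^ k"
proof -
  obtain c J where c: "c \<noteq> 0" "finite J" "Tz i K = emb c * (\<Prod>t\<in>J. lin t)"
     "\<And>u v z. (u, v, z) \<in> J \<Longrightarrow> u \<in> {..2} - {i} \<and> v \<in> {..2} - {i} \<and> (if u = v then True else z \<in> {})"
    using assms(1) unfolding monoat_def LM_def by blast
  have "ev (unitv j) (Tz i K) = ev (unitv j) K"
    by (rule ev_Tz_zero) (use assms(3) in \<open>auto simp: unitv_def\<close>)
  hence nz: "ev (unitv j) (\<Prod>t\<in>J. lin t) \<noteq> 0" using assms(2) c(3) by (auto simp: ev_simps)
  have "lin t = Var j" if "t \<in> J" for t
  proof -
    obtain u v z where t: "t = (u, v, z)" by (cases t)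
    hence uv: "u = v" using c(4)[of u v z] that by (auto split: if_splits)
    have "ev (unitv j) (lin t) \<noteq> 0" using nz that c(2) by (auto simp: ev_simps)
    thus ?thesis using uv by (auto simp: t ev_lin unitv_def lin_def split: if_splits)
  qed
  hence "(\<Prod>t\<in>J. lin t) = Var j ^ card J" by simp
  thus ?thesis using that c by metis
qed

lemma Tz_ev_poly:
  assumes "Y i = 0" shows "ev (Y :: nat \<Rightarrow> 'a :: complex_alg) (Tz i P) = ev Y P"
  unfolding Tz_def ev_ev using assms by (intro ev_cong) (auto simp: ev_simps)

text \<open>If H is monomial on all three sides, its pure powers exclude any variable on x_2 = 0.
  Otherwise orders of vanishing along two sides determine three exponents, all equal to a_1 - d.
  Comparing total degrees gives a_0 = 2 a_1, hence d = a_1.\<close>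

lemma hexagon_01:
  assumes "fact_pair 3 d a G H" "a 1 \<noteq> d" "monoat 0 H" "monoat 1 H" "monoat 2 G \<or> monoat 2 H"
  shows "is_const H"
proof -
  note f = fact_pair3[OF assms(1)]
  obtain k where k: "homog k H" by (rule fact_pair_hom[OF fact_pair_swap[OF assms(1)]])
  obtain l where l: "homog l G" by (rule fact_pair_hom[OF assms(1)])
  have p0: "ev (unitv 0) H \<noteq> 0" and p1: "ev (unitv 1) H \<noteq> 0" using assms(3,4) by (auto simp: monoat_def)
  show ?thesis
  proof (cases "monoat 2 H")
    case True
    obtain c m where c: "c \<noteq> 0" "Tz 2 H = emb c * Var 0 ^ m"
      by (rule monoat_power[OF True p0]) auto
    have "ev (unitv 1) (Tz 2 H) = ev (unitv 1) H" by (rule ev_Tz_zero) (simp add: unitv_def)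
    hence "m = 0" using p1 by (auto simp: c ev_simps unitv_def power_0_left split: if_splits)
    thus ?thesis using const_of_Tz[OF k _ c(1), of 2] c(2) by simp
  next
    case False
    hence G: "monoat 2 G" using assms(5) by blast
    obtain c J where c: "c \<noteq> 0" "finite J" "Tz 2 G = emb c * (\<Prod>t\<in>J. lin t)"
     "\<And>u v z. (u, v, z) \<in> J \<Longrightarrow> u \<in> {..2} - {2} \<and> v \<in> {..2} - {2} \<and> (if u = v then True else z \<in> {})"
      using G unfolding monoat_def LM_def by blast
    define A where "A = {t \<in> J. fst t = 0}"
    have fin: "finite A" "finite (J - A)" using c(2) by (auto simp: A_def)
    have "lin t = Var 0" if "t \<in> A" for t
      using that c(4)[of "fst t" "fst (snd t)" "snd (snd t)"] by (auto simp: A_def lin_def split: if_splits prod.splits)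
    hence pA: "(\<Prod>t\<in>A. lin t) = Var 0 ^ card A" by simp
    have "lin t = Var 1" if "t \<in> J - A" for t
    proof -
      obtain u v z where t: "t = (u, v, z)" by (cases t)
      have "u = v" "u \<noteq> 0" "u < 2" using that c(4)[of u v z] by (auto simp: A_def t split: if_splits)
      hence "u = 1" by simp
      thus ?thesis using \<open>u = v\<close> by (simp add: t lin_def)
    qed
    hence pB: "(\<Prod>t\<in>J - A. lin t) = Var 1 ^ card (J - A)" by simp
    have "(\<Prod>t\<in>J. lin t) = (\<Prod>t\<in>J - A. lin t) * (\<Prod>t\<in>A. lin t)"
      by (rule prod.subset_diff) (auto simp: A_def c(2))
    hence TG: "Tz 2 G = emb c * Var 0 ^ card A * Var 1 ^ card (J - A)"
      unfolding c(3) pA pB by (simp add: mult_ac)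
    obtain e m where e: "e \<noteq> 0" "Tz 0 H = emb e * Var 1 ^ m"
      by (rule monoat_power[OF assms(3) p1]) auto
    let ?X = "[:0, 1:] :: complex poly"
    have ord: "order 0 (?X ^ p - ?X ^ q) = q" "?X ^ p - ?X ^ q \<noteq> 0" if "q < p" for p q
    proof -
      have s: "?X ^ p - ?X ^ q = monom 1 q * (monom 1 (p - q) - 1)"
        using that by (simp add: algebra_simps mult_monom monom_altdef[of 1, symmetric] flip: monom_altdef)
          (simp add: monom_altdef)
      have z: "poly (monom 1 (p - q) - 1 :: complex poly) 0 \<noteq> 0" using that by (simp add: poly_monom power_0_left)
      hence z': "(monom 1 (p - q) - 1 :: complex poly) \<noteq> 0" by auto
      show "?X ^ p - ?X ^ q \<noteq> 0" unfolding s using z' by simp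
      show "order 0 (?X ^ p - ?X ^ q) = q"
        unfolding s using z z' by (simp add: order_mult order_0I order_0_monom)
    qed
    have two: "d < 2 * d" using f(8) by simp
    \<comment> \<open>Y runs along a side of the coordinate triangle, where both determinants become
      binomials with a common sign \<epsilon>; the orders at X = 0 are a_1 and d.\<close>
    have main: "order 0 (ev Y G) + order 0 (ev Y H) + d = a 1"
      if "gd 3 Y (drho 3 d) = \<epsilon> * (?X ^ (2 * d) - ?X ^ d)" "gd 3 Y a = \<epsilon> * (?X ^ a 0 - ?X ^ a 1)" "\<epsilon> = 1 \<or> \<epsilon> = -1" for Y \<epsilon>
    proof -
      have "\<epsilon> * (ev Y G * ev Y H * (?X ^ (2 * d) - ?X ^ d)) = \<epsilon> * (?X ^ a 0 - ?X ^ a 1)"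
        using fact_pair_ev[OF assms(1), of Y] that(1,2) by (simp add: mult_ac)
      hence "ev Y G * ev Y H * (?X ^ (2 * d) - ?X ^ d) = ?X ^ a 0 - ?X ^ a 1"
        using that(3) by (subst (asm) mult_left_cancel) auto
      hence o: "order 0 (ev Y G * ev Y H * (?X ^ (2 * d) - ?X ^ d)) = a 1"
        and nz: "ev Y G * ev Y H * (?X ^ (2 * d) - ?X ^ d) \<noteq> 0"
        using ord[OF f(1)] by simp_all
      thus ?thesis using ord(1)[OF two] by (simp only: order_mult[OF nz]) (auto simp: order_mult)
    qed
    \<comment> \<open>At X = 0 these are the unit vectors 1, 0 and 2, where H, H and G respectively
      are nonzero. In each case the other factor takes the whole order a_1 - d.\<close>
    define Y0 where "Y0 = (\<lambda>i :: nat. if i = 0 then ?X else if i = 1 then 1 else 0)"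
    define Y1 where "Y1 = (\<lambda>i :: nat. if i = 1 then ?X else if i = 0 then 1 else 0)"
    define Y2 where "Y2 = (\<lambda>i :: nat. if i = 1 then ?X else if i = 2 then 1 else 0)"
    have a0: "a 0 > 0" and a00: "a 0 \<noteq> 0" and f20: "a (Suc 0) \<noteq> 0" using f(1,2) by simp_all
    have evp: "poly (ev Y P) 0 = ev (\<lambda>i. poly (Y i) 0) P" for Y :: "nat \<Rightarrow> complex poly" and P
      by (rule ahom_ev_comp[OF ahom_poly])
    have un: "(\<lambda>i. poly (Y0 i) 0) = unitv 1" "(\<lambda>i. poly (Y1 i) 0) = unitv 0" "(\<lambda>i. poly (Y2 i) 0) = unitv 2"
      by (auto simp: Y0_def Y1_def Y2_def unitv_def)
    have oX: "order 0 (emb q * ?X ^ p) = p" if "q \<noteq> 0" for p q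
      using that by (simp add: emb_poly_def order_smult flip: monom_altdef)
    have "order 0 (ev Y0 G) + order 0 (ev Y0 H) + d = a 1"
      by (rule main[of _ 1]) (simp_all add: gd3 drho3 Y0_def f a0 f20 a00 power_0_left)
    moreover have "order 0 (ev Y0 H) = 0"
      using p1 by (intro order_0I) (simp add: evp un)
    moreover have "ev Y0 G = ev Y0 (Tz 2 G)" by (rule Tz_ev_poly[symmetric]) (simp add: Y0_def)
    hence "order 0 (ev Y0 G) = card A" using oX[OF c(1)] by (simp add: TG ev_simps Y0_def)
    ultimately have A: "card A + d = a 1" by simp
    have "order 0 (ev Y1 G) + order 0 (ev Y1 H) + d = a 1"
      by (rule main[of _ "-1"]) (simp_all add: gd3 drho3 Y1_def f a0 f20 a00 power_0_left)
    moreover have "order 0 (ev Y1 H) = 0"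
      using p0 by (intro order_0I) (simp add: evp un)
    moreover have "ev Y1 G = ev Y1 (Tz 2 G)" by (rule Tz_ev_poly[symmetric]) (simp add: Y1_def)
    hence "order 0 (ev Y1 G) = card (J - A)" using oX[OF c(1)] by (simp add: TG ev_simps Y1_def)
    ultimately have B: "card (J - A) + d = a 1" by simp
    have "order 0 (ev Y2 G) + order 0 (ev Y2 H) + d = a 1"
      by (rule main[of _ 1]) (simp_all add: gd3 drho3 Y2_def f a0 f20 a00 power_0_left)
    moreover have "order 0 (ev Y2 G) = 0"
      using G by (intro order_0I) (simp add: evp un monoat_def)
    moreover have "ev Y2 H = ev Y2 (Tz 0 H)" by (rule Tz_ev_poly[symmetric]) (simp add: Y2_def)
    hence "order 0 (ev Y2 H) = m" using oX[OF e(1)] by (simp add: e ev_simps Y2_def)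
    ultimately have M: "m + d = a 1" by simp
    have Vnz: "Var i \<noteq> 0" for i using lin_nonzero[of "(i, i, 0)"] by (simp add: lin_def)
    have "homog (0 + m * Suc 0) (Tz 0 H)" unfolding e by (intro hom_mult hom_power hom_Var hom_emb)
    moreover have "Tz 0 H \<noteq> 0" using e Vnz by simp
    ultimately have km: "k = m" using hom_unique[OF hom_Tz[OF k, of 0]] by simp
    have "homog (0 + card A * Suc 0 + card (J - A) * Suc 0) (Tz 2 G)"
      unfolding TG by (intro hom_mult hom_power hom_Var hom_emb)
    moreover have "Tz 2 G \<noteq> 0" using TG c Vnz by simp
    ultimately have lm: "l = card A + card (J - A)" using hom_unique[OF hom_Tz[OF l, of 2]] by simp
    have s3: "{..<3 :: nat} = {0, 1, 2}" by auto
    have "homog (l + k + (\<Sum>j<3. drho 3 d j)) (G * H * S 3 (drho 3 d))"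
      by (intro hom_mult l k hom_S)
    hence "homog (l + k + 3 * d) (S 3 a)"
      unfolding fact_pairD(7)[OF assms(1)] by (simp add: s3 drho3)
    hence "l + k + 3 * d = (\<Sum>j<3. a j)"
      using hom_unique[OF _ hom_S S_nonzero[OF fact_pairD(1)[OF assms(1)]]] by blast
    hence "a 0 = 2 * a 1" using A B M km lm f(3) by (simp add: s3)
    hence "d = a 1" using f(4) by simp
    thus ?thesis using assms(2) by simp
  qed
qed

lemma hexagon_ij:
  assumes "fact_pair 3 d a G H" "a 0 - a 1 \<noteq> d" "a 1 \<noteq> d" "monoat i H" "monoat j H" "i \<le> 2" "j \<le> 2" "i \<noteq> j"
  shows "is_const H"
proof -
  obtain \<rho> where r: "\<rho> permutes {..<3}" "\<rho> i = 0" "\<rho> j = 1" "bij \<rho>"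
    by (rule perm_pair[of i "{..<3}" j 0 1]) (use assms(6-8) in auto)
  note fp = fact_pair_pact[OF assms(1) r(1)]
  have "is_const (pact \<rho> H)"
    using hexagon_01[OF fp assms(3)] monoat_pact[OF assms(4) r(1)] monoat_pact[OF assms(5) r(1)]
      hexagon_any[OF fp assms(2,3), of 2] r by simp
  thus ?thesis by (rule pact_const[OF r(4)])
qed

text \<open>Of the three indices two belong to the same factor.\<close>

lemma hexagon:
  assumes "fact_pair 3 d a G H" "a 0 - a 1 \<noteq> d" "a 1 \<noteq> d"
  shows "is_const G \<or> is_const H"
proof -
  have "monoat i G \<or> monoat i H" if "i \<le> 2" for i
    using hexagon_any[OF assms that] .
  from this[of 0] this[of 1] this[of 2] show ?thesis
    using hexagon_ij[OF assms, of 0 1] hexagon_ij[OF assms, of 0 2] hexagon_ij[OF assms, of 1 2]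
      hexagon_ij[OF fact_pair_swap[OF assms(1)] assms(2,3), of 0 1]
      hexagon_ij[OF fact_pair_swap[OF assms(1)] assms(2,3), of 0 2]
      hexagon_ij[OF fact_pair_swap[OF assms(1)] assms(2,3), of 1 2] by auto
qed

section \<open>One gap equal to d: the Newton polygon of C is a triangle\<close>

lemma dvd_pderiv_power:
  fixes p :: "'a :: idom poly"
  assumes "[:- t, 1:] ^ Suc n dvd p" shows "[:- t, 1:] ^ n dvd pderiv p"
proof -
  obtain r where r: "p = [:- t, 1:] ^ Suc n * r" using assms by blast
  have "pderiv p = [:- t, 1:] ^ Suc n * pderiv r + r * pderiv ([:- t, 1:] ^ Suc n)"
    unfolding r by (rule pderiv_mult)
  also have "\<dots> = [:- t, 1:] ^ n * ([:- t, 1:] * pderiv r + r * (smult (of_nat (Suc n)) (pderiv [:- t, 1:])))"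
    unfolding pderiv_power_Suc by (simp add: algebra_simps)
  finally show ?thesis by simp
qed

lemma trinomial_double_root:
  fixes t :: complex
  assumes "[:- t, 1:] ^ 2 dvd monom A a + monom B d + [:C:]" "0 < d" "d < a"
  shows "A * t ^ a + B * t ^ d + C = 0" "of_nat a * A * t ^ a + of_nat d * B * t ^ d = 0"
proof -
  let ?p = "monom A a + monom B d + [:C:]"
  have "[:- t, 1:] dvd ?p"
    using assms(1) by (rule dvd_trans[rotated]) (simp only: power2_eq_square dvd_triv_left)
  thus "A * t ^ a + B * t ^ d + C = 0" by (simp add: dvd_iff_poly_eq_0 poly_monom)
  have "[:- t, 1:] ^ 1 dvd pderiv ?p" using assms(1) by (intro dvd_pderiv_power) (simp add: numeral_2_eq_2)
  hence "poly (pderiv ?p) t = 0" by (simp add: dvd_iff_poly_eq_0)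
  hence "t * (of_nat a * A * t ^ (a - 1) + of_nat d * B * t ^ (d - 1)) = 0"
    by (simp add: pderiv_add pderiv_monom pderiv_pCons poly_monom)
  moreover have e: "t ^ a = t * t ^ (a - 1)" "t ^ d = t * t ^ (d - 1)"
    using assms by (simp_all flip: power_Suc)
  ultimately show "of_nat a * A * t ^ a + of_nat d * B * t ^ d = 0"
    unfolding e by (simp only: distrib_left mult_ac)
qed

text \<open>The double root criterion applies to p and to X p', which has the same exponents.
  Eliminating B leaves a (a - d) A t^a = 0.\<close>

lemma trinomial_triple_root:
  fixes t :: complex
  assumes "[:- t, 1:] ^ 3 dvd monom A a + monom B d + [:C:]" "0 < d" "d < a" "t \<noteq> 0"
  shows "A = 0"
proof -
  let ?p = "monom A a + monom B d + [:C:]"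
  have "[:- t, 1:] ^ 2 dvd [:- t, 1:] ^ 3" by (rule le_imp_power_dvd) simp
  hence "[:- t, 1:] ^ 2 dvd ?p" using assms(1) dvd_trans by blast
  note d1 = trinomial_double_root(2)[OF this assms(2,3)]
  have "[:- t, 1:] ^ 2 dvd pderiv ?p"
    using assms(1) by (intro dvd_pderiv_power) (simp add: numeral_3_eq_3)
  hence "[:- t, 1:] ^ 2 dvd [:0, 1:] * pderiv ?p" by (rule dvd_mult)
  also have "[:0, 1:] * pderiv ?p = monom (of_nat a * A) a + monom (of_nat d * B) d + [:0:]"
    using assms(2,3) by (simp add: pderiv_add pderiv_monom pderiv_pCons algebra_simps flip: monom_Suc)
  finally have e1: "of_nat a * (of_nat a * A) * t ^ a + of_nat d * (of_nat d * B) * t ^ d = 0"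
    by (rule trinomial_double_root(2)[OF _ assms(2,3)])
  have "of_nat a * (of_nat a - of_nat d) * A * t ^ a =
      (of_nat a * (of_nat a * A) * t ^ a + of_nat d * (of_nat d * B) * t ^ d)
      - of_nat d * (of_nat a * A * t ^ a + of_nat d * B * t ^ d)"
    by (simp only: ring_distribs mult_ac) simp
  also have "\<dots> = 0" unfolding e1 d1 by simp
  finally have "of_nat a * (of_nat a - of_nat d) * A * t ^ a = 0" .
  moreover have "of_nat a - of_nat d \<noteq> (0 :: complex)" using assms(3) by simp
  ultimately show ?thesis using assms by auto
qed

text \<open>A common zero of both factors counts twice in S(a), and a zero of S(d rho) adds a
  third.\<close>

lemma fact_double_root:
  assumes "fact_pair 3 d a G H" "poly (ev Y G) t = (0 :: complex)" "poly (ev Y H) t = 0"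
  shows "[:- t, 1:] ^ 2 dvd gd 3 Y a"
    and "poly (gd 3 Y (drho 3 d)) t = 0 \<Longrightarrow> [:- t, 1:] ^ 3 dvd gd 3 Y a"
proof -
  have 2: "[:- t, 1:] ^ 2 dvd ev Y G * ev Y H"
    using assms(2,3) unfolding power2_eq_square by (intro mult_dvd_mono) (simp_all add: dvd_iff_poly_eq_0)
  thus "[:- t, 1:] ^ 2 dvd gd 3 Y a"
    unfolding fact_pair_ev[OF assms(1), symmetric] by (rule dvd_mult2)
  assume "poly (gd 3 Y (drho 3 d)) t = 0"
  hence "[:- t, 1:] dvd gd 3 Y (drho 3 d)" by (simp add: dvd_iff_poly_eq_0)
  hence "[:- t, 1:] ^ 2 * [:- t, 1:] dvd ev Y G * ev Y H * gd 3 Y (drho 3 d)"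
    using 2 by (intro mult_dvd_mono)
  thus "[:- t, 1:] ^ 3 dvd gd 3 Y a"
    unfolding fact_pair_ev[OF assms(1)] by (simp add: numeral_3_eq_3 numeral_2_eq_2 mult_ac)
qed

lemma complex_poly_eqI: "(\<And>u. poly p u = poly q (u :: complex)) \<Longrightarrow> p = q"
  by (simp add: poly_eq_poly_eq_iff[symmetric] fun_eq_iff)

text \<open>The factor \<open>y ^ d - 1\<close> can be cancelled before evaluating at a \<open>d\<close>-th root of unity.\<close>

lemma special_value:
  fixes z x :: complex
  assumes "F * S 3 (drho 3 d) = S 3 a" "a 0 = q * d" "a 1 = d" "a 2 = 0" "d > 0" "z ^ d = 1"
  shows "ev (\<lambda>i. if i = 2 then x else if i = 0 then z else 1) F * (1 - x ^ d) ^ 2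
    = x ^ (q * d) - of_nat q * x ^ d + (of_nat q - 1)"
proof -
  define Y where "Y = (\<lambda>i :: nat. if i = 2 then [:x:] else if i = 0 then [:0, 1:] else 1)"
  define s where "s = x ^ d"
  let ?T = "monom 1 d :: complex poly"
  have "ev Y (F * S 3 (drho 3 d)) = ev Y (S 3 a)" using assms(1) by simp
  hence eq: "ev Y F * gd 3 Y (drho 3 d) = gd 3 Y a" by (simp add: ev_mult ev_S)
  have pw: "v ^ (q * d) = (v ^ d) ^ q" "v ^ (2 * d) = v ^ d * v ^ d" for v :: complex
    by (simp add: mult.commute flip: power_mult) (simp only: mult_2 power_add)
  have W: "gd 3 Y (drho 3 d) = (?T - 1) * ([:1 - s:] * (?T - [:s:]))"
    by (rule complex_poly_eqI, unfold ahom_gd[OF ahom_poly] gd3 drho3 mult_2 power_add)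
       (simp add: Y_def s_def poly_monom algebra_simps)
  have fq: "?T ^ q - 1 = (?T - 1) * (\<Sum>i<q. ?T ^ i)" by (rule power_diff_1_eq)
  have ga: "gd 3 Y a = (?T ^ q - 1) * [:1 - s:] - (?T - 1) * [:1 - s ^ q:]"
    by (rule complex_poly_eqI, unfold ahom_gd[OF ahom_poly] gd3 assms(2-4) pw)
       (simp add: Y_def power_mult s_def poly_monom algebra_simps)
  have A: "gd 3 Y a = (?T - 1) * ((\<Sum>i<q. ?T ^ i) * [:1 - s:] - [:1 - s ^ q:])"
    unfolding ga fq by (simp only: right_diff_distrib mult.assoc)
  have "degree (?T - 1) = d"
    using assms(5) degree_add_eq_left[of "- 1" ?T] by (simp add: degree_monom_eq)
  hence T1: "?T - 1 \<noteq> 0" using assms(5) by auto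
  have "(?T - 1) * (ev Y F * ([:1 - s:] * (?T - [:s:]))) = (?T - 1) * ((\<Sum>i<q. ?T ^ i) * [:1 - s:] - [:1 - s ^ q:])"
    using eq unfolding W A by (simp only: mult_ac)
  hence "ev Y F * ([:1 - s:] * (?T - [:s:])) = (\<Sum>i<q. ?T ^ i) * [:1 - s:] - [:1 - s ^ q:]"
    by (subst (asm) mult_left_cancel[OF T1])
  hence "poly (ev Y F) z * ((1 - s) * (1 - s)) = of_nat q * (1 - s) - (1 - s ^ q)"
    by (drule_tac arg_cong[of _ _ "\<lambda>p. poly p z"]) (simp add: poly_sum poly_monom assms(6) mult_ac)
  moreover have "poly (ev Y F) z = ev (\<lambda>i. if i = 2 then x else if i = 0 then z else 1) F"
    unfolding ahom_ev_comp[OF ahom_poly] by (intro ev_cong) (auto simp: Y_def)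
  moreover have "s ^ q = x ^ (q * d)" by (simp add: s_def mult.commute flip: power_mult)
  ultimately show ?thesis by (simp add: power2_eq_square algebra_simps s_def)
qed

text \<open>For a_1 = d the lower exponents (d, 0) are d rho, so the leading coefficient of C in x_2
  is 1 and those of the factors are constants.\<close>

lemma triangle_pure_last:
  assumes "fact_pair 3 d a G H" "a 1 = d" shows "ev (unitv 2) G \<noteq> 0"
proof -
  have s3: "Suc 2 = 3" by simp
  note f = fact_pair3[OF assms(1)] and g = fact_pairD[OF assms(1)]
  have "Lc 2 (G * H) * S 2 (drho 2 d) = S 2 (\<lambda>j. a (Suc j))"
    by (rule Lc_step[of _ 2, unfolded s3, OF g(7,1,4)])
  also have "\<dots> = S 2 (drho 2 d)"
    using f(3) assms(2) by (intro S_cong) (auto simp: drho_def less_Suc_eq numeral_2_eq_2)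
  finally have "Lc 2 G * Lc 2 H = emb 1"
    using S_nonzero[OF dec_drho[OF g(4)], of 2] by (simp add: Lc_mult)
  then obtain c where "Lc 2 G = emb c" "c \<noteq> 0" using emb_factor by (metis one_neq_zero)
  moreover obtain k where "homog k G" by (rule fact_pair_hom[OF assms(1)])
  ultimately show ?thesis using pure_power by blast
qed

lemma triangle_pure:
  assumes "fact_pair 3 d a G H" "a 1 = d" "i \<le> 2" shows "ev (unitv i) G \<noteq> 0"
proof -
  define \<rho> where "\<rho> = Transposition.transpose i 2"
  have s3: "Suc 2 = 3" by simp
  note r = swap_last[OF assms(3), folded \<rho>_def, unfolded s3]
  have "ev (unitv 2) (pact \<rho> G) \<noteq> 0"
    by (rule triangle_pure_last[OF fact_pair_pact[OF assms(1) r(1)] assms(2)])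
  moreover have "unitv 2 (\<rho> v) = unitv i v" for v unfolding unitv_def using r(4,5) by metis
  ultimately show ?thesis by (simp add: ev_pact)
qed

text \<open>At a common zero S(a) has a double root in x and in y, and a triple root where S(d rho)
  vanishes, which a trinomial does not permit at a nonzero point. For s = t = 1 the trinomials
  vanish identically and \<open>special_value\<close> takes their place. In the remaining case the
  derivatives force s = t; coordinates equal to 0 are treated directly.\<close>

lemma triangle_no_common_zero:
  fixes x y :: complex
  assumes "fact_pair 3 d a G H" "a 1 = d" "a 0 = q * d" "q \<ge> 3"
  defines "p \<equiv> (\<lambda>i :: nat. if i = 2 then x else if i = 0 then y else 1 :: complex)"
  assumes "ev p G = 0" "ev p H = 0"
  shows False
proof -
  note f = fact_pair3[OF assms(1)] and g = fact_pairD[OF assms(1)]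
  define s t where "s = x ^ d" and "t = y ^ d"
  have xa: "x ^ a 0 = s ^ q" "y ^ a 0 = t ^ q"
    by (simp_all add: assms(3) s_def t_def mult.commute flip: power_mult)
  have da: "0 < d" "d < a 0" using f(1,8) assms(2) by auto
  define Yx where "Yx = (\<lambda>i :: nat. if i = 2 then [:0, 1:] else if i = 0 then [:y:] else 1)"
  define Yy where "Yy = (\<lambda>i :: nat. if i = 2 then [:x:] else if i = 0 then [:0, 1:] else 1)"
  have ex: "poly (ev Yx P) x = ev p P" for P
    unfolding ahom_ev_comp[OF ahom_poly] by (intro ev_cong) (auto simp: Yx_def p_def)
  have ey: "poly (ev Yy P) y = ev p P" for P
    unfolding ahom_ev_comp[OF ahom_poly] by (intro ev_cong) (auto simp: Yy_def p_def)
  have Sx: "gd 3 Yx a = monom (t - 1) (a 0) + monom (1 - t ^ q) d + [:t ^ q - t:]"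
    by (rule complex_poly_eqI, unfold ahom_gd[OF ahom_poly] gd3 f(3) assms(2))
       (simp add: Yx_def poly_monom xa algebra_simps flip: t_def)
  have Sy: "gd 3 Yy a = monom (1 - s) (a 0) + monom (s ^ q - 1) d + [:s - s ^ q:]"
    by (rule complex_poly_eqI, unfold ahom_gd[OF ahom_poly] gd3 f(3) assms(2))
       (simp add: Yy_def poly_monom xa algebra_simps flip: s_def)
  have W: "gd 3 p (drho 3 d) = (t - 1) * (1 - s) * (t - s)"
    unfolding gd3 drho3 mult_2 power_add by (simp add: p_def s_def t_def algebra_simps)
  have Wx: "poly (gd 3 Yx (drho 3 d)) x = gd 3 p (drho 3 d)" and Wy: "poly (gd 3 Yy (drho 3 d)) y = gd 3 p (drho 3 d)"
    unfolding ahom_gd[OF ahom_poly] by (auto intro!: gd_cong simp: Yx_def Yy_def p_def)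
  note dx = fact_double_root[OF assms(1), of Yx x, unfolded ex Wx W Sx, OF assms(6,7)]
  note dy = fact_double_root[OF assms(1), of Yy y, unfolded ey Wy W Sy, OF assms(6,7)]
  note dx2 = trinomial_double_root[OF dx(1) da] and dy2 = trinomial_double_root[OF dy(1) da]
  have d0: "(of_nat d :: complex) \<noteq> 0" using da by simp
  have aq: "of_nat (a 0) = of_nat q * (of_nat d :: complex)" by (simp add: assms(3))
  consider "x = 0" "y = 0" | "x = 0" "y \<noteq> 0" | "x \<noteq> 0" "y = 0" | "x \<noteq> 0" "y \<noteq> 0" by blast
  thus False
  proof cases
    case 1
    have "ev p G = ev (unitv 1) G"
      using 1 g(5) by (intro ev_cong) (auto simp: p_def unitv_def)
    thus False using triangle_pure[OF assms(1,2), of 1] assms(6) by simp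
  next
    case 2
    hence s: "s = 0" "s ^ q = 0" using da assms(4) by (auto simp: s_def)
    have "y ^ a 0 - y ^ d = 0" "of_nat (a 0) * y ^ a 0 - of_nat d * y ^ d = 0"
      using dy2 assms(4) by (simp_all add: s(1) power_0_left)
    hence "(of_nat (a 0) - of_nat d) * y ^ d = 0" by (simp add: algebra_simps)
    thus False using 2 da by simp
  next
    case 3
    hence t: "t = 0" "t ^ q = 0" using da assms(4) by (auto simp: t_def)
    have "- (x ^ a 0) + x ^ d = 0" "- (of_nat (a 0) * x ^ a 0) + of_nat d * x ^ d = 0"
      using dx2 assms(4) by (simp_all add: t(1) power_0_left)
    hence "(of_nat d - of_nat (a 0)) * x ^ d = 0" by (simp add: algebra_simps)
    thus False using 3 da by simp
  next
    case 4
    have st0: "s \<noteq> 0" "t \<noteq> 0" using 4 by (simp_all add: s_def t_def)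
    consider "t = 1" "s = 1" | "t \<noteq> 1" "s = t \<or> s = 1" | "t = 1" "s \<noteq> 1" | "t \<noteq> 1" "s \<noteq> 1" "s \<noteq> t" by blast
    thus False
    proof cases
      case 1
      define Z where "Z = (\<lambda>i :: nat. if i = 2 then [:0, 1:] else if i = 0 then [:y:] else 1)"
      let ?f = "ev Z (G * H)"
      have "poly ?f u * (1 - u ^ d) ^ 2 = u ^ (q * d) - of_nat q * u ^ d + (of_nat q - 1)" for u
      proof -
        have "poly ?f u = ev (\<lambda>i. if i = 2 then u else if i = 0 then y else 1) (G * H)"
          unfolding ahom_ev_comp[OF ahom_poly] by (intro ev_cong) (auto simp: Z_def)
        thus ?thesis using special_value[OF g(7) assms(3,2) f(3) da(1), of y u] 1 by (simp add: t_def)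
      qed
      hence "poly (?f * (1 - monom 1 d) ^ 2) u = poly (monom 1 (a 0) + monom (- of_nat q) d + [:of_nat q - 1:]) u" for u
        by (simp add: poly_monom assms(3))
      hence eq: "?f * (1 - monom 1 d) ^ 2 = monom 1 (a 0) + monom (- of_nat q) d + [:of_nat q - 1:]"
        by (simp add: poly_eq_poly_eq_iff[symmetric] fun_eq_iff)
      have "Z = Yx" by (simp add: Z_def Yx_def)
      hence "poly ?f x = 0" using ex assms(6) by (simp add: ev_mult)
      hence "[:- x, 1:] dvd ?f" by (simp add: dvd_iff_poly_eq_0)
      moreover have "[:- x, 1:] dvd 1 - monom 1 d" using 1 by (simp add: dvd_iff_poly_eq_0 poly_monom s_def)
      \<comment> \<open>The factor \<open>?f\<close> contributes one root x and the square two
        more.\<close>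
      ultimately have "[:- x, 1:] * [:- x, 1:] ^ 2 dvd ?f * (1 - monom 1 d) ^ 2"
        by (intro mult_dvd_mono dvd_power_same)
      hence "[:- x, 1:] ^ 3 dvd monom 1 (a 0) + monom (- of_nat q) d + [:of_nat q - 1:]"
        unfolding eq by (simp add: numeral_3_eq_3 numeral_2_eq_2)
      from trinomial_triple_root[OF this da 4(1)] show False by simp
    next
      case 2
      hence "(t - 1) * (1 - s) * (t - s) = 0" by auto
      from trinomial_triple_root[OF dx(2)[OF this] da 4(1)] show False using 2 by simp
    next
      case 3
      hence "(t - 1) * (1 - s) * (t - s) = 0" by auto
      from trinomial_triple_root[OF dy(2)[OF this] da 4(2)] show False using 3 by simp
    next
      case 5: 4
      \<comment> \<open>The derivatives in x and y read q (t - 1) \<sigma> = t^q - 1 and q (s - 1)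
        \<tau> = s^q - 1. Together with the vanishing of S(a) they give \<sigma> = \<tau>, and
        subtracting them gives (s - t) (q - 1) \<sigma> = 0.\<close>
      define \<sigma> \<tau> where "\<sigma> = s ^ (q - 1)" and "\<tau> = t ^ (q - 1)"
      have q: "s ^ q = s * \<sigma>" "t ^ q = t * \<tau>"
        using assms(4) by (simp_all add: \<sigma>_def \<tau>_def flip: power_Suc)
      have "of_nat d * (s * (of_nat q * (t - 1) * \<sigma> + (1 - t ^ q))) = 0"
        using dx2(2) by (simp add: aq xa q algebra_simps flip: s_def)
      hence "of_nat q * (t - 1) * \<sigma> + (1 - t ^ q) = 0" using d0 st0 by (simp only: mult_eq_0_iff simp_thms)
      hence 1: "of_nat q * (t - 1) * \<sigma> = t ^ q - 1"
        by (subst (asm) eq_neg_iff_add_eq_0[symmetric]) simp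
      have "of_nat d * (t * (of_nat q * (1 - s) * \<tau> + (s ^ q - 1))) = 0"
        using dy2(2) by (simp add: aq xa q algebra_simps flip: t_def)
      hence "of_nat q * (1 - s) * \<tau> + (s ^ q - 1) = 0" using d0 st0 by (simp only: mult_eq_0_iff simp_thms)
      hence "of_nat q * (1 - s) * \<tau> = - (s ^ q - 1)" by (simp only: eq_neg_iff_add_eq_0)
      moreover have "of_nat q * (s - 1) * \<tau> = - (of_nat q * (1 - s) * \<tau>)" by (simp add: algebra_simps)
      ultimately have 2: "of_nat q * (s - 1) * \<tau> = s ^ q - 1" by simp
      have 0: "(s ^ q - 1) * (t - 1) = (t ^ q - 1) * (s - 1)"
        using dx2(1) by (simp add: xa algebra_simps flip: s_def)
      have "(of_nat q * (s - 1) * (t - 1)) * (\<tau> - \<sigma>) = 0"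
        using 0 unfolding 1[symmetric] 2[symmetric] by (simp add: algebra_simps)
      hence st: "\<tau> = \<sigma>" using 5 assms(4) by auto
      have "s * \<sigma> - t * \<sigma> = of_nat q * (s - 1) * \<sigma> - of_nat q * (t - 1) * \<sigma>"
        using 1 2 unfolding q st by (simp only:) simp
      hence "(s - t) * \<sigma> * (of_nat q - 1) = 0" by (simp add: algebra_simps)
      moreover have "\<sigma> \<noteq> 0" using st0 by (simp add: \<sigma>_def)
      moreover have "(of_nat q :: complex) \<noteq> 1" using assms(4) by auto
      ultimately show False using 5 by simp
    qed
  qed
qed

text \<open>Each root of h is a root of u and is divided off both sides.\<close>

lemma dvd_of_no_common_root:
  fixes h g u :: "complex poly"
  assumes "h \<noteq> 0" "\<And>x. \<not> (poly h x = 0 \<and> poly g x = 0)" "h dvd u * g"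
  shows "h dvd u"
  using assms
proof (induction "degree h" arbitrary: h u)
  case 0
  then obtain c where "h = [:c:]" "c \<noteq> 0" by (metis degree_eq_zeroE pCons_0_0)
  thus ?case by (intro dvdI[of _ _ "smult (1 / c) u"]) simp
next
  case (Suc n)
  hence "\<not> constant (poly h)" by (simp add: constant_degree)
  then obtain x where x: "poly h x = 0" using fundamental_theorem_of_algebra by blast
  then obtain h1 where h1: "h = [:- x, 1:] * h1" by (metis poly_eq_0_iff_dvd dvdE)
  have "poly (u * g) x = 0" using Suc.prems(3) x by (metis dvdE mult_zero_left poly_mult)
  hence "poly u x = 0" using Suc.prems(2)[of x] x by simp
  then obtain u1 where u1: "u = [:- x, 1:] * u1" by (metis poly_eq_0_iff_dvd dvdE)
  have h10: "h1 \<noteq> 0" using Suc.prems(1) h1 by auto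
  have "n = degree h1" using Suc.hyps(2) h10 unfolding h1 by (subst (asm) degree_mult_eq) auto
  moreover have "\<not> (poly h1 y = 0 \<and> poly g y = 0)" for y using Suc.prems(2)[of y] h1 by auto
  moreover have "[:- x, 1:] * h1 dvd [:- x, 1:] * (u1 * g)" using Suc.prems(3) unfolding h1 u1 by (simp only: mult.assoc)
  hence "h1 dvd u1 * g" by (subst (asm) dvd_mult_cancel_left) auto
  ultimately have "h1 dvd u1" using Suc.hyps(1) h10 by blast
  thus ?case unfolding h1 u1 by (rule mult_dvd_mono[OF dvd_refl])
qed

text \<open>An element q of the ideal (g, h) of least degree divides all others up to powers of its
  leading coefficient. A positive degree would thus yield a common zero, so the ideal contains a
  nonzero polynomial R in the inner variable alone. Choose R of least degree with deg U < deg h.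
  Over a root y of R the identity becomes U g + V h = 0; there h keeps its degree and shares no root
  with g, so h divides U and U = V = 0. Then the linear polynomial with root y cancels, against
  minimality.\<close>

lemma bezout_const:
  fixes g h :: "complex poly poly"
  assumes g: "lead_coeff g = [:cg:]" "cg \<noteq> 0" and h: "lead_coeff h = [:ch:]" "ch \<noteq> 0"
    and dh: "degree h > 0"
    and nz: "\<And>x y. \<not> (poly (poly g [:x:]) y = 0 \<and> poly (poly h [:x:]) y = 0)"
  obtains U V c where "U * g + V * h = [:[:c:]:]" "c \<noteq> 0" "degree U < degree h"
proof -
  define I where "I = {p. \<exists>U V. p = U * g + V * h}"
  have Ig: "g \<in> I" unfolding I_def by (intro CollectI exI[of _ 1] exI[of _ 0]) simp
  have Ih: "h \<in> I" unfolding I_def by (intro CollectI exI[of _ 0] exI[of _ 1]) simp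
  have Isub: "p - r * q \<in> I" if "p \<in> I" "q \<in> I" for p q r
  proof -
    obtain A B C D where "p = A * g + B * h" "q = C * g + D * h" using \<open>p \<in> I\<close> \<open>q \<in> I\<close> by (auto simp: I_def)
    hence "p - r * q = (A - r * C) * g + (B - r * D) * h" by (simp add: algebra_simps)
    thus ?thesis by (auto simp: I_def)
  qed
  have Ismult: "smult c p \<in> I" if "p \<in> I" for c p
  proof -
    obtain A B where "p = A * g + B * h" using \<open>p \<in> I\<close> by (auto simp: I_def)
    hence "smult c p = smult c A * g + smult c B * h" by (simp add: smult_add_right)
    thus ?thesis unfolding I_def by blast
  qed
  have g0: "g \<noteq> 0" using g by auto
  have ex: "\<exists>p. p \<in> I \<and> p \<noteq> 0" using Ig g0 by blast
  define q where "q = (ARG_MIN degree p. p \<in> I \<and> p \<noteq> 0)"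
  have q: "q \<in> I" "q \<noteq> 0" using arg_min_natI[of "\<lambda>p. p \<in> I \<and> p \<noteq> 0"] ex unfolding q_def by blast+
  have qmin: "degree q \<le> degree p" if "p \<in> I" "p \<noteq> 0" for p
    using arg_min_nat_le[of "\<lambda>p. p \<in> I \<and> p \<noteq> 0" p degree] that unfolding q_def by blast
  have div: "\<exists>e Q. smult (lead_coeff q ^ e) p = q * Q" if p: "p \<in> I" for p
  proof -
    obtain Q r where qr: "pseudo_divmod p q = (Q, r)" by (cases "pseudo_divmod p q")
    note pd = pseudo_divmod[OF q(2) qr]
    let ?e = "Suc (degree p) - degree q"
    have "r = smult (lead_coeff q ^ ?e) p - Q * q" using pd(1) by simp
    hence "r \<in> I" using Isub[OF Ismult[OF p] q(1)] by simp
    hence "r = 0" using qmin[of r] pd(2) by force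
    thus ?thesis using pd(1) by auto
  qed
  have "degree q = 0"
  proof (rule ccontr)
    assume dq: "degree q \<noteq> 0"
    have "infinite {y. poly (lead_coeff q) y \<noteq> 0}"
    proof -
      have "finite {y. poly (lead_coeff q) y = 0}" using q(2) by (intro poly_roots_finite) simp
      moreover have "{y. poly (lead_coeff q) y \<noteq> 0} = UNIV - {y. poly (lead_coeff q) y = 0}" by auto
      ultimately show ?thesis using infinite_UNIV_char_0[where 'a = complex] by (simp add: Diff_infinite_finite)
    qed
    \<comment> \<open>Away from the zeros of its leading coefficient, q keeps its positive degree
      over y and has a root there.\<close>
    then obtain y where y: "poly (lead_coeff q) y \<noteq> 0"
      by (metis (mono_tags, lifting) empty_Collect_eq finite.emptyI)
    let ?q = "map_poly (\<lambda>c. poly c y) q"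
    have "degree ?q = degree q" using y by (intro map_poly_degree_eq) simp
    hence "\<not> constant (poly ?q)" using dq by (simp add: constant_degree)
    then obtain x where x: "poly ?q x = 0" using fundamental_theorem_of_algebra by blast
    have e: "poly (map_poly (\<lambda>c. poly c y) p) x = poly (poly p [:x:]) y" for p
      by (induction p) (simp_all add: map_poly_pCons)
    have "poly (poly p [:x:]) y = 0" if p: "p \<in> I" for p
    proof -
      obtain e Q where "smult (lead_coeff q ^ e) p = q * Q" using div[OF p] by blast
      hence "poly (poly (smult (lead_coeff q ^ e) p) [:x:]) y = poly (poly (q * Q) [:x:]) y" by simp
      hence "poly (lead_coeff q) y ^ e * poly (poly p [:x:]) y = 0" using x e by simp
      thus ?thesis using y by simp
    qed
    thus False using Ig Ih nz by blast
  qed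
  then obtain R0 where R0: "q = [:R0:]" by (auto elim: degree_eq_zeroE)
  define Good where "Good = (\<lambda>R. R \<noteq> 0 \<and> (\<exists>U V. U * g + V * h = [:R:] \<and> degree U < degree h))"
  have h0: "h \<noteq> 0" using h by auto
  have "\<exists>R. Good R"
  proof -
    obtain U V where UV: "[:R0:] = U * g + V * h" using q(1) R0 by (auto simp: I_def)
    obtain Q r where qr: "pseudo_divmod U h = (Q, r)" by (cases "pseudo_divmod U h")
    note pd = pseudo_divmod[OF h0 qr]
    define l where "l = lead_coeff h ^ (Suc (degree U) - degree h)"
    have l0: "l \<noteq> 0" using h0 by (simp add: l_def)
    have "[:l * R0:] = smult l U * g + smult l V * h"
      using UV by (metis smult_add_right mult_smult_left smult_pCons smult_0_right)
    also have "smult l U = h * Q + r" using pd(1) by (simp add: l_def)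
    finally have "r * g + (Q * g + smult l V) * h = [:l * R0:]" by (simp add: algebra_simps)
    moreover have "degree r < degree h" using pd(2) dh by auto
    moreover have "l * R0 \<noteq> 0" using l0 R0 q(2) by auto
    ultimately show ?thesis unfolding Good_def by blast
  qed
  define R where "R = (ARG_MIN degree R. Good R)"
  have R: "Good R" unfolding R_def using arg_min_natI \<open>\<exists>R. Good R\<close> by metis
  have Rmin: "degree R \<le> degree R'" if "Good R'" for R'
    unfolding R_def using arg_min_nat_le[of Good R' degree] that by blast
  obtain U V where UV: "U * g + V * h = [:R:]" "degree U < degree h" "R \<noteq> 0" using R by (auto simp: Good_def)
  have "degree R = 0"
  proof (rule ccontr)
    assume "degree R \<noteq> 0"
    hence "\<not> constant (poly R)" by (simp add: constant_degree)
    then obtain y where y: "poly R y = 0" using fundamental_theorem_of_algebra by blast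
    \<comment> \<open>Restriction to the fibre over y.\<close>
    define E where "E = map_poly (\<lambda>c :: complex poly. poly c y)"
    have aE: "ahom E" unfolding E_def by (rule ahom_map_poly[OF ahom_poly])
    have "E U * E g + E V * E h = E [:R:]" using UV(1) by (metis ahom_add[OF aE] ahom_mult[OF aE])
    also have "E [:R:] = 0" using y by (simp add: E_def map_poly_pCons)
    finally have 0: "E U * E g = - E V * E h" by (simp add: eq_neg_iff_add_eq_0)
    have e: "poly (E p) x = poly (poly p [:x:]) y" for p x
      unfolding E_def by (induction p) (simp_all add: map_poly_pCons)
    have dEh: "degree (E h) = degree h" unfolding E_def using h by (intro map_poly_degree_eq) simp
    have Eh0: "E h \<noteq> 0" using dEh dh by auto
    have dv: "E h dvd E U * E g" unfolding 0 by simp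
    have nc: "\<not> (poly (E h) x = 0 \<and> poly (E g) x = 0)" for x using nz[of x y] by (auto simp: e)
    have "E h dvd E U" by (rule dvd_of_no_common_root[OF Eh0 nc dv])
    moreover have "degree (E U) < degree (E h)"
      using UV(2) map_poly_degree_leq[of "\<lambda>c. poly c y" U] dEh by (simp add: E_def)
    ultimately have EU: "E U = 0" using dvd_imp_degree_le[of "E h" "E U"] by force
    hence "E V * E h = 0" using 0 by simp
    hence EV: "E V = 0" using Eh0 by simp
    have fac: "\<exists>P1. P = smult [:- y, 1:] P1 \<and> degree P1 = degree P" if "E P = 0" for P
    proof -
      have "poly (coeff P n) y = 0" for n
        using that by (metis E_def coeff_0 coeff_map_poly poly_0)
      hence dv: "[:- y, 1:] dvd coeff P n" for n by (simp add: dvd_iff_poly_eq_0)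
      hence "[:[:- y, 1:]:] dvd P" by (simp add: const_poly_dvd_iff)
      then obtain P1 where "P = [:[:- y, 1:]:] * P1" by blast
      thus ?thesis by (intro exI[of _ P1]) simp
    qed
    obtain U1 where U1: "U = smult [:- y, 1:] U1" "degree U1 = degree U" using fac[OF EU] by blast
    obtain V1 where V1: "V = smult [:- y, 1:] V1" using fac[OF EV] by blast
    obtain R1 where R1: "R = [:- y, 1:] * R1" using y by (metis poly_eq_0_iff_dvd dvdE)
    have "smult [:- y, 1:] (U1 * g + V1 * h) = smult [:- y, 1:] [:R1:]"
      using UV(1) by (simp add: U1 V1 R1 smult_add_right)
    hence "U1 * g + V1 * h = [:R1:]" by (rule smult_cancel[rotated]) simp
    moreover have "R1 \<noteq> 0" using R1 UV(3) by auto
    moreover have "degree U1 < degree h" using U1(2) UV(2) by simp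
    ultimately have "Good R1" unfolding Good_def by blast
    moreover have "degree R1 < degree R" using R1 UV(3) by (subst R1, subst degree_mult_eq) auto
    ultimately show False using Rmin by force
  qed
  then obtain c where "R = [:c:]" by (auto elim: degree_eq_zeroE)
  thus ?thesis using that[of U V c] UV by auto
qed

lemma homog_pure:
  fixes y :: "nat \<Rightarrow> 'a :: {idom, complex_alg}"
  assumes "homog k P" "ev (unitv i) P \<noteq> 0"
  defines "A \<equiv> ev (\<lambda>v. if v = i then [:0, 1:] else [:y v:]) P"
  shows "degree A = k" "lead_coeff A = emb (ev (unitv i) P)"
proof -
  define y' where "y' = y(i := 1)"
  have A: "A = ev (\<lambda>v. if v \<in> {i} then [:0, y' v:] else [:y' v:]) P"
    unfolding A_def by (intro ev_cong) (auto simp: y'_def)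
  have "ev (\<lambda>v. if v \<in> {i} then y' v else 0) P = ev (\<lambda>v. emb (unitv i v)) P"
    by (intro ev_cong) (auto simp: y'_def unitv_def)
  hence c: "coeff A k = emb (ev (unitv i) P)"
    using hom_top(2)[OF assms(1), of "{i}" y'] unfolding A[symmetric] ev_mpoly_emb by simp
  moreover have "degree A \<le> k" using hom_top(1)[OF assms(1), of "{i}" y'] unfolding A[symmetric] .
  moreover have "k \<le> degree A" using c assms(2) by (intro le_degree) simp
  ultimately show "degree A = k" by simp
  thus "lead_coeff A = emb (ev (unitv i) P)" using c by simp
qed

text \<open>Two plane curves of positive degree meet; here this is derived by hand. In the chart x_1
  = 1 there is an identity U G + V H = c. Its leading forms at infinity show that H on x_1 = 0, of
  degree k, divides the leading form of U, whose degree in x_2 is less than k.\<close>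

lemma triangle:
  assumes "fact_pair 3 d a G H" "a 1 = d" "a 0 \<noteq> 2 * d"
  shows "is_const G \<or> is_const H"
proof (rule ccontr)
  assume nc: "\<not> (is_const G \<or> is_const H)"
  note f = fact_pair3[OF assms(1)] and fs = fact_pair_swap[OF assms(1)]
  obtain q where q: "a 0 = q * d" using f(5) by (metis dvdE mult.commute)
  have q3: "q \<ge> 3"
  proof -
    have "d < q * d" using f(1) q assms(2) by simp
    hence "1 < q" using f(8) by simp
    moreover have "q \<noteq> 2" using q assms(3) by auto
    ultimately show ?thesis by linarith
  qed
  obtain m where m: "homog m G" by (rule fact_pair_hom[OF assms(1)])
  obtain k where k: "homog k H" by (rule fact_pair_hom[OF fs])
  have m0: "m > 0" using nc m hom_0_emb unfolding is_const_def by (metis gr0I)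
  have k0: "k > 0" using nc k hom_0_emb unfolding is_const_def by (metis gr0I)
  have pG: "ev (unitv i) G \<noteq> 0" and pH: "ev (unitv i) H \<noteq> 0" if "i \<le> 2" for i
    using triangle_pure[OF assms(1,2) that] triangle_pure[OF fs assms(2) that] by auto
  define e where "e = (\<lambda>i :: nat. if i = 2 then [:0, 1:] else [:if i = 0 then [:0, 1:] else (1 :: complex poly):])"
  have g: "degree (ev e G) = m" "lead_coeff (ev e G) = [:ev (unitv 2) G:]"
    using homog_pure[OF m pG[OF order_refl], of "\<lambda>i. if i = 0 then [:0, 1:] else (1 :: complex poly)"]
    unfolding e_def by (simp_all add: emb_poly_def)
  have h: "degree (ev e H) = k" "lead_coeff (ev e H) = [:ev (unitv 2) H:]"
    using homog_pure[OF k pH[OF order_refl], of "\<lambda>i. if i = 0 then [:0, 1:] else (1 :: complex poly)"]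
    unfolding e_def by (simp_all add: emb_poly_def)
  have ee: "poly (poly (ev e P) [:x:]) y = ev (\<lambda>i. if i = 2 then x else if i = 0 then y else 1) P" for P x y
    unfolding ahom_ev_comp[OF ahom_comp[OF ahom_poly ahom_poly]]
    by (intro ev_cong) (auto simp: e_def)
  have nz: "\<not> (poly (poly (ev e G) [:x:]) y = 0 \<and> poly (poly (ev e H) [:x:]) y = 0)" for x y
    using triangle_no_common_zero[OF assms(1,2) q q3] unfolding ee by blast
  have "degree (ev e H) > 0" using h k0 by simp
  then obtain U V c where UV: "U * ev e G + V * ev e H = [:[:c:]:]" "c \<noteq> 0" "degree U < degree (ev e H)"
    by (rule bezout_const[OF g(2) pG[OF order_refl] h(2) pH[OF order_refl] _ nz])
  \<comment> \<open>\<theta> substitutes T for x_0 and X T for x_2, with T the outer and X the inner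
    variable. The top coefficient in T is then the form on x_1 = 0 in the chart x_0 = 1.\<close>
  define \<theta> where "\<theta> = (\<lambda>P :: complex poly poly. poly (map_poly (map_poly (\<lambda>a. [:a:])) P) [:0, [:0, 1:]:] :: complex poly poly)"
  have C: "ahom (\<lambda>a :: complex. [:a:])" by (auto simp: ahom_def emb_poly_def)
  have a\<theta>: "ahom \<theta>" unfolding \<theta>_def by (intro ahom_comp[OF ahom_poly] ahom_map_poly C)
  define Z where "Z = (\<lambda>v :: nat. if v = 2 then [:0, 1:] else (1 :: complex poly))"
  have th: "\<theta> (ev e P) = ev (\<lambda>v. if v \<in> {0, 2} then [:0, Z v:] else [:Z v:]) P" for P
    unfolding ahom_ev_comp[OF a\<theta>]
    by (intro ev_cong) (auto simp: e_def \<theta>_def Z_def map_poly_pCons one_pCons)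
  define T where "T = (\<lambda>P. ev (\<lambda>v. if v \<in> {0, 2} then Z v else 0) P)"
  have T: "T P = ev (\<lambda>v. if v = 2 then [:0, 1:] else [:if v = 0 then 1 else 0:]) P" for P
    unfolding T_def by (intro ev_cong) (auto simp: Z_def one_pCons)
  have TG: "degree (T G) = m" "T G \<noteq> 0"
    using homog_pure[OF m pG[OF order_refl], of "\<lambda>v. if v = 0 then 1 else (0 :: complex)"] m0 unfolding T by auto
  have TH: "degree (T H) = k" "T H \<noteq> 0"
    using homog_pure[OF k pH[OF order_refl], of "\<lambda>v. if v = 0 then 1 else (0 :: complex)"] k0 unfolding T by auto
  have tG: "degree (\<theta> (ev e G)) = m" "lead_coeff (\<theta> (ev e G)) = T G"
    using hom_top[OF m, of "{0, 2}" Z, folded th T_def] TG(2) le_degree[of "\<theta> (ev e G)" m]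
    by (simp_all add: antisym)
  have tH: "degree (\<theta> (ev e H)) = k" "lead_coeff (\<theta> (ev e H)) = T H"
    using hom_top[OF k, of "{0, 2}" Z, folded th T_def] TH(2) le_degree[of "\<theta> (ev e H)" k]
    by (simp_all add: antisym)
  \<comment> \<open>At infinity S(a) is X^(a_0) - X^d, which has no nonzero double root; its order d
    at X = 0 is already used up by S(d rho).\<close>
  have tnz: "\<not> (poly (T H) x = 0 \<and> poly (T G) x = 0)" for x
  proof
    assume z: "poly (T H) x = 0 \<and> poly (T G) x = 0"
    let ?Y = "\<lambda>v :: nat. if v \<in> {0, 2} then Z v else 0"
    have da: "0 < d" "d < a 0" using f(1,8) assms(2) by auto
    have S: "gd 3 ?Y a = monom 1 (a 0) + monom (- 1) d + [:0:]"
      by (rule complex_poly_eqI, unfold ahom_gd[OF ahom_poly] gd3 f(3) assms(2))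
         (use da in \<open>simp add: Z_def poly_monom power_0_left\<close>)
    have W: "gd 3 ?Y (drho 3 d) = monom 1 (2 * d) + monom (- 1) d + [:0:]"
      by (rule complex_poly_eqI, unfold ahom_gd[OF ahom_poly] gd3 drho3)
         (use da in \<open>simp add: Z_def poly_monom power_0_left\<close>)
    have dbl: "[:- x, 1:] ^ 2 dvd monom 1 (a 0) + monom (- 1) d + [:0:]"
      using fact_double_root(1)[OF assms(1), of ?Y x] z unfolding S T_def by blast
    show False
    proof (cases "x = 0")
      case False
      have "x ^ a 0 - x ^ d = 0" "of_nat (a 0) * x ^ a 0 - of_nat d * x ^ d = 0"
        using trinomial_double_root[OF dbl da] by simp_all
      hence "(of_nat (a 0) - of_nat d) * x ^ d = 0" by (simp add: algebra_simps)
      thus False using False da by simp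
    next
      case True
      have eq: "T G * T H * (monom 1 (2 * d) + monom (- 1) d + [:0:]) = monom 1 (a 0) + monom (- 1) d + [:0:]"
        using fact_pair_ev[OF assms(1), of ?Y] unfolding S W T_def .
      have "monom 1 (2 * d) + monom (- 1) d + [:0:] = monom 1 d * (monom 1 d - 1 :: complex poly)"
        unfolding mult_2 by (rule complex_poly_eqI) (simp add: poly_monom power_add algebra_simps)
      moreover have "monom 1 (a 0) + monom (- 1) d + [:0:] = monom 1 d * (monom 1 (a 0 - d) - 1 :: complex poly)"
        using da by (intro complex_poly_eqI) (simp add: poly_monom algebra_simps flip: power_add)
      ultimately have "monom 1 d * (T G * T H * (monom 1 d - 1)) = monom 1 d * (monom 1 (a 0 - d) - 1)"
        using eq by (simp only: mult_ac)
      hence "T G * T H * (monom 1 d - 1) = monom 1 (a 0 - d) - 1" by (subst (asm) mult_left_cancel) auto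
      hence "poly (T G * T H * (monom 1 d - 1)) 0 = poly (monom 1 (a 0 - d) - 1) 0" by simp
      thus False using z True da by (simp add: poly_monom power_0_left)
    qed
  qed
  \<comment> \<open>X enters only together with x_2, so the degree in X is bounded by the degree of
    P in x_2.\<close>
  have degc: "degree (coeff (\<theta> P) n) \<le> degree P" for P n
  proof -
    have "\<theta> P = (\<Sum>i\<le>degree P. map_poly (\<lambda>a. [:a:]) (coeff P i) * monom (monom 1 i) i)"
      unfolding \<theta>_def poly_altdef pCons_0_power
      by (intro sum.mono_neutral_cong_left)
         (auto simp: coeff_map_poly map_poly_degree_leq not_le coeff_eq_0 intro: map_poly_degree_leq intro!: le_degree)
    hence "coeff (\<theta> P) n = (\<Sum>i\<le>degree P. coeff (map_poly (\<lambda>a. [:a:]) (coeff P i) * monom (monom 1 i) i) n)"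
      by (simp add: coeff_sum)
    also have "degree \<dots> \<le> degree P"
    proof (intro degree_sum_le)
      fix i assume i: "i \<in> {..degree P}"
      have "coeff (map_poly (\<lambda>a. [:a:]) (coeff P i) * monom (monom 1 i) i) n
        = (if n < i then 0 else [:coeff (coeff P i) (n - i):] * monom 1 i)"
        by (subst mult.commute) (simp add: coeff_monom_mult coeff_map_poly not_less mult.commute)
      also have "degree \<dots> \<le> i" by (auto simp: smult_monom intro: order.trans[OF degree_monom_le])
      finally show "degree (coeff (map_poly (\<lambda>a. [:a:]) (coeff P i) * monom (monom 1 i) i) n) \<le> degree P" using i by simp
    qed auto
    finally show ?thesis .
  qed
  have sum: "\<theta> U * \<theta> (ev e G) + \<theta> V * \<theta> (ev e H) = [:[:c:]:]"
  proof -
    have "\<theta> U * \<theta> (ev e G) + \<theta> V * \<theta> (ev e H) = \<theta> [:[:c:]:]"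
      unfolding UV(1)[symmetric] by (simp add: ahom_add[OF a\<theta>] ahom_mult[OF a\<theta>])
    also have "\<dots> = [:[:c:]:]" by (simp add: \<theta>_def map_poly_pCons)
    finally show ?thesis .
  qed
  have tG0: "\<theta> (ev e G) \<noteq> 0" and tH0: "\<theta> (ev e H) \<noteq> 0" using tG tH m0 k0 by auto
  have U0: "\<theta> U \<noteq> 0"
  proof
    assume "\<theta> U = 0"
    hence *: "\<theta> V * \<theta> (ev e H) = [:[:c:]:]" using sum by simp
    hence "degree (\<theta> V) + degree (\<theta> (ev e H)) = 0" using UV(2) tH0
      by (metis degree_mult_eq degree_pCons_0 mult_eq_0_iff pCons_eq_0_iff)
    thus False using tH k0 by simp
  qed
  have dU: "degree (\<theta> U * \<theta> (ev e G)) > 0" using U0 tG0 tG m0 by (simp add: degree_mult_eq)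
  have eqV: "\<theta> V * \<theta> (ev e H) = [:[:c:]:] - \<theta> U * \<theta> (ev e G)" using sum by (simp add: algebra_simps)
  have "lead_coeff ([:[:c:]:] - \<theta> U * \<theta> (ev e G)) = - lead_coeff (\<theta> U * \<theta> (ev e G))"
    using dU lead_coeff_add_le[of "[:[:c:]:]" "- (\<theta> U * \<theta> (ev e G))"] by (simp add: lead_coeff_minus)
  hence "lead_coeff (\<theta> V) * T H = - (lead_coeff (\<theta> U) * T G)"
    unfolding eqV[symmetric] lead_coeff_mult tG(2) tH(2) .
  hence "T H dvd lead_coeff (\<theta> U) * T G" by (metis dvd_minus_iff dvd_triv_right)
  hence "T H dvd lead_coeff (\<theta> U)" by (rule dvd_of_no_common_root[OF TH(2) tnz])
  hence "k \<le> degree (lead_coeff (\<theta> U))" using dvd_imp_degree_le[of "T H"] U0 TH(1) by simp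
  also have "\<dots> \<le> degree U" by (rule degc)
  finally show False using UV(3) h(1) by simp
qed

section \<open>Duality\<close>

lemma gd_perm_cols:
  assumes "p permutes {..<r}"
  shows "gd r y (\<lambda>j. b (p j)) = of_int (sign p) * gd r y b"
proof -
  have p: "p permutes {0..<r}" using assms by (simp add: atLeast0LessThan)
  have pi: "p i < r" if "i < r" for i
    using permutes_in_image[OF assms, of i] that by simp
  let ?B = "mat r r (\<lambda>(i, j). y j ^ b i)"
  have t: "mat r r (\<lambda>(i, j). y i ^ c j) = transpose_mat (mat r r (\<lambda>(i, j). y j ^ c i))" for c
    by (rule eq_matI) simp_all
  have e: "mat r r (\<lambda>(i, j). y j ^ b (p i)) = mat r r (\<lambda>(i, j). ?B $$ (p i, j))"
    by (rule eq_matI) (simp_all add: pi)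
  have "gd r y (\<lambda>j. b (p j)) = det (mat r r (\<lambda>(i, j). y j ^ b (p i)))"
    unfolding gd_def t by (rule det_transpose[of _ r]) simp
  also have "\<dots> = det (mat r r (\<lambda>(i, j). ?B $$ (p i, j)))" by (rule arg_cong[OF e])
  also have "\<dots> = of_int (sign p) * det ?B" by (rule det_permute_rows[OF _ p]) simp
  also have "det ?B = gd r y b" unfolding gd_def t[of b] by (rule det_transpose[of _ r, symmetric]) simp
  finally show ?thesis .
qed

definition flip :: "nat \<Rightarrow> nat \<Rightarrow> nat" where "flip r i = (if i < r then r - 1 - i else i)"

lemma flip_permutes: "flip r permutes {..<r}"
proof (rule bij_imp_permutes)
  show "bij_betw (flip r) {..<r} {..<r}"
    by (rule bij_betwI[where g = "flip r"]) (auto simp: flip_def)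
qed (auto simp: flip_def)

text \<open>Inverting the nodes negates the exponents. The power M makes them nonnegative, and
  reversing the columns restores the decreasing order at the price of a sign.\<close>

lemma gd_flip:
  fixes y :: "nat \<Rightarrow> complex"
  assumes "\<And>i. i < r \<Longrightarrow> y i \<noteq> 0" "\<And>j. j < r \<Longrightarrow> b j \<le> M"
  shows "gd r y (\<lambda>j. M - b (r - 1 - j)) = (\<Prod>i<r. y i ^ M) * (of_int (sign (flip r)) * gd r (\<lambda>i. 1 / y i) b)"
proof -
  have "gd r y (\<lambda>j. M - b (r - 1 - j)) = gd r y (\<lambda>j. M - b (flip r j))"
    by (rule gd_cong) (auto simp: flip_def)
  also have "\<dots> = of_int (sign (flip r)) * gd r y (\<lambda>j. M - b j)"
    using gd_perm_cols[OF flip_permutes, of r y "\<lambda>j. M - b j"] .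
  also have "gd r y (\<lambda>j. M - b j) = (\<Prod>i<r. y i ^ M) * gd r (\<lambda>i. 1 / y i) b"
    unfolding gd_leibniz sum_distrib_left
  proof (rule sum.cong[OF refl])
    fix \<sigma> assume s: "\<sigma> \<in> {\<sigma>. \<sigma> permutes {..<r}}"
    have "(\<Prod>i<r. y i ^ (M - b (\<sigma> i))) = (\<Prod>i<r. y i ^ M * (1 / y i) ^ b (\<sigma> i))"
    proof (rule prod.cong[OF refl])
      fix i assume i: "i \<in> {..<r}"
      hence "\<sigma> i < r" using s permutes_in_image by fastforce
      hence "b (\<sigma> i) \<le> M" by (rule assms(2))
      hence "y i ^ M = y i ^ (M - b (\<sigma> i)) * y i ^ b (\<sigma> i)" by (simp flip: power_add)
      thus "y i ^ (M - b (\<sigma> i)) = y i ^ M * (1 / y i) ^ b (\<sigma> i)"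
        using assms(1)[of i] i by (simp flip: power_mult_distrib)
    qed
    thus "of_int (sign \<sigma>) * (\<Prod>i<r. y i ^ (M - b (\<sigma> i))) =
       (\<Prod>i<r. y i ^ M) * (of_int (sign \<sigma>) * (\<Prod>i<r. (1 / y i) ^ b (\<sigma> i)))"
      by (simp only: prod.distrib mult_ac)
  qed
  finally show ?thesis by (simp only: mult_ac)
qed

lemma ev_prod_Var: "ev y (\<Prod>i<r. Var i ^ N) = (\<Prod>i<r. y i ^ N)"
  by (simp add: ev_simps)

lemma Var_nonzero: "Var i \<noteq> 0"
  using lin_nonzero[of "(i, i, 0)"] by (simp add: lin_def)

text \<open>Clearing denominators after x_i to 1/x_i. The claim covers all large N because two
  summands must be brought to a common exponent.\<close>

lemma inversion_exists:
  assumes "vars P \<subseteq> {..<r}"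
  shows "\<exists>N0. \<forall>N\<ge>N0. \<exists>Q. \<forall>y :: nat \<Rightarrow> complex. (\<forall>i<r. y i \<noteq> 0) \<longrightarrow>
     ev y Q = (\<Prod>i<r. y i ^ N) * ev (\<lambda>i. 1 / y i) P"
  using assms
proof (induction rule: mpoly_induct)
  case (emb c)
  show ?case
  proof (intro exI[of _ "0 :: nat"] allI impI)
    fix N :: nat
    show "\<exists>Q. \<forall>y :: nat \<Rightarrow> complex. (\<forall>i<r. y i \<noteq> 0) \<longrightarrow>
     ev y Q = (\<Prod>i<r. y i ^ N) * ev (\<lambda>i. 1 / y i) (emb c)"
      by (rule exI[of _ "(\<Prod>i<r. Var i ^ N) * emb c"]) (simp add: ev_mult ev_prod_Var)
  qed
next
  case (Var i)
  show ?case
  proof (intro exI[of _ "1 :: nat"] allI impI)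
    fix N :: nat assume N: "1 \<le> N"
    have "ev y ((\<Prod>j\<in>{..<r} - {i}. Var j ^ N) * Var i ^ (N - 1)) = (\<Prod>j<r. y j ^ N) * ev (\<lambda>i. 1 / y i) (Var i)"
      if y: "\<forall>i<r. y i \<noteq> 0" for y :: "nat \<Rightarrow> complex"
    proof -
      have yi: "y i \<noteq> 0" using y Var by simp
      have "(\<Prod>j<r. y j ^ N) = y i ^ N * (\<Prod>j\<in>{..<r} - {i}. y j ^ N)"
        using Var by (intro prod.remove) auto
      moreover have "y i ^ N = y i * y i ^ (N - 1)" using N by (simp flip: power_Suc)
      ultimately show ?thesis using yi by (simp add: ev_simps)
    qed
    thus "\<exists>Q. \<forall>y :: nat \<Rightarrow> complex. (\<forall>i<r. y i \<noteq> 0) \<longrightarrow>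
     ev y Q = (\<Prod>i<r. y i ^ N) * ev (\<lambda>i. 1 / y i) (Var i)" by blast
  qed
next
  case (add A B)
  obtain N1 where N1: "\<forall>N\<ge>N1. \<exists>Q. \<forall>y :: nat \<Rightarrow> complex. (\<forall>i<r. y i \<noteq> 0) \<longrightarrow>
     ev y Q = (\<Prod>i<r. y i ^ N) * ev (\<lambda>i. 1 / y i) A" using add(1) by blast
  obtain N2 where N2: "\<forall>N\<ge>N2. \<exists>Q. \<forall>y :: nat \<Rightarrow> complex. (\<forall>i<r. y i \<noteq> 0) \<longrightarrow>
     ev y Q = (\<Prod>i<r. y i ^ N) * ev (\<lambda>i. 1 / y i) B" using add(2) by blast
  show ?case
  proof (intro exI[of _ "N1 + N2"] allI impI)
    fix N :: nat assume N: "N1 + N2 \<le> N"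
    obtain Q1 where Q1: "\<forall>y :: nat \<Rightarrow> complex. (\<forall>i<r. y i \<noteq> 0) \<longrightarrow>
     ev y Q1 = (\<Prod>i<r. y i ^ N) * ev (\<lambda>i. 1 / y i) A" using N1[rule_format, of N] N by auto
    obtain Q2 where Q2: "\<forall>y :: nat \<Rightarrow> complex. (\<forall>i<r. y i \<noteq> 0) \<longrightarrow>
     ev y Q2 = (\<Prod>i<r. y i ^ N) * ev (\<lambda>i. 1 / y i) B" using N2[rule_format, of N] N by auto
    show "\<exists>Q. \<forall>y :: nat \<Rightarrow> complex. (\<forall>i<r. y i \<noteq> 0) \<longrightarrow>
     ev y Q = (\<Prod>i<r. y i ^ N) * ev (\<lambda>i. 1 / y i) (A + B)"
      by (rule exI[of _ "Q1 + Q2"]) (simp add: ev_add Q1 Q2 distrib_left)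
  qed
next
  case (mult A B)
  obtain N1 where N1: "\<forall>N\<ge>N1. \<exists>Q. \<forall>y :: nat \<Rightarrow> complex. (\<forall>i<r. y i \<noteq> 0) \<longrightarrow>
     ev y Q = (\<Prod>i<r. y i ^ N) * ev (\<lambda>i. 1 / y i) A" using mult(1) by blast
  obtain N2 where N2: "\<forall>N\<ge>N2. \<exists>Q. \<forall>y :: nat \<Rightarrow> complex. (\<forall>i<r. y i \<noteq> 0) \<longrightarrow>
     ev y Q = (\<Prod>i<r. y i ^ N) * ev (\<lambda>i. 1 / y i) B" using mult(2) by blast
  show ?case
  proof (intro exI[of _ "N1 + N2"] allI impI)
    fix N :: nat assume N: "N1 + N2 \<le> N"
    obtain Q1 where Q1: "\<forall>y :: nat \<Rightarrow> complex. (\<forall>i<r. y i \<noteq> 0) \<longrightarrow>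
     ev y Q1 = (\<Prod>i<r. y i ^ N1) * ev (\<lambda>i. 1 / y i) A" using N1[rule_format, of N1] by auto
    obtain Q2 where Q2: "\<forall>y :: nat \<Rightarrow> complex. (\<forall>i<r. y i \<noteq> 0) \<longrightarrow>
     ev y Q2 = (\<Prod>i<r. y i ^ (N - N1)) * ev (\<lambda>i. 1 / y i) B" using N2[rule_format, of "N - N1"] N by (auto simp: le_diff_conv2)
    have pp: "(\<Prod>i<r. y i ^ N) = (\<Prod>i<r. y i ^ N1) * (\<Prod>i<r. y i ^ (N - N1))" for y :: "nat \<Rightarrow> complex"
      using N by (simp flip: prod.distrib power_add)
    show "\<exists>Q. \<forall>y :: nat \<Rightarrow> complex. (\<forall>i<r. y i \<noteq> 0) \<longrightarrow>
     ev y Q = (\<Prod>i<r. y i ^ N) * ev (\<lambda>i. 1 / y i) (A * B)"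
      by (rule exI[of _ "Q1 * Q2"]) (simp add: ev_mult Q1 Q2 pp)
  qed
qed

lemma torus_eq:
  assumes "\<And>y :: nat \<Rightarrow> complex. (\<forall>i<r. y i \<noteq> 0) \<Longrightarrow> ev y W \<noteq> 0 \<Longrightarrow> ev y P = ev y Q" "W \<noteq> 0"
  shows "P = Q"
proof -
  have "P - Q = 0"
  proof (rule ev_eq_0_off)
    show "(\<Prod>i<r. Var i ^ 1) * W \<noteq> 0" using assms(2) Var_nonzero by simp
    fix y :: "nat \<Rightarrow> complex" assume "ev y ((\<Prod>i<r. Var i ^ 1) * W) \<noteq> 0"
    hence "\<forall>i<r. y i \<noteq> 0" "ev y W \<noteq> 0" by (auto simp: ev_simps)
    thus "ev y (P - Q) = 0" using assms(1)[of y] by (simp add: ev_simps)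
  qed
  thus ?thesis by simp
qed

text \<open>The exponent 0 keeps S(a) nonzero on x_u = 0, so no variable divides a factor.\<close>

lemma Tz_nonzero:
  assumes "fact_pair (Suc n) d a G H" "u \<le> n" shows "Tz u G \<noteq> 0"
proof -
  define \<rho> where "\<rho> = Transposition.transpose u n"
  note r = swap_last[OF assms(2), folded \<rho>_def]
  note f = fact_pairD[OF fact_pair_pact[OF assms(1) r(1)], simplified diff_Suc_1]
  have "Tz n (pact \<rho> G * pact \<rho> H * S (Suc n) (drho (Suc n) d)) = S n a"
    unfolding f(7) by (rule Tz_S[OF f(1,2)])
  moreover have "S n a \<noteq> 0" by (rule S_nonzero[OF dec_sub[OF f(1)]])
  ultimately have "Tz n (pact \<rho> G) \<noteq> 0" by (auto simp: ahom_mult[OF ahom_Tz])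
  moreover have "pact \<rho> (Tz u G) = Tz n (pact \<rho> G)"
    using Tz_pact[OF r(2), of u G] r(4) r(5)[of n] by simp
  ultimately show ?thesis by (auto simp: ahom_0[OF ahom_pact])
qed

text \<open>Inverting once more shows that G times a monomial is a monomial up to a constant. As no
  variable divides G, it is constant.\<close>

lemma const_of_inverse_monomial:
  assumes f: "fact_pair (Suc n) d a G H"
    and Q: "\<And>y :: nat \<Rightarrow> complex. (\<forall>i<Suc n. y i \<noteq> 0) \<Longrightarrow> ev y Q = (\<Prod>i<Suc n. y i ^ N) * ev (\<lambda>i. 1 / y i) G"
    and eq: "Q * (\<Prod>i<Suc n. Var i ^ e) = emb c * (\<Prod>t\<in>K. lin t)" and K: "K \<subseteq> Mset (Suc n) k"
  shows "is_const G"
proof -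
  have finM: "finite (Mset m l)" for m l by (simp add: Mset_def)
  have finK: "finite K" by (rule finite_subset[OF K finM])
  have ml: "ev y (lin t) = y (fst t) \<and> fst t < Suc n" if "t \<in> K" for t and y :: "nat \<Rightarrow> complex"
    using that K by (auto simp: Mset_def ev_lin)
  have "G * (\<Prod>t\<in>K. lin t) = emb c * (\<Prod>t\<in>Mset (Suc n) (N + e). lin t)"
  proof (rule torus_eq[where W = 1 and r = "Suc n"])
    fix y :: "nat \<Rightarrow> complex" assume y: "\<forall>i<Suc n. y i \<noteq> 0"
    define z where "z = (\<lambda>i. 1 / y i)"
    have z: "\<forall>i<Suc n. z i \<noteq> 0" "(\<lambda>i. 1 / z i) = y" using y by (auto simp: z_def)
    have yz: "(\<Prod>i<Suc n. y i ^ m) * (\<Prod>i<Suc n. z i ^ m) = 1" for m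
    proof -
      have "(\<Prod>i<Suc n. y i ^ m) * (\<Prod>i<Suc n. z i ^ m) = (\<Prod>i<Suc n. (y i * z i) ^ m)"
        by (simp only: prod.distrib power_mult_distrib)
      also have "\<dots> = (\<Prod>i<Suc n. 1)" using y by (intro prod.cong) (auto simp: z_def)
      finally show ?thesis by simp
    qed
    have kyz: "ev y (\<Prod>t\<in>K. lin t) * ev z (\<Prod>t\<in>K. lin t) = 1"
    proof -
      have "ev y (\<Prod>t\<in>K. lin t) * ev z (\<Prod>t\<in>K. lin t) = (\<Prod>t\<in>K. ev y (lin t) * ev z (lin t))"
        by (simp add: ev_simps prod.distrib)
      also have "\<dots> = (\<Prod>t\<in>K. 1)"
      proof (rule prod.cong[OF refl])
        fix t assume t: "t \<in> K"
        show "ev y (lin t) * ev z (lin t) = 1" using ml[OF t] y by (simp add: z_def)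
      qed
      finally show ?thesis by simp
    qed
    have "ev z (Q * (\<Prod>i<Suc n. Var i ^ e)) = ev z (emb c * (\<Prod>t\<in>K. lin t))" by (simp only: eq)
    hence "(\<Prod>i<Suc n. z i ^ N) * ev y G * (\<Prod>i<Suc n. z i ^ e) = c * ev z (\<Prod>t\<in>K. lin t)"
      unfolding ev_mult ev_prod_Var Q[OF z(1)] z(2) by simp
    note hz = this
    have "((\<Prod>i<Suc n. y i ^ N) * (\<Prod>i<Suc n. z i ^ N)) * ((\<Prod>i<Suc n. y i ^ e) * (\<Prod>i<Suc n. z i ^ e)) * ev y G * ev y (\<Prod>t\<in>K. lin t)
      = ((\<Prod>i<Suc n. z i ^ N) * ev y G * (\<Prod>i<Suc n. z i ^ e)) * ((\<Prod>i<Suc n. y i ^ N) * (\<Prod>i<Suc n. y i ^ e) * ev y (\<Prod>t\<in>K. lin t))"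
      by (simp only: mult_ac)
    also have "\<dots> = c * (\<Prod>i<Suc n. y i ^ N) * (\<Prod>i<Suc n. y i ^ e) * (ev y (\<Prod>t\<in>K. lin t) * ev z (\<Prod>t\<in>K. lin t))"
      unfolding hz by (simp only: mult_ac)
    finally have "((\<Prod>i<Suc n. y i ^ N) * (\<Prod>i<Suc n. z i ^ N)) * ((\<Prod>i<Suc n. y i ^ e) * (\<Prod>i<Suc n. z i ^ e)) * ev y G * ev y (\<Prod>t\<in>K. lin t)
      = c * (\<Prod>i<Suc n. y i ^ N) * (\<Prod>i<Suc n. y i ^ e) * (ev y (\<Prod>t\<in>K. lin t) * ev z (\<Prod>t\<in>K. lin t))" .
    hence "ev y G * ev y (\<Prod>t\<in>K. lin t) = c * ((\<Prod>i<Suc n. y i ^ N) * (\<Prod>i<Suc n. y i ^ e))"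
      unfolding yz kyz by simp
    thus "ev y (G * (\<Prod>t\<in>K. lin t)) = ev y (emb c * (\<Prod>t\<in>Mset (Suc n) (N + e). lin t))"
      unfolding prod_Mset ev_mult ev_prod_Var by (simp add: power_add prod.distrib)
  qed simp
  from lin_split[OF finM this] obtain J A' B' where J: "J \<subseteq> Mset (Suc n) (N + e)" "G = A' * (\<Prod>t\<in>J. lin t)"
    "A' * B' = emb c" by (elim exE conjE) (rule that)
  have "J = {}"
  proof (rule ccontr)
    assume "J \<noteq> {}"
    then obtain t where t: "t \<in> J" by blast
    then obtain u z where u: "t = (u, u, z)" "u < Suc n" using J(1) by (auto simp: Mset_def)
    have finJ: "finite J" by (rule finite_subset[OF J(1) finM])
    have "Tz u (lin t) = 0" by (simp add: u lin_def Tz_def)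
    hence "Tz u G = 0" using t finJ by (auto simp: J(2) ahom_mult[OF ahom_Tz] ahom_prod[OF ahom_Tz])
    thus False using Tz_nonzero[OF f, of u] u by simp
  qed
  hence G: "G = A'" using J by simp
  have "c \<noteq> 0"
  proof
    assume "c = 0"
    hence "G * (\<Prod>t\<in>K. lin t) = 0" using \<open>G * (\<Prod>t\<in>K. lin t) = _\<close> by simp
    thus False using fact_pair_nz(1)[OF f] prod_lin_nonzero[OF finK] by simp
  qed
  thus ?thesis using emb_factor[OF J(3)] G by (auto simp: is_const_def)
qed

text \<open>Under x_i to 1/x_i the quotient C(a) becomes, up to a monomial, the quotient for the
  reversed vector a_0 - a_{n-j}, which has the same gcd. X and Y are the inverted factors with
  denominators cleared; splitting off the monomial leaves a factorisation A B of the dual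
  quotient.\<close>

lemma dual:
  assumes f: "fact_pair (Suc n) d a G H" and n: "n \<ge> 1"
    and irr: "\<And>A B. fact_pair (Suc n) d (\<lambda>j. a 0 - a (n - j)) A B \<Longrightarrow> is_const A \<or> is_const B"
  shows "is_const G \<or> is_const H"
proof -
  define r where "r = Suc n"
  note g = fact_pairD[OF f, simplified diff_Suc_1]
  let ?b = "\<lambda>j. a 0 - a (n - j)"
  have le: "a j \<le> a 0" if "j < r" for j
    using g(1) that unfolding dec_def r_def by (cases j) (auto simp: less_imp_le)
  have decb: "dec (Suc n) ?b"
    unfolding dec_def
  proof (intro allI impI)
    fix i j assume ij: "i < j" "j < Suc n"
    have "a (n - i) < a (n - j)" using g(1) ij unfolding dec_def by auto
    moreover have "a (n - j) \<le> a 0" by (rule le) (simp add: r_def)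
    ultimately show "a 0 - a (n - j) < a 0 - a (n - i)" by linarith
  qed
  have bn: "?b n = 0" by simp
  have dvdb: "d dvd ?b j" for j
    using fact_pair_dvd[OF f] by (intro dvd_diff_nat) auto
  have Gb: "d = Gcd (?b ` {..<Suc n})"
  proof (rule dvd_antisym)
    show "d dvd Gcd (?b ` {..<Suc n})" using dvdb by (intro Gcd_greatest) auto
    have "Gcd (?b ` {..<Suc n}) dvd ?b 0" by (intro Gcd_dvd imageI) simp
    hence 0: "Gcd (?b ` {..<Suc n}) dvd a 0" using g(2) by simp
    have "Gcd (?b ` {..<Suc n}) dvd a j" if j: "j < Suc n" for j
    proof -
      have "Gcd (?b ` {..<Suc n}) dvd ?b (n - j)" by (intro Gcd_dvd imageI) simp
      hence "Gcd (?b ` {..<Suc n}) dvd a 0 - a j" using j by simp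
      thus ?thesis using 0 le[of j] j dvd_diffD1[of _ "a 0" "a j"] by (simp add: r_def)
    qed
    thus "Gcd (?b ` {..<Suc n}) dvd d" unfolding g(3) by (intro Gcd_greatest) auto
  qed
  obtain C where C: "C * S (Suc n) (drho (Suc n) d) = S (Suc n) ?b"
    using exists_C[OF g(4), of "Suc n" ?b] dvdb by blast
  obtain N1 where N1: "\<forall>N\<ge>N1. \<exists>Q. \<forall>y :: nat \<Rightarrow> complex. (\<forall>i<Suc n. y i \<noteq> 0) \<longrightarrow>
     ev y Q = (\<Prod>i<Suc n. y i ^ N) * ev (\<lambda>i. 1 / y i) G" using inversion_exists[OF g(5)] by blast
  obtain N2 where N2: "\<forall>N\<ge>N2. \<exists>Q. \<forall>y :: nat \<Rightarrow> complex. (\<forall>i<Suc n. y i \<noteq> 0) \<longrightarrow>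
     ev y Q = (\<Prod>i<Suc n. y i ^ N) * ev (\<lambda>i. 1 / y i) H" using inversion_exists[OF g(6)] by blast
  obtain X where X: "\<And>y :: nat \<Rightarrow> complex. (\<forall>i<Suc n. y i \<noteq> 0) \<Longrightarrow>
     ev y X = (\<Prod>i<Suc n. y i ^ N1) * ev (\<lambda>i. 1 / y i) G" using N1 by blast
  obtain Y where Y: "\<And>y :: nat \<Rightarrow> complex. (\<forall>i<Suc n. y i \<noteq> 0) \<Longrightarrow>
     ev y Y = (\<Prod>i<Suc n. y i ^ N2) * ev (\<lambda>i. 1 / y i) H" using N2 by blast
  let ?m = "\<lambda>k. \<Prod>i<Suc n. Var i ^ k"
  \<comment> \<open>The exponent collects the denominators N1 and N2 of G and H and the largest
    exponent d n of d rho; a_0 is the largest one of a.\<close>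
  have main: "X * (Y * ?m (a 0)) = C * (\<Prod>t\<in>Mset (Suc n) (N1 + N2 + d * n). lin t)"
  proof (rule torus_eq[where W = "S (Suc n) (drho (Suc n) d)" and r = "Suc n"])
    show "S (Suc n) (drho (Suc n) d) \<noteq> 0" by (rule S_nonzero[OF dec_drho[OF g(4)]])
    fix y :: "nat \<Rightarrow> complex"
    assume y: "\<forall>i<Suc n. y i \<noteq> 0" and W: "ev y (S (Suc n) (drho (Suc n) d)) \<noteq> 0"
    define z where "z = (\<lambda>i. 1 / y i)"
    define p where "p = (\<lambda>k. \<Prod>i<Suc n. y i ^ k)"
    define \<epsilon> where "\<epsilon> = (of_int (sign (flip (Suc n))) :: complex)"
    have e0: "\<epsilon> \<noteq> 0" by (auto simp: \<epsilon>_def sign_def)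
    have 1: "gd (Suc n) y ?b = p (a 0) * (\<epsilon> * gd (Suc n) z a)"
      using gd_flip[of "Suc n" y a "a 0"] y le unfolding z_def \<epsilon>_def p_def r_def by simp
    have "gd (Suc n) y (drho (Suc n) d) = gd (Suc n) y (\<lambda>j. d * n - drho (Suc n) d (Suc n - 1 - j))"
      by (rule gd_cong) (auto simp: drho_def simp flip: diff_mult_distrib2)
    also have "\<dots> = p (d * n) * (\<epsilon> * gd (Suc n) z (drho (Suc n) d))"
      using gd_flip[of "Suc n" y "drho (Suc n) d" "d * n"] y unfolding z_def \<epsilon>_def p_def by (simp add: drho_def)
    finally have 2: "gd (Suc n) y (drho (Suc n) d) = p (d * n) * (\<epsilon> * gd (Suc n) z (drho (Suc n) d))" .
    have w0: "gd (Suc n) z (drho (Suc n) d) \<noteq> 0" using W unfolding ev_S 2 by auto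
    have 3: "ev z G * ev z H * gd (Suc n) z (drho (Suc n) d) = gd (Suc n) z a" by (rule fact_pair_ev[OF f])
    have 4: "ev y C * gd (Suc n) y (drho (Suc n) d) = gd (Suc n) y ?b"
      using arg_cong[OF C, of "ev y"] by (simp add: ev_mult ev_S)
    have "(\<epsilon> * gd (Suc n) z (drho (Suc n) d)) * (ev y C * p (d * n)) =
      (\<epsilon> * gd (Suc n) z (drho (Suc n) d)) * (p (a 0) * (ev z G * ev z H))"
      using 4 unfolding 1 2 3[symmetric] by (simp only: mult_ac)
    hence 5: "ev y C * p (d * n) = p (a 0) * (ev z G * ev z H)"
      using w0 e0 by (subst (asm) mult_left_cancel) auto
    have p: "p (N1 + N2 + d * n) = p N1 * p N2 * p (d * n)"
      by (simp add: p_def power_add prod.distrib)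
    have "ev y (X * (Y * ?m (a 0))) = p N1 * ev z G * (p N2 * ev z H * p (a 0))"
      unfolding ev_mult ev_prod_Var X[OF y] Y[OF y] p_def z_def ..
    also have "\<dots> = p N1 * p N2 * (p (a 0) * (ev z G * ev z H))" by (simp only: mult_ac)
    also have "\<dots> = ev y C * p (N1 + N2 + d * n)" unfolding 5[symmetric] p by (simp only: mult_ac)
    finally show "ev y (X * (Y * ?m (a 0))) = ev y (C * (\<Prod>t\<in>Mset (Suc n) (N1 + N2 + d * n). lin t))"
      unfolding prod_Mset ev_mult ev_prod_Var p_def .
  qed
  have finM: "finite (Mset (Suc n) (N1 + N2 + d * n))" by (simp add: Mset_def)
  from lin_split[OF finM main] obtain J A B where J: "J \<subseteq> Mset (Suc n) (N1 + N2 + d * n)"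
    "X = A * (\<Prod>t\<in>J. lin t)" "Y * ?m (a 0) = B * (\<Prod>t\<in>Mset (Suc n) (N1 + N2 + d * n) - J. lin t)" "A * B = C"
    by (elim exE conjE) (rule that)
  have nzb: "S (Suc n) ?b \<noteq> 0" by (rule S_nonzero[OF decb])
  have eq: "A * B * S (Suc n) (drho (Suc n) d) = S (Suc n) ?b" unfolding J(4) by (rule C)
  have eqs: "A * (B * S (Suc n) (drho (Suc n) d)) = S (Suc n) ?b" "B * (A * S (Suc n) (drho (Suc n) d)) = S (Suc n) ?b"
    using eq by (simp_all only: mult_ac)
  have vA: "vars A \<subseteq> {..<Suc n}"
    using vars_factor[of A "B * S (Suc n) (drho (Suc n) d)", unfolded eqs(1), OF nzb] vars_S by blast
  have vB: "vars B \<subseteq> {..<Suc n}"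
    using vars_factor[of B "A * S (Suc n) (drho (Suc n) d)", unfolded eqs(2), OF nzb] vars_S by blast
  have "fact_pair (Suc n) d ?b A B"
    unfolding fact_pair_def diff_Suc_1 by (intro conjI decb bn Gb g(4) vA vB eq)
  hence "is_const A \<or> is_const B" by (rule irr)
  thus ?thesis
  proof
    assume "is_const A"
    then obtain c where c: "A = emb c" by (auto simp: is_const_def)
    have "X * ?m 0 = emb c * (\<Prod>t\<in>J. lin t)" using J(2) c by simp
    hence "is_const G" by (intro const_of_inverse_monomial[OF f _ _ J(1)]) (rule X)
    thus ?thesis ..
  next
    assume "is_const B"
    then obtain c where c: "B = emb c" by (auto simp: is_const_def)
    have "is_const H"
      by (rule const_of_inverse_monomial[OF fact_pair_swap[OF f] _ J(3)[unfolded c] Diff_subset]) (rule Y)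
    thus ?thesis ..
  qed
qed

section \<open>Equal middle gaps\<close>

text \<open>Up to sign, p(0) is the leading coefficient times the product of the roots.\<close>

lemma roots_in_disc_bound:
  fixes p :: "complex poly"
  assumes "p \<noteq> 0" "\<And>x. poly p x = 0 \<Longrightarrow> norm x \<le> 1"
  shows "norm (poly p 0) \<le> norm (lead_coeff p)"
  using assms
proof (induction "degree p" arbitrary: p)
  case 0
  then obtain c where "p = [:c:]" by (metis degree_eq_zeroE)
  thus ?case by simp
next
  case (Suc k)
  hence "\<not> constant (poly p)" by (simp add: constant_degree)
  then obtain t where t: "poly p t = 0" using fundamental_theorem_of_algebra by blast
  then obtain q where q: "p = [:- t, 1:] * q" by (metis poly_eq_0_iff_dvd dvdE)
  have q0: "q \<noteq> 0" using q Suc.prems(1) by auto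
  have "degree p = Suc (degree q)" unfolding q using q0 by (subst degree_mult_eq) auto
  hence "norm (poly q 0) \<le> norm (lead_coeff q)"
    using Suc.hyps(2) Suc.prems(2) q0 by (intro Suc.hyps(1)) (auto simp: q)
  moreover have "norm t \<le> 1" by (rule Suc.prems(2)[OF t])
  moreover have "lead_coeff p = lead_coeff [:- t, 1:] * lead_coeff q" unfolding q by (rule lead_coeff_mult)
  hence "lead_coeff p = lead_coeff q" by simp
  moreover have "norm (poly p 0) = norm t * norm (poly q 0)" by (simp add: q norm_mult)
  ultimately show ?case
    by (metis mult_left_le_one_le norm_ge_zero order.trans)
qed

lemma power_cancel_prime:
  fixes p :: "'a :: idom"
  assumes "\<And>x y. p dvd x * y \<Longrightarrow> p dvd x \<or> p dvd y" "p \<noteq> 0" "\<not> p dvd u" "u dvd p ^ e * r"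
  shows "u dvd r"
  using assms(4)
proof (induction e)
  case (Suc e)
  then obtain v where v: "p ^ Suc e * r = u * v" by blast
  hence "p dvd u * v" by (metis dvd_mult2 dvd_triv_left power_Suc)
  then obtain w where "v = p * w" using assms(1,3) by blast
  hence "p * (p ^ e * r) = p * (u * w)" using v by (simp add: mult_ac)
  hence "p ^ e * r = u * w" using assms(2) by simp
  thus ?case using Suc.IH by simp
qed simp

lemma Var_dvd_iff: "Var m dvd P \<longleftrightarrow> Tz m P = 0"
proof -
  have "lsub (m, m, 0) = (\<lambda>i. if i = m then 0 else Var i)" by (auto simp: lsub_def)
  thus ?thesis using lin_dvd_iff[of "(m, m, 0)" P] by (simp add: lin_def Tz_def)
qed

text \<open>Setting x_m = 0 at once could annihilate the right side. The power of x_m is therefore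
  divided off first, which is allowed because x_m does not divide U; the remaining determinant then
  has smallest exponent 0 and loses its last row and column.\<close>

lemma dvd_step:
  assumes "m \<ge> 2" "dec (Suc m) b" "Tz m U \<noteq> 0"
  defines "y \<equiv> (\<lambda>i :: nat. if i = 1 then 1 else Var i)"
  assumes "U dvd emb \<kappa> * gd (Suc m) y b"
  shows "Tz m U dvd emb \<kappa> * gd m y b"
proof -
  define e where "e = b m"
  define R where "R = (\<Prod>i<m. y i ^ e) * gd (Suc m) y (\<lambda>j. b j - e)"
  have be: "e \<le> b j" if "j \<le> m" for j
    using assms(2) that unfolding dec_def e_def by (cases "j = m") (auto simp: less_imp_le)
  have "gd (Suc m) y b = gd (Suc m) y (\<lambda>j. (b j - e) + e)" using be by (intro gd_cong) auto
  also have "\<dots> = Var m ^ e * R" unfolding gd_shift using assms(1) by (simp add: R_def y_def)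
  finally have "U dvd Var m ^ e * (emb \<kappa> * R)" using assms(5) by (simp add: mult_ac)
  note dv0 = this
  have lv: "lin (m, m, 0) = Var m" by (simp add: lin_def)
  have "U dvd emb \<kappa> * R"
  proof (rule power_cancel_prime[OF _ _ _ dv0])
    show "Var m dvd p \<or> Var m dvd q" if "Var m dvd p * q" for p q
      using lin_prime[of "(m, m, 0)" p q] that unfolding lv .
    show "Var m \<noteq> 0" using lin_nonzero[of "(m, m, 0)"] unfolding lv .
    show "\<not> Var m dvd U" using assms(3) unfolding Var_dvd_iff .
  qed
  then obtain V where "emb \<kappa> * R = U * V" by blast
  hence "Tz m (emb \<kappa> * R) = Tz m U * Tz m V" by (metis ahom_mult[OF ahom_Tz])
  hence dv: "Tz m U dvd emb \<kappa> * Tz m R" by (simp add: ahom_mult[OF ahom_Tz] ahom_emb[OF ahom_Tz])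
  have yT: "Tz m (y i) = (if i = m then 0 else y i)" for i
    using assms(1) by (auto simp: y_def Tz_def ev_simps)
  have pos: "0 < b k - e" if "k < m" for k using assms(2) that unfolding dec_def e_def by auto
  have "Tz m (gd (Suc m) y (\<lambda>j. b j - e)) = gd (Suc m) (\<lambda>i. Tz m (y i)) (\<lambda>j. b j - e)"
    by (rule ahom_gd[OF ahom_Tz])
  also have "\<dots> = (\<Sum>k\<le>m. if k = m then gd m (\<lambda>i. Tz m (y i)) (skip m (\<lambda>j. b j - e)) else 0)"
    unfolding gd_expand
  proof (rule sum.cong[OF refl])
    fix k assume k: "k \<in> {..m}"
    show "Tz m (y m) ^ (b k - e) * ((-1) ^ (m + k) * gd m (\<lambda>i. Tz m (y i)) (skip k (\<lambda>j. b j - e))) =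
      (if k = m then gd m (\<lambda>i. Tz m (y i)) (skip m (\<lambda>j. b j - e)) else 0)"
    proof (cases "k = m")
      case True thus ?thesis by (simp add: e_def flip: mult_2)
    next
      case False
      hence "0 < b k - e" using k pos[of k] by simp
      thus ?thesis using False by (simp add: yT power_0_left)
    qed
  qed
  also have "\<dots> = gd m y (\<lambda>j. b j - e)" by (simp add: yT skip_def cong: gd_cong)
  finally have g: "Tz m (gd (Suc m) y (\<lambda>j. b j - e)) = gd m y (\<lambda>j. b j - e)" .
  have "Tz m R = (\<Prod>i<m. y i ^ e) * gd m y (\<lambda>j. b j - e)"
    unfolding R_def ahom_mult[OF ahom_Tz] ahom_prod[OF ahom_Tz] ahom_power[OF ahom_Tz] g yT
    by (intro arg_cong2[where f = "(*)"] prod.cong refl) auto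
  also have "\<dots> = gd m y (\<lambda>j. (b j - e) + e)" by (rule gd_shift[symmetric])
  also have "\<dots> = gd m y b" using be by (intro gd_cong) auto
  finally show ?thesis using dv by simp
qed

text \<open>Repeats \<open>dvd_step\<close> until only x_0 and x_1 = 1 are left. Nonvanishing under
  R guarantees that no intermediate restriction of U is 0.\<close>

lemma dvd_chain:
  defines "y \<equiv> (\<lambda>i :: nat. if i = 1 then 1 else Var i)"
  defines "R \<equiv> (\<lambda>i :: nat. if i = 0 then [:0, 1 :: complex:] else 0)"
  assumes "n \<ge> 2" "dec n b" "ev R U \<noteq> 0" "U dvd emb \<kappa> * gd n y b"
  shows "ev R U dvd ev R (emb \<kappa> * gd 2 y b)"
  using assms(3-6)
proof (induction n arbitrary: U rule: nat_induct_at_least)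
  case base
  then obtain V where "emb \<kappa> * gd 2 y b = U * V" by blast
  hence "ev R (emb \<kappa> * gd 2 y b) = ev R U * ev R V" by (metis ev_mult)
  thus ?case by simp
next
  case (Suc m)
  have T: "ev R (Tz m U) = ev R U" by (rule Tz_ev_poly) (use Suc.hyps in \<open>simp add: R_def\<close>)
  have "Tz m U \<noteq> 0" using T Suc.prems(2) by auto
  hence "Tz m U dvd emb \<kappa> * gd m y b"
    using dvd_step[OF Suc.hyps Suc.prems(1)] Suc.prems(3) unfolding y_def by blast
  from Suc.IH[OF dec_sub[OF Suc.prems(1)] _ this] show ?case using T Suc.prems(2) by simp
qed

text \<open>The exponents a_j - a_{n-1} in the progression case. The quotient by S(D rho) is the
  complete homogeneous symmetric polynomial h_{c-1} in the x_i^D; c = 1 gives D rho itself.\<close>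

definition ladder :: "nat \<Rightarrow> nat \<Rightarrow> nat \<Rightarrow> nat \<Rightarrow> nat" where
  "ladder c D n j = (if j = 0 then D * (c + n - 2) else D * (n - 1 - j))"

lemma dec_ladder:
  assumes "D > 0" "c > 0" "n \<ge> 2" shows "dec n (ladder c D n)"
  unfolding dec_def ladder_def using assms by auto

text \<open>Setting a variable to 0 takes h_{c-1} to h_{c-1} in the remaining variables.\<close>

lemma ladder_restrict:
  assumes "C * S n (drho n D) = S n (ladder c D n)" "n \<ge> 3" "D > 0" "c > 0"
  shows "ev (\<lambda>i. if i < 3 then Var i else 0) C * S 3 (drho 3 D) = S 3 (ladder c D 3)"
  using assms(2,1)
proof (induction n arbitrary: C rule: nat_induct_at_least)
  case base
  have e: "ev (\<lambda>i. if i < 3 then Var i else 0) P = P" if "P \<in> {S 3 (drho 3 D), S 3 (ladder c D 3)}" for P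
  proof -
    have "vars P \<subseteq> {..<3}" using that vars_S by blast
    hence "ev (\<lambda>i. if i < 3 then Var i else 0) P = ev Var P" by (intro ev_cong) auto
    also have "\<dots> = P" by (rule ev_Var_id)
    finally show ?thesis .
  qed
  have "ev (\<lambda>i. if i < 3 then Var i else 0) (C * S 3 (drho 3 D)) = ev (\<lambda>i. if i < 3 then Var i else 0) (S 3 (ladder c D 3))"
    using base by simp
  thus ?case unfolding ev_mult by (simp add: e)
next
  case (Suc n)
  have l: "ladder c D (Suc n) (n - 1) = D" "ladder c D (Suc n) n = 0"
    using Suc.hyps by (auto simp: ladder_def)
  have "Tz n C * S n (drho n D) = (\<Prod>i<n. Var i ^ (ladder c D (Suc n) (n - 1) - D)) * S n (\<lambda>j. ladder c D (Suc n) j - ladder c D (Suc n) (n - 1))"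
    by (rule Tz_step[OF Suc.prems dec_ladder[OF assms(3,4)] assms(3)]) (use Suc.hyps l in auto)
  also have "\<dots> = S n (\<lambda>j. ladder c D (Suc n) j - D)" unfolding l by simp
  also have "\<dots> = S n (ladder c D n)"
  proof (rule S_cong)
    fix j assume "j < n"
    have "c + Suc n - 2 = Suc (c + n - 2)" using Suc.hyps by simp
    hence "D * (c + Suc n - 2) = D * (c + n - 2) + D" by (simp only: mult_Suc_right add.commute)
    moreover have "n - j = Suc (n - 1 - j)" using \<open>j < n\<close> by simp
    hence "D * (n - j) = D * (n - 1 - j) + D" by (simp only: mult_Suc_right add.commute)
    ultimately show "ladder c D (Suc n) j - D = ladder c D n j" by (auto simp: ladder_def)
  qed
  finally have "ev (\<lambda>i. if i < 3 then Var i else 0) (Tz n C) * S 3 (drho 3 D) = S 3 (ladder c D 3)"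
    by (rule Suc.IH)
  moreover have "ev (\<lambda>i. if i < 3 then Var i else 0) (Tz n C) = ev (\<lambda>i. if i < 3 then Var i else 0) C"
    by (rule Tz_ev_poly) (use Suc.hyps in simp)
  ultimately show ?case by simp
qed

text \<open>The identity h_{c-1}(1, 1, s) (1 - s)^2 = s^(c+1) - (c+1) s + c with s = x^D.\<close>

lemma ladder_value:
  fixes x z :: complex
  assumes "C * S n (drho n D) = S n (ladder c D n)" "n \<ge> 3" "D > 0" "c > 0" "z ^ D = 1"
  shows "ev (\<lambda>i. if i = 2 then x else if i = 0 then z else if i = 1 then 1 else 0) C * (1 - x ^ D) ^ 2
    = x ^ ((c + 1) * D) - of_nat (c + 1) * x ^ D + of_nat c"
proof -
  let ?C = "ev (\<lambda>i. if i < 3 then Var i else 0) C"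
  have "ev (\<lambda>i. if i = 2 then x else if i = 0 then z else 1) ?C * (1 - x ^ D) ^ 2
    = x ^ ((c + 1) * D) - of_nat (c + 1) * x ^ D + (of_nat (c + 1) - 1)"
    by (rule special_value[OF ladder_restrict[OF assms(1-4)] _ _ _ assms(3,5)])
       (auto simp: ladder_def mult.commute)
  also have "ev (\<lambda>i. if i = 2 then x else if i = 0 then z else 1) ?C =
     ev (\<lambda>i. if i = 2 then x else if i = 0 then z else if i = 1 then 1 else 0) C"
    unfolding ev_ev by (intro arg_cong2[where f = ev] ext) (auto simp: ev_simps)
  finally show ?thesis by simp
qed

text \<open>p is \<beta> times the sum of (c - i) x^(D i) over i < c; the proof extracts its degree
  and its two end coefficients.\<close>

lemma quotient_poly_props:
  fixes p :: "complex poly"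
  assumes "\<And>x. poly p x * (1 - x ^ D) ^ 2 = \<beta> * (x ^ ((c + 1) * D) - of_nat (c + 1) * x ^ D + of_nat c)"
    and "D > 0" "c > 0" "\<beta> \<noteq> 0"
  shows "degree p = (c - 1) * D" "lead_coeff p = \<beta>" "poly p 0 = \<beta> * of_nat c"
proof -
  define w where "w = monom 1 D + [:- 1 :: complex:]"
  define t where "t = monom (- (\<beta> * of_nat (c + 1))) D + [:\<beta> * of_nat c:]"
  have eq: "p * w ^ 2 = monom \<beta> ((c + 1) * D) + t"
  proof (rule complex_poly_eqI)
    fix x :: complex
    have "(1 - x ^ D) ^ 2 = (x ^ D - 1) ^ 2" by (rule power2_commute)
    thus "poly (p * w ^ 2) x = poly (monom \<beta> ((c + 1) * D) + t) x"
      using assms(1)[of x] by (simp add: w_def t_def poly_monom algebra_simps)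
  qed
  have w: "degree w = D" "lead_coeff w = 1"
  proof -
    show d: "degree w = D" unfolding w_def using assms(2)
      by (subst degree_add_eq_left) (simp_all add: degree_monom_eq)
    have "coeff w D = 1" using assms(2) by (cases D) (simp_all add: w_def)
    thus "lead_coeff w = 1" by (simp only: d)
  qed
  have "degree t \<le> D" unfolding t_def
    by (intro degree_add_le) (simp_all add: degree_monom_le)
  moreover have "D < (c + 1) * D" using assms(2,3) by simp
  ultimately have t: "degree t < (c + 1) * D" by linarith
  have dm: "degree (monom \<beta> ((c + 1) * D)) = (c + 1) * D" using assms(4) by (rule degree_monom_eq)
  have d: "degree (p * w ^ 2) = (c + 1) * D"
    unfolding eq using t dm by (subst degree_add_eq_left) simp_all
  have l: "lead_coeff (p * w ^ 2) = \<beta>"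
    unfolding d using t by (simp add: eq coeff_eq_0)
  have "p \<noteq> 0" using l assms(4) by auto
  moreover have "w \<noteq> 0" using w(2) by auto
  ultimately have "degree p + 2 * D = (c + 1) * D"
    using d by (simp add: degree_mult_eq degree_power_eq w)
  moreover have "(c + 1) * D = (c - 1) * D + 2 * D"
    using assms(3) by (simp flip: distrib_right)
  ultimately show "degree p = (c - 1) * D" by simp
  show "lead_coeff p = \<beta>" using l by (simp add: lead_coeff_mult lead_coeff_power w(2))
  show "poly p 0 = \<beta> * of_nat c" using assms(1)[of 0] assms(2) by (simp add: power_0_left)
qed


text \<open>On x_n = 0 every linear factor in I divides G or H, whichever receives it.\<close>

lemma vanish_on_lin:
  fixes y :: "nat \<Rightarrow> 'a :: complex_alg"
  assumes "fact_pair (Suc n) d a G H" "Irr n" "n \<ge> 2"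
    and "D = Gcd ((\<lambda>j. a j - a (n - 1)) ` {..<n})"
    and "t \<in> (Lset n D - Lset n d) \<union> Mset n (a (n - 1) - d)" "y n = 0" "ev y (lin t) = 0"
  shows "ev y G * ev y H = 0"
proof -
  let ?I = "(Lset n D - Lset n d) \<union> Mset n (a (n - 1) - d)"
  obtain J A B where *: "J \<subseteq> ?I" "finite ?I"
    "Tz n G = A * (\<Prod>t\<in>J. lin t)" "Tz n H = B * (\<Prod>t\<in>?I - J. lin t)"
    by (rule struct_Tz[OF assms(1-3), folded assms(4)]) (rule that; assumption)
  have "Tz n G * Tz n H = A * B * ((\<Prod>t\<in>?I - J. lin t) * (\<Prod>t\<in>J. lin t))"
    unfolding *(3,4) by (simp only: mult_ac)
  also have "(\<Prod>t\<in>?I - J. lin t) * (\<Prod>t\<in>J. lin t) = (\<Prod>t\<in>?I. lin t)"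
    by (rule prod.subset_diff[OF *(1,2), symmetric])
  also have "\<dots> = lin t * (\<Prod>t\<in>?I - {t}. lin t)" by (rule prod.remove[OF *(2) assms(5)])
  finally have "ev y (Tz n G) * ev y (Tz n H) = ev y (A * B) * (ev y (lin t) * ev y (\<Prod>t\<in>?I - {t}. lin t))"
    by (metis ev_mult)
  thus ?thesis using assms(7) Tz_ev_poly[of y n, OF assms(6)] by simp
qed

text \<open>For d'' = d the leading coefficients carry no linear factors, so the induction
  hypothesis makes one of them constant.\<close>

lemma pure_alt:
  assumes "fact_pair (Suc n) d a G H" "Irr n" "n \<ge> 2" "d = Gcd ((\<lambda>j. a (Suc j)) ` {..<n})" "i \<le> n"
  shows "ev (unitv i) G \<noteq> 0 \<or> ev (unitv i) H \<noteq> 0"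
proof -
  have last: "ev (unitv n) G \<noteq> 0 \<or> ev (unitv n) H \<noteq> 0" if f: "fact_pair (Suc n) d a G H" for G H
  proof -
    obtain C J A B k where *: "J \<subseteq> Lset n d - Lset n d"
      "Lc n G = A * (\<Prod>t\<in>J. lin t)" "Lc n H = B * (\<Prod>t\<in>Lset n d - Lset n d - J. lin t)"
      "is_const A \<or> is_const B"
      by (rule struct_Lc[OF f assms(2,3), folded assms(4)]) (rule that; assumption)
    have e: "Lc n G = A" "Lc n H = B" using * by simp_all
    have nz: "Lc n G \<noteq> 0" "Lc n H \<noteq> 0" using fact_pair_nz[OF f] by simp_all
    obtain kg kh where k: "homog kg G" "homog kh H"
      using fact_pair_hom[OF f] fact_pair_hom[OF fact_pair_swap[OF f]] by metis
    show ?thesis using *(4)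
    proof
      assume "is_const A"
      then obtain c where "Lc n G = emb c" "c \<noteq> 0" using e nz by (auto simp: is_const_def)
      thus ?thesis using pure_power[OF k(1)] by blast
    next
      assume "is_const B"
      then obtain c where "Lc n H = emb c" "c \<noteq> 0" using e nz by (auto simp: is_const_def)
      thus ?thesis using pure_power[OF k(2)] by blast
    qed
  qed
  define \<rho> where "\<rho> = Transposition.transpose i n"
  note r = swap_last[OF assms(5), folded \<rho>_def]
  have "(\<lambda>v. unitv n (\<rho> v)) = unitv i" unfolding unitv_def using r(4,5) by metis
  thus ?thesis using last[OF fact_pair_pact[OF assms(1) r(1)]] by (simp add: ev_pact)
qed

text \<open>After a permutation, H contains the pure power of x_0 and G that of x_1. The linear
  factor involves neither variable, so G H vanishes at all points (X, 1, 0, ..., 0). There H has a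
  leading term in X, so G vanishes identically, against its value at X = 0.\<close>

lemma mixed_pure_plane:
  assumes f: "fact_pair (Suc n) d a G H" and "Irr n" "n \<ge> 3"
    and D: "D = Gcd ((\<lambda>j. a j - a (n - 1)) ` {..<n})"
    and ii: "i \<le> n" "i' \<le> n" "i \<noteq> i'" "ev (unitv i) H \<noteq> 0" "ev (unitv i') G \<noteq> 0"
    and t: "(u, v, z) \<in> (Lset n D - Lset n d) \<union> Mset n (a (n - 1) - d)" "u \<ge> 2" "v \<ge> 2"
  shows False
proof -
  obtain \<rho> where r: "\<rho> permutes {..<Suc n}" "\<rho> i = 0" "\<rho> i' = 1" "bij \<rho>"
    by (rule perm_pair[of i "{..<Suc n}" i' 0 1]) (use ii assms(3) in auto)
  have ru: "(\<lambda>v. unitv 0 (\<rho> v)) = unitv i" "(\<lambda>v. unitv 1 (\<rho> v)) = unitv i'"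
    unfolding unitv_def using r(2-4) by (metis bij_pointE)+
  define G' H' where "G' = pact \<rho> G" and "H' = pact \<rho> H"
  have f': "fact_pair (Suc n) d a G' H'" unfolding G'_def H'_def by (rule fact_pair_pact[OF f r(1)])
  have pH: "ev (unitv 0) H' \<noteq> 0" and pG: "ev (unitv 1) G' \<noteq> 0"
    unfolding G'_def H'_def ev_pact ru by (rule ii)+
  obtain k where k: "homog k H'" by (rule fact_pair_hom[OF fact_pair_swap[OF f']])
  define Y where "Y = (\<lambda>v. if v = 0 then [:0, 1:] else [:unitv 1 v:])"
  have n2: "n \<ge> 2" using assms(3) by simp
  have "ev Y G' * ev Y H' = 0"
    by (rule vanish_on_lin[OF f' assms(2) n2 D t(1)]) (use t assms(3) in \<open>auto simp: Y_def unitv_def ev_lin\<close>)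
  moreover have "lead_coeff (ev Y H') \<noteq> 0"
    using homog_pure(2)[OF k pH, of "unitv 1"] pH unfolding Y_def by simp
  ultimately have "ev Y G' = 0" by auto
  hence "poly (ev Y G') 0 = 0" by simp
  also have "poly (ev Y G') 0 = ev (unitv 1) G'"
    unfolding ahom_ev_comp[OF ahom_poly] by (intro ev_cong) (auto simp: Y_def unitv_def)
  finally show False using pG by simp
qed

text \<open>G H vanishes at (z, 1, X, 0, ..., 0) for all X, where H has a leading term in X. So G
  vanishes there, in particular at X = 0.\<close>

lemma vanish_line:
  assumes f: "fact_pair (Suc n) d a G H" and "Irr n" "n \<ge> 3"
    and D: "D = Gcd ((\<lambda>j. a j - a (n - 1)) ` {..<n})"
    and H: "ev (unitv 2) H \<noteq> 0" and z: "z ^ D = 1" "z ^ d \<noteq> (1 :: complex)"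
  shows "ev (\<lambda>v. if v = 0 then z else if v = 1 then 1 else 0) G = 0"
proof -
  obtain k where k: "homog k H" by (rule fact_pair_hom[OF fact_pair_swap[OF f]])
  define w where "w = (\<lambda>v :: nat. if v = 0 then z else if v = 1 then 1 else 0)"
  define Y where "Y = (\<lambda>v. if v = 2 then [:0, 1:] else [:w v:])"
  have n2: "n \<ge> 2" using assms(3) by simp
  have t: "(0, 1, z) \<in> (Lset n D - Lset n d) \<union> Mset n (a (n - 1) - d)"
    using z assms(3) by (auto simp: Lset_def)
  have "ev Y G * ev Y H = 0"
    by (rule vanish_on_lin[OF f assms(2) n2 D t])
       (use assms(3) in \<open>auto simp: Y_def w_def ev_lin emb_poly_def one_pCons\<close>)
  moreover have "lead_coeff (ev Y H) \<noteq> 0"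
    using homog_pure(2)[OF k H, of w] H unfolding Y_def by simp
  ultimately have "ev Y G = 0" by auto
  hence "poly (ev Y G) 0 = 0" by simp
  also have "poly (ev Y G) 0 = ev w G"
    unfolding ahom_ev_comp[OF ahom_poly] by (intro ev_cong) (auto simp: Y_def w_def)
  finally show ?thesis unfolding w_def .
qed

text \<open>With four variables and a_2 = d no linear factor on x_3 = 0 avoids two of the remaining
  variables, so the argument of \<open>mixed_pure_plane\<close> breaks down. Instead both factors
  vanish at (z, 1, 0, 0). Along (X, 1, 0, 0) this would be a nonzero double root of X^P -
  X^D.\<close>

lemma mixed_pure_4:
  assumes f: "fact_pair (Suc 3) d a G H" and irr: "Irr 3"
    and D: "D = Gcd ((\<lambda>j. a j - a (3 - 1)) ` {..<3})"
    and ii: "i \<le> 3" "i' \<le> 3" "i \<noteq> i'" "ev (unitv i) H \<noteq> 0" "ev (unitv i') G \<noteq> 0"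
    and a: "a 2 = d" "a 1 = d + D" "a 0 = d + P" "D < P" and dD: "d < D" "\<not> D dvd d"
  shows False
proof -
  have D0: "D > 0" using dD by simp
  obtain z :: complex where z: "\<And>k. z ^ k = 1 \<longleftrightarrow> D dvd k" by (rule primitive_root[OF D0]) blast
  have zz: "z ^ D = 1" "z ^ d \<noteq> 1" using z dD by auto
  have z0: "z \<noteq> 0" using zz D0 by (auto simp: power_0_left)
  obtain \<rho> where r: "\<rho> permutes {..<Suc 3}" "\<rho> i = 2" "\<rho> i' = 3" "bij \<rho>"
    by (rule perm_pair[of i "{..<Suc 3}" i' 2 3]) (use ii in auto)
  have ru: "(\<lambda>v. unitv 2 (\<rho> v)) = unitv i" "(\<lambda>v. unitv 3 (\<rho> v)) = unitv i'"
    unfolding unitv_def using r(2-4) by (metis bij_pointE)+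
  define G' H' where "G' = pact \<rho> G" and "H' = pact \<rho> H"
  have f': "fact_pair (Suc 3) d a G' H'" unfolding G'_def H'_def by (rule fact_pair_pact[OF f r(1)])
  have pH: "ev (unitv 2) H' \<noteq> 0" and pG: "ev (unitv 3) G' \<noteq> 0"
    unfolding G'_def H'_def ev_pact ru by (rule ii)+
  define w where "w = (\<lambda>v :: nat. if v = 0 then z else if v = 1 then 1 else 0)"
  have wG: "ev w G' = 0" unfolding w_def by (rule vanish_line[OF f' irr order_refl D pH zz])
  define \<tau> where "\<tau> = Transposition.transpose (2 :: nat) 3"
  have t: "\<tau> permutes {..<Suc 3}" unfolding \<tau>_def by (rule permutes_swap_id) auto
  have ut: "(\<lambda>v. unitv 2 (\<tau> v)) = unitv 3" "(\<lambda>v. w (\<tau> v)) = w"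
    by (auto simp: unitv_def w_def \<tau>_def Transposition.transpose_def)
  have "ev (unitv 2) (pact \<tau> G') \<noteq> 0" using pG by (simp add: ev_pact ut)
  hence "ev w (pact \<tau> H') = 0" unfolding w_def
    by (rule vanish_line[OF fact_pair_swap[OF fact_pair_pact[OF f' t]] irr order_refl D _ zz])
  hence wH: "ev w H' = 0" by (simp add: ev_pact ut)
  define Y where "Y = (\<lambda>v :: nat. if v = 0 then [:0, 1 :: complex:] else if v = 1 then 1 else 0)"
  have pY: "poly (ev Y Q) z = ev w Q" for Q
    unfolding ahom_ev_comp[OF ahom_poly] by (intro ev_cong) (auto simp: Y_def w_def)
  have st: "Tz 3 G' * Tz 3 H' * S 3 (drho 3 d) = (\<Prod>i<3. Var i ^ (a (3 - 1) - d)) * S 3 (\<lambda>j. a j - a (3 - 1))"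
    by (rule struct_Tz[OF f' irr]) auto
  have "ev Y (Tz 3 G') * ev Y (Tz 3 H') * gd 3 Y (drho 3 d) = gd 3 Y (\<lambda>j. a j - d)"
    using arg_cong[OF st, of "ev Y"] by (simp add: a ev_mult ev_S)
  moreover have "Y 3 = 0" by (simp add: Y_def)
  ultimately have eq: "ev Y G' * ev Y H' * gd 3 Y (drho 3 d) = gd 3 Y (\<lambda>j. a j - d)"
    by (simp add: Tz_ev_poly)
  have S: "gd 3 Y (\<lambda>j. a j - d) = monom 1 P + monom (- 1) D + [:0:]"
    by (rule complex_poly_eqI, unfold ahom_gd[OF ahom_poly] gd3)
       (use a D0 in \<open>simp add: Y_def poly_monom power_0_left\<close>)
  have "[:- z, 1:] dvd ev Y G'" "[:- z, 1:] dvd ev Y H'"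
    using wG wH by (simp_all add: pY flip: poly_eq_0_iff_dvd)
  hence "[:- z, 1:] ^ 2 dvd ev Y G' * ev Y H' * gd 3 Y (drho 3 d)"
    unfolding power2_eq_square by (intro dvd_mult2 mult_dvd_mono)
  hence dbl: "[:- z, 1:] ^ 2 dvd monom 1 P + monom (- 1) D + [:0:]" unfolding eq S .
  have "z ^ P - z ^ D = 0" "of_nat P * z ^ P - of_nat D * z ^ D = 0"
    using trinomial_double_root[OF dbl D0 a(4)] by simp_all
  hence "(of_nat P - of_nat D) * z ^ D = 0" by (simp add: algebra_simps)
  thus False using z0 a(4) by simp
qed

lemma pure_all:
  assumes alt: "\<And>i. i \<le> n \<Longrightarrow> ev (unitv i) G \<noteq> 0 \<or> ev (unitv i) H \<noteq> 0"
    and mix: "\<And>i i'. i \<le> n \<Longrightarrow> i' \<le> n \<Longrightarrow> i \<noteq> i' \<Longrightarrow> ev (unitv i) H \<noteq> 0 \<Longrightarrow> ev (unitv i') G \<noteq> 0 \<Longrightarrow> False"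
    and n: "n \<ge> 1"
  shows "(\<forall>i\<le>n. ev (unitv i) G \<noteq> 0) \<or> (\<forall>i\<le>n. ev (unitv i) H \<noteq> 0)"
  by (metis alt mix n le_eq_less_or_eq less_one not_less zero_le zero_neq_one)


text \<open>The case D \<noteq> d. Put x_1 = 1 and x_n = \<zeta> of order D. All exponents but the
  last are congruent to Q mod D, so S(a) becomes the nonzero constant 1 - \<zeta>^Q times a smaller
  determinant. Setting further variables to 0 shows that h divides a multiple of x^(a_0) - x^(a_1),
  whose roots lie in the closed unit disc. But |h(0)| exceeds the leading coefficient of h by the
  factor c > 1.\<close>

lemma ladder_c3:
  fixes \<beta> :: complex
  assumes f: "fact_pair (Suc n) d a G H" and n: "n \<ge> 3" and D: "D > 0" and c: "c > 1" and \<beta>: "\<beta> \<noteq> 0"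
    and aj: "\<And>j. 1 \<le> j \<Longrightarrow> j < n \<Longrightarrow> a j = Q + D * (n - 1 - j)" "a 0 = Q + D * (c + n - 2)"
    and dD: "\<not> D dvd Q"
    and val: "\<And>x z. z ^ D = 1 \<Longrightarrow>
      ev (\<lambda>i. if i = 2 then x else if i = 0 then z else if i = 1 then 1 else 0) H * (1 - x ^ D) ^ 2
       = \<beta> * (x ^ ((c + 1) * D) - of_nat (c + 1) * x ^ D + of_nat c)"
  shows False
proof -
  obtain \<zeta> :: complex where z: "\<And>k. \<zeta> ^ k = 1 \<longleftrightarrow> D dvd k" by (rule primitive_root[OF D]) blast
  have z1: "\<zeta> ^ D = 1" and zQ: "\<zeta> ^ Q \<noteq> 1" using z dD by auto
  define h where "h = ev (\<lambda>i. if i = 2 then [:0, 1:] else if i = 0 then [:\<zeta>:] else if i = 1 then 1 else 0) H"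
  have ph: "poly h x = ev (\<lambda>i. if i = 2 then x else if i = 0 then \<zeta> else if i = 1 then 1 else 0) H" for x
    unfolding h_def ahom_ev_comp[OF ahom_poly] by (intro ev_cong) auto
  have c0: "c > 0" using c by simp
  have hv: "poly h x * (1 - x ^ D) ^ 2 = \<beta> * (x ^ ((c + 1) * D) - of_nat (c + 1) * x ^ D + of_nat c)" for x
    unfolding ph by (rule val[OF z1])
  note hp = quotient_poly_props[OF hv D c0 \<beta>]
  \<comment> \<open>\<rho> sends 2 to 0, 0 to n and n to 2: the free variable of \<open>val\<close>
    becomes x_0, which \<open>dvd_chain\<close> keeps, and the root of unity moves to the last
    row.\<close>
  define \<rho> where "\<rho> = Transposition.transpose (2 :: nat) n \<circ> Transposition.transpose 0 2"
  have r: "\<rho> permutes {..<Suc n}" unfolding \<rho>_def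
    using n by (intro permutes_compose permutes_swap_id) auto
  note f' = fact_pair_pact[OF f r] and g = fact_pairD[OF f, simplified diff_Suc_1]
  define Y where "Y = (\<lambda>i. if i = 1 then 1 else if i = n then emb \<zeta> else Var i)"
  define y where "y = (\<lambda>i :: nat. if i = 1 then 1 else Var i)"
  define U where "U = ev Y (pact \<rho> H)"
  have "gd (Suc n) Y a = emb (1 - \<zeta> ^ Q) * gd n y a"
  proof -
    \<comment> \<open>With \<zeta> replaced by 1 the rows 1 and n agree, so the signed minors T k
      sum to 0. This expresses the sum of the first n of them by the last.\<close>
    define Y1 where "Y1 = Y(n := 1)"
    define T where "T = (\<lambda>k. (-1) ^ (n + k) * gd n Y (skip k a))"
    have z: "gd (Suc n) Y1 a = 0"
      by (rule gd_rows_eq[of 1 _ n]) (use n in \<open>auto simp: Y1_def Y_def\<close>)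
    have gY: "gd n Y1 b = gd n Y b" for b by (rule gd_cong) (auto simp: Y1_def)
    have "0 = (\<Sum>k\<le>n. T k)" using z unfolding gd_expand gY by (simp add: Y1_def T_def)
    also have "\<dots> = (\<Sum>k<n. T k) + T n" by (simp flip: lessThan_Suc_atMost)
    finally have s: "(\<Sum>k<n. T k) = - T n" by (metis add_eq_0_iff2)
    have "gd (Suc n) Y a = (\<Sum>k\<le>n. emb \<zeta> ^ a k * T k)"
      unfolding gd_expand using n by (simp add: Y_def T_def)
    also have "\<dots> = (\<Sum>k<n. emb \<zeta> ^ a k * T k) + emb \<zeta> ^ a n * T n" by (simp flip: lessThan_Suc_atMost)
    also have "(\<Sum>k<n. emb \<zeta> ^ a k * T k) = (\<Sum>k<n. emb (\<zeta> ^ Q) * T k)"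
    proof (rule sum.cong[OF refl])
      fix k assume k: "k \<in> {..<n}"
      have "\<exists>m. a k = Q + D * m" using aj k by (cases "k = 0") auto
      then obtain m where "a k = Q + D * m" by blast
      hence "\<zeta> ^ a k = \<zeta> ^ Q" by (simp add: power_add power_mult z1)
      thus "emb \<zeta> ^ a k * T k = emb (\<zeta> ^ Q) * T k" by (simp flip: emb_power)
    qed
    also have "\<dots> = emb (\<zeta> ^ Q) * - T n" unfolding s[symmetric] by (rule sum_distrib_left[symmetric])
    finally have "gd (Suc n) Y a = emb (1 - \<zeta> ^ Q) * T n" using g(2) by (simp add: emb_diff algebra_simps)
    also have "T n = gd n Y (skip n a)" by (simp add: T_def flip: mult_2)
    also have "\<dots> = gd n y a" by (rule gd_cong) (auto simp: skip_def Y_def y_def)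
    finally show ?thesis .
  qed
  hence "ev Y (pact \<rho> G) * U * gd (Suc n) Y (drho (Suc n) d) = emb (1 - \<zeta> ^ Q) * gd n y a"
    using fact_pair_ev[OF f', of Y] by (simp add: U_def)
  hence dv: "U dvd emb (1 - \<zeta> ^ Q) * gd n y a" by (metis dvd_mult2 dvd_triv_right)
  define R where "R = (\<lambda>i :: nat. if i = 0 then [:0, 1 :: complex:] else 0)"
  have "ev R U = h"
  proof -
    have "ev R U = ev (\<lambda>i. ev R (Y (\<rho> i))) H" by (simp add: U_def ev_ev ev_pact)
    also have "\<dots> = h" unfolding h_def
    proof (rule ev_cong)
      fix i assume "i \<in> vars H"
      hence i: "i \<le> n" using g(6) by auto
      have "\<rho> i = (if i = 0 then n else if i = 2 then 0 else if i = n then 2 else i)"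
        using n by (auto simp: \<rho>_def Transposition.transpose_def)
      thus "ev R (Y (\<rho> i)) = (if i = 2 then [:0, 1:] else if i = 0 then [:\<zeta>:] else if i = 1 then 1 else 0)"
        using n i by (auto simp: Y_def R_def ev_simps emb_poly_def)
    qed
    finally show ?thesis .
  qed
  moreover have h0: "h \<noteq> 0" using hp(2) \<beta> by auto
  moreover have n2: "n \<ge> 2" using n by simp
  ultimately have "h dvd ev R (emb (1 - \<zeta> ^ Q) * gd 2 y a)"
    using dvd_chain[OF n2 dec_sub[OF g(1)], of U "1 - \<zeta> ^ Q"] dv unfolding y_def R_def by simp
  moreover have "poly (ev R (emb (1 - \<zeta> ^ Q) * gd 2 y a)) x = (1 - \<zeta> ^ Q) * (x ^ a 0 - x ^ a 1)" for x
    by (simp add: ev_mult gd2 y_def R_def ev_simps emb_poly_def)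
  ultimately have rt: "x ^ a 0 = x ^ a 1" if "poly h x = 0" for x
    using that zQ by (metis dvdE mult_eq_0_iff poly_mult eq_iff_diff_eq_0)
  have "norm (poly h 0) \<le> norm (lead_coeff h)"
  proof (rule roots_in_disc_bound[OF h0])
    fix x assume "poly h x = 0"
    hence e: "norm x ^ a 0 = norm x ^ a 1" using rt by (metis norm_power)
    have "a 1 < a 0" using g(1) n by (auto simp: dec_def)
    thus "norm x \<le> 1" using e power_strict_increasing[of "a 1" "a 0" "norm x"] by fastforce
  qed
  hence "norm \<beta> * real c \<le> norm \<beta>" unfolding hp(2,3) by (simp add: norm_mult)
  moreover have "norm \<beta> * 1 < norm \<beta> * real c" using \<beta> c by (intro mult_strict_left_mono) auto
  ultimately show False by simp
qed

text \<open>The case D = d. Let \<omega> have order M = a_0 - Q. At x_i = \<omega>^i the columns of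
  a_0 and Q agree, so S(a) is divisible by x_n^Q. Neither G nor S(d rho) vanishes at x_n = 0, so
  x_n^Q divides H, whose degree (c - 1) d is smaller than Q.\<close>

lemma ladder_c4:
  assumes f: "fact_pair (Suc n) d a G H" and n: "n \<ge> 3" and c: "c > 1" and \<alpha>: "\<alpha> \<noteq> 0"
    and aj: "a (n - 1) = Q" "a 0 = Q + d * (c + n - 2)" and Qc: "d * c \<le> Q" "\<And>j. j < n \<Longrightarrow> Q \<le> a j"
    and G: "Tz n G = emb \<alpha> * (\<Prod>u<n. Var u ^ (Q - d))"
    and H: "homog ((c - 1) * d) H" "ev (unitv n) H \<noteq> 0"
  shows False
proof -
  note g = fact_pairD[OF f, simplified diff_Suc_1]
  define M where "M = d * (c + n - 2)"
  have M0: "M > 0" using g(4) c n by (simp add: M_def)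
  obtain \<omega> :: complex where w: "\<And>k. \<omega> ^ k = 1 \<longleftrightarrow> M dvd k" by (rule primitive_root[OF M0]) blast
  have w0: "\<omega> \<noteq> 0" using w[of M] M0 by (auto simp: power_0_left)
  define y where "y = (\<lambda>i. if i < n then \<omega> ^ i else 0)"
  define Y where "Y = (\<lambda>i. if i = n then [:0, 1:] else [:y i:])"
  have pY: "poly (ev Y P) 0 = ev y P" for P
    unfolding ahom_ev_comp[OF ahom_poly] by (intro ev_cong) (auto simp: Y_def y_def)
  have eq: "ev Y G * ev Y H * gd (Suc n) Y (drho (Suc n) d) = gd (Suc n) Y a" by (rule fact_pair_ev[OF f])
  have sep: "y i ^ d \<noteq> y j ^ d" if "i < j" "j < Suc n" for i j
  proof (cases "j = n")
    case True thus ?thesis using that w0 g(4) by (simp add: y_def power_0_left)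
  next
    case False
    show ?thesis
    proof
      assume "y i ^ d = y j ^ d"
      hence "\<omega> ^ (i * d) = \<omega> ^ (j * d)" using that False by (simp add: y_def power_mult)
      also have "j * d = i * d + (j - i) * d" using that(1) by (simp flip: distrib_right)
      finally have "\<omega> ^ (i * d) * 1 = \<omega> ^ (i * d) * \<omega> ^ ((j - i) * d)" by (simp add: power_add)
      hence "M dvd (j - i) * d" using w0 w by simp
      hence "M \<le> (j - i) * d" using that g(4) by (intro dvd_imp_le) auto
      moreover have "(j - i) * d < n * d" using that False g(4) by simp
      moreover have "n * d \<le> M" unfolding M_def using c by (subst mult.commute) (intro mult_le_mono2, simp)
      ultimately show False by linarith
    qed
  qed
  have W0: "poly (gd (Suc n) Y (drho (Suc n) d)) 0 \<noteq> 0"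
  proof -
    have "poly (gd (Suc n) Y (drho (Suc n) d)) 0 = gd (Suc n) y (drho (Suc n) d)"
      unfolding ahom_gd[OF ahom_poly] by (rule gd_cong) (auto simp: Y_def y_def)
    thus ?thesis using gd_drho_nonzero[of "Suc n" y d] sep by simp
  qed
  have G0: "poly (ev Y G) 0 \<noteq> 0"
  proof -
    have "ev y G = ev y (Tz n G)" by (rule ev_Tz_zero[symmetric]) (simp add: y_def)
    also have "\<dots> \<noteq> 0" unfolding G using \<alpha> w0 by (simp add: ev_simps y_def)
    finally show ?thesis by (simp add: pY)
  qed
  have "[:0, 1:] ^ Q dvd gd (Suc n) Y a"
    unfolding gd_expand
  proof (rule dvd_sum)
    fix k assume k: "k \<in> {..n}"
    show "[:0, 1:] ^ Q dvd Y n ^ a k * ((- 1) ^ (n + k) * gd n Y (skip k a))"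
    proof (cases "k = n")
      case False
      hence "Q \<le> a k" using k Qc(2)[of k] by simp
      thus ?thesis by (intro dvd_mult2) (simp add: Y_def le_imp_power_dvd)
    next
      case True
      have "gd n Y (skip k a) = gd n (\<lambda>i. [:y i:]) a"
        by (rule gd_cong) (auto simp: True skip_def Y_def)
      also have "\<dots> = 0"
        unfolding gd_eq_0_iff
      proof (intro exI[of _ "\<lambda>j. if j = 0 then 1 else if j = n - 1 then - 1 else 0"] conjI allI impI)
        show "\<exists>j<n. (if j = 0 then 1 else if j = n - 1 then - 1 else 0) \<noteq> (0 :: complex poly)"
          using n by (intro exI[of _ 0]) auto
        fix i assume i: "i < n"
        have "(\<Sum>j<n. (if j = 0 then 1 else if j = n - 1 then - 1 else 0) * [:y i:] ^ a j)
          = (\<Sum>j\<in>{0, n - 1}. (if j = 0 then 1 else if j = n - 1 then - 1 else 0) * [:y i:] ^ a j)"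
          using n by (intro sum.mono_neutral_right) auto
        also have "\<dots> = [:y i:] ^ a 0 - [:y i:] ^ Q"
          using n aj(1) by simp
        also have "y i ^ a 0 = y i ^ Q"
        proof -
          have "(\<omega> ^ i) ^ M = 1" using w[of M] by (metis dvd_refl mult.commute power_mult power_one)
          thus ?thesis using i by (simp add: y_def aj(2) power_add M_def)
        qed
        hence "[:y i:] ^ a 0 - [:y i:] ^ Q = 0" unfolding poly_const_pow by simp
        finally show "(\<Sum>j<n. (if j = 0 then 1 else if j = n - 1 then - 1 else 0) * [:y i:] ^ a j) = 0" .
      qed
      finally show ?thesis by simp
    qed
  qed
  hence dv: "[:0, 1:] ^ Q dvd ev Y G * ev Y H * gd (Suc n) Y (drho (Suc n) d)" unfolding eq .
  have hd: "degree (ev Y H) = (c - 1) * d" "lead_coeff (ev Y H) \<noteq> 0"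
    using homog_pure[OF H, of y] H(2) unfolding Y_def by auto
  have "[:0, 1:] ^ Q dvd ev Y H"
  proof (rule ccontr)
    assume nd: "\<not> [:0, 1:] ^ Q dvd ev Y H"
    have H0: "ev Y H \<noteq> 0" using hd(2) by auto
    have "ev Y G \<noteq> 0" "gd (Suc n) Y (drho (Suc n) d) \<noteq> 0" using G0 W0 by auto
    hence nz: "ev Y G * ev Y H * gd (Suc n) Y (drho (Suc n) d) \<noteq> 0" using H0 by simp
    have od: "[:0, 1:] ^ Q dvd p \<longleftrightarrow> p = 0 \<or> Q \<le> order 0 p" for p :: "complex poly"
      using order_divides[of 0 Q p] by simp
    have "Q \<le> order 0 (ev Y G * ev Y H * gd (Suc n) Y (drho (Suc n) d))"
      using dv nz unfolding od by blast
    also have "\<dots> = order 0 (ev Y G) + order 0 (ev Y H) + order 0 (gd (Suc n) Y (drho (Suc n) d))"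
      using nz by (simp add: order_mult)
    also have "\<dots> = order 0 (ev Y H)" using G0 W0 by (simp add: order_0I)
    finally show False using nd unfolding od by blast
  qed
  hence "degree ([:0, 1 :: complex:] ^ Q) \<le> degree (ev Y H)" using hd(2) by (intro dvd_imp_degree_le) auto
  hence "Q \<le> (c - 1) * d" using hd(1) by (simp add: degree_power_eq)
  also have "\<dots> < c * d" using c g(4) by simp
  finally show False using Qc(1) by (simp add: mult.commute)
qed

text \<open>Since H contains all pure powers, every linear factor on x_n = 0 goes to G. If H is not
  constant, the induction hypothesis makes the cofactor A constant, and H restricts to a multiple of
  h_{c-1}.\<close>

lemma ladder_core:
  assumes f: "fact_pair (Suc n) d a G H" and irr: "Irr n" and n: "n \<ge> 3" and D: "D > 0" and c: "c > 0"
    and aj: "\<And>j. 1 \<le> j \<Longrightarrow> j < n \<Longrightarrow> a j = Q + D * (n - 1 - j)" "a 0 = Q + D * (c + n - 2)"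
    and g: "D = Gcd ((\<lambda>j. a j - a (n - 1)) ` {..<n})"
    and pure: "\<And>i. i \<le> n \<Longrightarrow> ev (unitv i) H \<noteq> 0"
    and dD: "D \<noteq> d \<Longrightarrow> \<not> D dvd Q" "D = d \<Longrightarrow> D * c \<le> Q"
  shows "is_const G \<or> is_const H"
proof -
  let ?I = "(Lset n D - Lset n d) \<union> Mset n (a (n - 1) - d)"
  have n2: "n \<ge> 2" using n by simp
  have aQ: "a (n - 1) = Q" using aj(1)[of "n - 1"] n by simp
  obtain C J A B k where *: "C * S n (drho n D) = S n (\<lambda>j. a j - a (n - 1))" "J \<subseteq> ?I" "finite ?I"
    "Tz n G = A * (\<Prod>t\<in>J. lin t)" "Tz n H = B * (\<Prod>t\<in>?I - J. lin t)" "A * B = emb k * C" "k \<noteq> 0"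
    "is_const A \<or> is_const B" "Tz n G * Tz n H \<noteq> 0"
    by (rule struct_Tz[OF f irr n2, folded g]) (rule that; assumption)
  have "?I - J = {}" by (rule pure_no_lin[OF pure order_refl n *(5)]) (use *(3) in simp_all)
  note e = this
  have J: "J = ?I" using e *(2) by blast
  have B: "Tz n H = B" using *(5) unfolding e by simp
  obtain kh where kh: "homog kh H" by (rule fact_pair_hom[OF fact_pair_swap[OF f]])
  have Bc: ?thesis if cB: "is_const B"
  proof -
    obtain b where "B = emb b" using cB by (auto simp: is_const_def)
    hence "Tz n H = emb b" "b \<noteq> 0" using B *(9) by auto
    thus ?thesis using const_of_Tz[OF kh] by blast
  qed
  show ?thesis
  proof (rule ccontr)
    assume nc: "\<not> ?thesis"
    hence "is_const A" using *(8) Bc by blast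
    then obtain \<alpha> where A: "A = emb \<alpha>" by (auto simp: is_const_def)
    have \<alpha>: "\<alpha> \<noteq> 0" using *(4,9) A by auto
    define \<beta> where "\<beta> = k / \<alpha>"
    have \<beta>: "\<beta> \<noteq> 0" using \<alpha> *(7) by (simp add: \<beta>_def)
    have "emb \<alpha> * B = emb \<alpha> * (emb \<beta> * C)"
      using *(6) A \<alpha> by (simp add: \<beta>_def mult.assoc[symmetric] flip: emb_mult)
    hence BC: "Tz n H = emb \<beta> * C" using \<alpha> B by simp
    have "S n (\<lambda>j. a j - a (n - 1)) = S n (ladder c D n)"
      by (rule S_cong) (use aj aQ in \<open>simp add: ladder_def\<close>)
    hence C: "C * S n (drho n D) = S n (ladder c D n)" using *(1) by simp
    have c1: "c > 1"
    proof (rule ccontr)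
      assume "\<not> c > 1"
      hence "c = 1" using c by simp
      hence "ladder c D n = drho n D" using n by (auto simp: ladder_def drho_def)
      hence "C = 1" using C S_nonzero[OF dec_drho[OF D], of n] by simp
      hence "is_const B" using BC B by (auto simp: is_const_def)
      thus False using Bc nc by blast
    qed
    have val: "ev (\<lambda>i. if i = 2 then x else if i = 0 then z else if i = 1 then 1 else 0) H * (1 - x ^ D) ^ 2
       = \<beta> * (x ^ ((c + 1) * D) - of_nat (c + 1) * x ^ D + of_nat c)" if z: "z ^ D = 1" for x z :: complex
    proof -
      let ?y = "\<lambda>i. if i = 2 then x else if i = 0 then z else if i = 1 then 1 else 0"
      have "ev ?y H = ev ?y (Tz n H)" by (rule ev_Tz_zero[symmetric]) (use n in simp)
      hence "ev ?y H * (1 - x ^ D) ^ 2 = \<beta> * (ev ?y C * (1 - x ^ D) ^ 2)" by (simp add: BC ev_mult)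
      thus ?thesis unfolding ladder_value[OF C n D c z] .
    qed
    show False
    proof (cases "D = d")
      case False
      show False by (rule ladder_c3[OF f n D c1 \<beta> _ aj(2) dD(1)[OF False]]) (rule aj(1) val; assumption)+
    next
      case True
      define w where "w = (\<lambda>i :: nat. if i = 0 \<or> i = 1 then 1 else 0 :: complex)"
      define h where "h = ev (\<lambda>i. if i = 2 then [:0, 1:] else [:w i:]) H"
      have "poly h x = ev (\<lambda>i. if i = 2 then x else if i = 0 then 1 else if i = 1 then 1 else 0) H" for x
        unfolding h_def ahom_ev_comp[OF ahom_poly] by (intro ev_cong) (auto simp: w_def)
      hence hv: "poly h x * (1 - x ^ D) ^ 2 = \<beta> * (x ^ ((c + 1) * D) - of_nat (c + 1) * x ^ D + of_nat c)" for x
        using val[of 1 x] by simp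
      have "degree h = kh" unfolding h_def by (rule homog_pure(1)[OF kh pure]) (use n in simp)
      hence kd: "kh = (c - 1) * d" using quotient_poly_props(1)[OF hv D c \<beta>] True by simp
      have L: "?I = Mset n (Q - d)" using True aQ by simp
      have G: "Tz n G = emb \<alpha> * (\<Prod>u<n. Var u ^ (Q - d))"
        using *(4) unfolding A J L prod_Mset .
      have ge: "Q \<le> a j" if "j < n" for j using aj that by (cases "j = 0") auto
      show False
        by (rule ladder_c4[OF f n c1 \<alpha> aQ _ _ ge G kh[unfolded kd] pure[OF order_refl]])
           (use True aj dD in auto)
    qed
  qed
qed

text \<open>Reduces to \<open>ladder_core\<close>: here d' = D and d'' = d, so each index gives a
  pure power in G or H, and mixed distributions are excluded. For D = Q = d the bound on a_0 - a_1
  forces a = d rho.\<close>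

lemma ladder_case:
  assumes f: "fact_pair (Suc n) d a G H" and irr: "Irr n" and n: "n \<ge> 3" and D: "D > 0"
    and aj: "\<And>j. 1 \<le> j \<Longrightarrow> j < n \<Longrightarrow> a j = a (n - 1) + D * (n - 1 - j)"
    and P: "D dvd a 0 - a 1" "D = d \<Longrightarrow> a 0 - a 1 \<le> a (n - 1)"
  shows "is_const G \<or> is_const H"
proof -
  define Q where "Q = a (n - 1)"
  note g = fact_pairD[OF f, simplified diff_Suc_1]
  have n2: "n \<ge> 2" using n by simp
  obtain c where c: "a 0 - a 1 = D * c" using P(1) by blast
  have a10: "a 1 < a 0" using g(1) n by (auto simp: dec_def)
  have c0: "c > 0" using c a10 by (cases c) auto
  have Q0: "Q > 0" unfolding Q_def using dec_pos[OF g(1), of "n - 1"] n by simp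
  have a1: "a 1 = Q + D * (n - 2)" using aj[of 1] n by (simp add: Q_def numeral_2_eq_2)
  have "c + n - 2 = c + (n - 2)" using n by simp
  hence a0: "a 0 = Q + D * (c + n - 2)" using c a10 a1 by (simp add: distrib_left)
  have dQ: "d dvd Q" unfolding Q_def using fact_pair_dvd[OF f, of "n - 1"] by simp
  have aD: "a (n - 2) = Q + D" using aj[of "n - 2"] n by (simp add: Q_def Suc_diff_Suc numeral_2_eq_2)
  have dD: "d dvd D" using dQ fact_pair_dvd[OF f, of "n - 2"] aD by (simp add: dvd_add_right_iff)
  have ajQ: "a j = Q + D * (n - 1 - j)" if "1 \<le> j" "j < n" for j using aj[OF that] by (simp add: Q_def)
  have gD: "D = Gcd ((\<lambda>j. a j - a (n - 1)) ` {..<n})"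
  proof (rule dvd_antisym)
    show "D dvd Gcd ((\<lambda>j. a j - a (n - 1)) ` {..<n})"
    proof (intro Gcd_greatest, elim imageE)
      fix b j assume "b = a j - a (n - 1)" "j \<in> {..<n}"
      moreover have "a (n - 1) = Q" by (simp add: Q_def)
      ultimately show "D dvd b" using ajQ[of j] a0 by (cases "j = 0") auto
    qed
    have "a (n - 2) - a (n - 1) \<in> (\<lambda>j. a j - a (n - 1)) ` {..<n}" using n by (intro imageI) auto
    hence "Gcd ((\<lambda>j. a j - a (n - 1)) ` {..<n}) dvd a (n - 2) - a (n - 1)" by (rule Gcd_dvd)
    thus "Gcd ((\<lambda>j. a j - a (n - 1)) ` {..<n}) dvd D" using aD by (simp add: Q_def)
  qed
  have dn: "D = d" if "D dvd Q"
  proof (rule dvd_antisym[OF _ dD])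
    have "D dvd a j" if "j \<le> n" for j
    proof -
      consider "j = 0" | "1 \<le> j" "j < n" | "j = n" using \<open>j \<le> n\<close> by linarith
      thus ?thesis using \<open>D dvd Q\<close> a0 ajQ[of j] g(2) by cases auto
    qed
    thus "D dvd d" unfolding g(3) by (intro Gcd_greatest) auto
  qed
  have gd: "d = Gcd ((\<lambda>j. a (Suc j)) ` {..<n})"
  proof (rule dvd_antisym)
    show "d dvd Gcd ((\<lambda>j. a (Suc j)) ` {..<n})" using fact_pair_dvd[OF f] by (intro Gcd_greatest) auto
    let ?g = "Gcd ((\<lambda>j. a (Suc j)) ` {..<n})"
    have gs: "?g dvd a j" if "1 \<le> j" "j \<le> n" for j
    proof -
      have "a (Suc (j - 1)) \<in> (\<lambda>j. a (Suc j)) ` {..<n}" using that by (intro imageI) auto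
      thus ?thesis using that Gcd_dvd[of "a (Suc (j - 1))"] by simp
    qed
    have gQ: "?g dvd Q" unfolding Q_def using n by (intro gs) auto
    moreover have "?g dvd Q + D" unfolding aD[symmetric] using n by (intro gs) auto
    ultimately have "?g dvd D" by (simp add: dvd_add_right_iff)
    hence "?g dvd a 0" using gQ a0 by simp
    hence "?g dvd a j" if "j \<le> n" for j using gs[of j] that by (cases "j = 0") auto
    thus "?g dvd d" unfolding g(3) by (intro Gcd_greatest) auto
  qed
  have core: "is_const A \<or> is_const B" if "fact_pair (Suc n) d a A B" "\<forall>i\<le>n. ev (unitv i) B \<noteq> 0" for A B
    by (rule ladder_core[OF that(1) irr n D c0 ajQ a0 gD]) (use that(2) dn c P(2) in \<open>auto simp: Q_def\<close>)
  show ?thesis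
  proof (cases "D = d \<and> Q = d")
    case True
    have "D * c \<le> D * 1" using P(2) True c by (auto simp: Q_def)
    hence "c \<le> 1" using D by simp
    hence c1: "c = 1" using c0 by simp
    have "a j = drho (Suc n) d j" if jn: "j < Suc n" for j
    proof -
      consider "j = 0" | "1 \<le> j" "j < n" | "j = n" using jn by linarith
      thus ?thesis
      proof cases
        case 1
        have "1 + n - 2 = n - 1" "n = Suc (n - 1)" using n by auto
        hence "d + d * (1 + n - 2) = d * n" by (metis mult_Suc_right)
        thus ?thesis using 1 a0 True c1 by (simp add: drho_def)
      next
        case 2
        have "n - j = Suc (n - 1 - j)" using 2 by simp
        hence "d + d * (n - 1 - j) = d * (n - j)" by (metis mult_Suc_right)
        thus ?thesis using ajQ[OF 2] True by (simp add: drho_def)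
      qed (use g(2) in \<open>simp add: drho_def\<close>)
    qed
    thus ?thesis using drho_case[OF f] by blast
  next
    case nt: False
    have mix: False if ii: "i \<le> n" "i' \<le> n" "i \<noteq> i'" "ev (unitv i) H \<noteq> 0" "ev (unitv i') G \<noteq> 0" for i i'
    proof (cases "Q = d")
      case False
      hence "d < Q" using dQ Q0 dvd_imp_le[of d Q] by linarith
      \<comment> \<open>For Q > d the variable x_2 itself divides the restriction to x_n =
        0.\<close>
      hence "(2, 2, of_nat 0) \<in> (Lset n D - Lset n d) \<union> Mset n (a (n - 1) - d)"
        using n by (force simp: Mset_def Q_def)
      from mixed_pure_plane[OF f irr n gD ii this] show False by simp
    next
      case Qd: True
      hence "D \<noteq> d" using nt by simp
      hence nD: "\<not> D dvd d" "d < D" using dn Qd dD D dvd_imp_le[of d D] by auto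
      show False
      proof (cases "n = 3")
        case True
        have D2: "D < D * (c + 1)" using D c0 by simp
        show False
          by (rule mixed_pure_4[of d a G H D i i' "D * (c + 1)"])
             (use f irr gD ii a0 a1 Qd nD True D2 in \<open>simp_all add: Q_def\<close>)
      next
        case False
        obtain z :: complex where z: "\<And>k. z ^ k = 1 \<longleftrightarrow> D dvd k" by (rule primitive_root[OF D]) blast
        \<comment> \<open>For n > 3 the indices 2 and 3 both lie below n; z is a new root of unity
          since D does not divide d.\<close>
        have "(2, 3, z) \<in> (Lset n D - Lset n d) \<union> Mset n (a (n - 1) - d)"
          using n False z nD by (auto simp: Lset_def)
        from mixed_pure_plane[OF f irr n gD ii this] show False by simp
      qed
    qed
    have "(\<forall>i\<le>n. ev (unitv i) G \<noteq> 0) \<or> (\<forall>i\<le>n. ev (unitv i) H \<noteq> 0)"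
      by (rule pure_all[OF pure_alt[OF f irr n2 gd] mix]) (use n in auto)
    thus ?thesis using core[OF f] core[OF fact_pair_swap[OF f]] by blast
  qed
qed


text \<open>Duality exchanges the outer gaps a_0 - a_1 and a_{n-1}. So D may be assumed to divide
  the upper one; for D = d it divides both, and the larger gap can be placed at the bottom.\<close>

lemma fact_pair_dual_case:
  assumes f: "fact_pair (Suc n) d a G H" and irr: "Irr n" and n: "n \<ge> 3" and D: "D > 0"
    and aj: "\<And>j. 1 \<le> j \<Longrightarrow> j < n \<Longrightarrow> a j = a (n - 1) + D * (n - 1 - j)"
    and P: "D dvd a 0 - a 1 \<or> D dvd a (n - 1)"
  shows "is_const G \<or> is_const H"
proof -
  define Q where "Q = a (n - 1)"
  note g = fact_pairD[OF f, simplified diff_Suc_1]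
  have n1: "n \<ge> 1" using n by simp
  have a10: "a 1 < a 0" using g(1) n by (auto simp: dec_def)
  have a1: "a 1 = Q + D * (n - 2)" using aj[of 1] n by (simp add: Q_def numeral_2_eq_2)
  have ajQ: "a j = Q + D * (n - 1 - j)" if "1 \<le> j" "j < n" for j using aj[OF that] by (simp add: Q_def)
  have direct: ?thesis if dd: "D dvd a 0 - a 1" "D = d \<longrightarrow> a 0 - a 1 \<le> Q"
  proof (rule ladder_case[OF f irr n D _ dd(1)])
    show "a j = a (n - 1) + D * (n - 1 - j)" if "1 \<le> j" "j < n" for j by (rule aj[OF that])
    show "a 0 - a 1 \<le> a (n - 1)" if "D = d" using dd(2) that by (simp add: Q_def)
  qed
  have dualc: ?thesis if dQ: "D dvd Q" "D = d \<longrightarrow> Q \<le> a 0 - a 1"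
  proof (rule dual[OF f n1])
    fix A B assume f': "fact_pair (Suc n) d (\<lambda>j. a 0 - a (n - j)) A B"
    show "is_const A \<or> is_const B"
    proof (rule ladder_case[OF f' irr n D])
      fix j assume j: "1 \<le> j" "j < n"
      have "n - 1 - (n - j) = j - 1" using j by simp
      hence "a (n - j) = Q + D * (j - 1)" using ajQ[of "n - j"] j by simp
      moreover have "n - 2 = (j - 1) + (n - 1 - j)" using j by simp
      hence "D * (n - 2) = D * (j - 1) + D * (n - 1 - j)" by (metis distrib_left)
      moreover have "n - (n - 1) = 1" using n by simp
      ultimately show "a 0 - a (n - j) = a 0 - a (n - (n - 1)) + D * (n - 1 - j)"
        using a1 a10 by simp
    next
      have e: "n - (n - 1) = 1" using n by simp
      have z: "a 0 - a (n - 0) - (a 0 - a (n - 1)) = Q"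
      proof -
        have "Q \<le> a 0" using a1 a10 by simp
        thus ?thesis using g(2) by (simp add: Q_def)
      qed
      show "D dvd a 0 - a (n - 0) - (a 0 - a (n - 1))" unfolding z by (rule dQ(1))
      show "D = d \<Longrightarrow> a 0 - a (n - 0) - (a 0 - a (n - 1)) \<le> a 0 - a (n - (n - 1))"
        unfolding z e using dQ(2) by simp
    qed
  qed
  have "D dvd a 0 - a 1" "D dvd Q" if "D = d"
    using that fact_pair_dvd[OF f] n unfolding Q_def by (auto intro!: dvd_diff_nat)
  thus ?thesis using direct dualc P unfolding Q_def by (metis linear)
qed

section \<open>Conclusion of the induction and the theorem\<close>

lemma tight_progression:
  fixes b :: "nat \<Rightarrow> nat"
  assumes "\<And>i. i < m \<Longrightarrow> b (Suc i) < b i" "\<And>j. j \<le> m \<Longrightarrow> e dvd b j - b m"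
    and "b 0 - b m < (m + 1) * e" "j \<le> m"
  shows "b j = b m + e * (m - j)"
proof -
  have ge: "b m \<le> b i" if "i \<le> m" for i
    using that by (induction i rule: inc_induct) (auto dest: assms(1) less_imp_le_nat[OF less_le_trans] intro: order.trans less_imp_le)
  define q where "q = (\<lambda>i. (b i - b m) div e)"
  have q: "b i = b m + e * q i" if "i \<le> m" for i
    using ge[OF that] assms(2)[OF that] by (simp add: q_def)
  have e0: "e > 0" using assms(3) by (cases e) auto
  have qd: "q (Suc i) < q i" if "i < m" for i
    using assms(1)[OF that] q[of i] q[of "Suc i"] that by simp
  have low: "m - i \<le> q i" if "i \<le> m" for i
    using that
  proof (induction i rule: inc_induct)
    case (step i)
    thus ?case using qd[of i] by simp
  qed simp
  have up: "q i + i \<le> q 0" if "i \<le> m" for i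
    using that
  proof (induction i)
    case (Suc i)
    thus ?case using qd[of i] by simp
  qed simp
  \<comment> \<open>Strict decrease gives q i \<ge> m - i and q i + i \<le> q 0; with q 0 \<le> m
    the two bounds meet.\<close>
  have "e * q 0 < e * (m + 1)" using assms(3) q[of 0] by (simp add: mult.commute)
  hence "q 0 < m + 1" by (simp only: mult_less_cancel1)
  hence "q 0 \<le> m" by simp
  hence "q j = m - j" using low[OF assms(4)] up[OF assms(4)] by linarith
  thus ?thesis using q[OF assms(4)] by simp
qed

lemma Irr_Suc:
  assumes irr: "Irr n" and n: "n \<ge> 3" shows "Irr (Suc n)"
  unfolding Irr_def
proof (intro allI impI)
  fix d a G H assume f: "fact_pair (Suc n) d a G H"
  note g = fact_pairD[OF f, simplified diff_Suc_1]
  define d' where "d' = Gcd ((\<lambda>j. a j - a (n - 1)) ` {..<n})"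
  define d'' where "d'' = Gcd ((\<lambda>j. a (Suc j)) ` {..<n})"
  define N where "N = a (Suc 0) - a (n - 1)"
  have d1: "d' dvd a j - a (n - 1)" if "j < n" for j unfolding d'_def using that by (intro Gcd_dvd) auto
  have d2: "d'' dvd a j" if "1 \<le> j" "j \<le> n" for j
  proof -
    have "a (Suc (j - 1)) \<in> (\<lambda>j. a (Suc j)) ` {..<n}" using that by (intro imageI) auto
    thus ?thesis using that Gcd_dvd[of "a (Suc (j - 1))"] by (simp add: d''_def)
  qed
  have lt: "a j < a i" if "i < j" "j \<le> n" for i j using g(1) that unfolding dec_def by auto
  have "a 0 - a (n - 1) > 0" using lt[of 0 "n - 1"] n by simp
  hence d'0: "d' > 0" using d1[of 0] n by (intro gr0I) auto
  have "a 1 > 0" using lt[of 1 n] g(2) n by simp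
  hence d''0: "d'' > 0" using d2[of 1] n by (intro gr0I) auto
  define m where "m = n - 2"
  have m: "Suc m = n - 1" "m + 1 = n - 1" using n by (auto simp: m_def)
  have prog: "a j = a (n - 1) + e * (n - 1 - j)"
    if e: "\<And>j. 1 \<le> j \<Longrightarrow> j < n \<Longrightarrow> e dvd a j - a (n - 1)" "N < (n - 1) * e" and j: "1 \<le> j" "j < n" for e j
  proof -
    have "a (Suc (j - 1)) = a (Suc m) + e * (m - (j - 1))"
    proof (rule tight_progression)
      show "a (Suc (Suc i)) < a (Suc i)" if "i < m" for i using that lt[of "Suc i" "Suc (Suc i)"] m by simp
      show "e dvd a (Suc i) - a (Suc m)" if "i \<le> m" for i unfolding m(1) using that m(1) by (intro e) auto
      show "a (Suc 0) - a (Suc m) < (m + 1) * e" unfolding m using e(2) by (simp add: N_def)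
      show "j - 1 \<le> m" using j m by simp
    qed
    moreover have "m - (j - 1) = n - 1 - j" using j by (simp add: m_def)
    ultimately show ?thesis using j m by simp
  qed
  \<comment> \<open>If the bound fails for d' or d'', the exponents a_1, ..., a_{n-1} form a
    progression of that step. Moreover d' divides the upper outer gap a_0 - a_1, and d'' the lower
    one a_{n-1}.\<close>
  consider "(n - 1) * d' \<le> N" "(n - 1) * d'' \<le> N" | "N < (n - 1) * d'" | "N < (n - 1) * d''" by linarith
  thus "is_const G \<or> is_const H"
  proof cases
    case 1
    thus ?thesis by (rule general_case[OF f irr n, folded d'_def d''_def N_def, OF _ _ d'0 d''0])
  next
    case 2
    note pr = prog[OF d1 2]
    have "a (n - 1) \<le> a 1"
    proof (cases "n - 1 = 1")
      case False
      hence "1 < n - 1" using n by linarith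
      thus ?thesis using lt[of 1 "n - 1"] by simp
    qed simp
    hence e: "a 0 - a 1 = (a 0 - a (n - 1)) - (a 1 - a (n - 1))" by simp
    have "d' dvd a 0 - a 1" unfolding e using n by (intro dvd_diff_nat d1) auto
    thus ?thesis using fact_pair_dual_case[OF f irr n d'0] pr by blast
  next
    case 3
    have "d'' dvd a j - a (n - 1)" if "1 \<le> j" "j < n" for j using that n by (intro dvd_diff_nat d2) auto
    note pr = prog[OF this 3]
    have "d'' dvd a (n - 1)" using n by (intro d2) auto
    thus ?thesis using fact_pair_dual_case[OF f irr n d''0] pr by blast
  qed
qed

lemma Irr_3: "Irr 3"
  unfolding Irr_def
proof (intro allI impI)
  fix d a G H assume f: "fact_pair 3 d a G H"
  note g = fact_pair3[OF f]
  \<comment> \<open>The Newton polygon of C is spanned by the permutations of (a_0 - 2d, a_1 - d,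
    0): a hexagon, a point, or one of two triangles that duality interchanges.\<close>
  consider "a 0 - a 1 \<noteq> d" "a 1 \<noteq> d" | "a 0 - a 1 = d" "a 1 = d" | "a 1 = d" "a 0 \<noteq> 2 * d"
    | "a 0 - a 1 = d" "a 1 \<noteq> d"
    using g(1) by linarith
  thus "is_const G \<or> is_const H"
  proof cases
    case 1 thus ?thesis by (rule hexagon[OF f])
  next
    case 2
    have "a j = drho 3 d j" if "j < 3" for j
    proof -
      have "j = 0 \<or> j = 1 \<or> j = 2" using that by linarith
      thus ?thesis using 2 g(1,3) drho3 by auto
    qed
    thus ?thesis using drho_case[OF f] by blast
  next
    case 3 thus ?thesis by (rule triangle[OF f])
  next
    case 4
    have s3: "Suc 2 = 3" by simp
    show ?thesis
    proof (rule dual[of 2, unfolded s3, OF f])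
      fix A B assume f': "fact_pair 3 d (\<lambda>j. a 0 - a (2 - j)) A B"
      show "is_const A \<or> is_const B" by (rule triangle[OF f']) (use 4 g in simp_all)
    qed simp
  qed
qed

lemma Irr_all: "n \<ge> 2 \<Longrightarrow> Irr n"
proof (induction n rule: nat_induct_at_least)
  case (Suc n)
  show ?case
  proof (cases "n = 2")
    case True
    have "Suc n = 3" using True by simp
    thus ?thesis using Irr_3 by simp
  next
    case False
    thus ?thesis using Suc by (intro Irr_Suc) auto
  qed
qed (rule Irr_2)

text \<open>Degrees in the last variable determine b_0, and leading coefficients pass to the
  remaining exponents. This shows that C is not a unit.\<close>

lemma drho_of_const_multiple:
  assumes "emb c * S n (drho n d) = S n b" "dec n b" "d > 0" "n > 0" "b (n - 1) = 0" "j < n"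
  shows "b j = drho n d j"
  using assms
proof (induction n arbitrary: b j)
  case (Suc n)
  have c: "c \<noteq> 0" using Suc.prems(1) S_nonzero[OF Suc.prems(2)] by auto
  have "Theta n (S (Suc n) b) = smult (emb c) (Theta n (S (Suc n) (drho (Suc n) d)))"
    unfolding Suc.prems(1)[symmetric] by (simp add: ahom_mult[OF ahom_Theta] ahom_emb[OF ahom_Theta] emb_poly_def)
  hence "degree (Theta n (S (Suc n) b)) = degree (Theta n (S (Suc n) (drho (Suc n) d)))" using c by simp
  hence b0: "b 0 = drho (Suc n) d 0"
    unfolding Lc_S(2)[OF Suc.prems(2)] Lc_S(2)[OF dec_drho[OF Suc.prems(3)]] .
  show ?case
  proof (cases j)
    case 0 thus ?thesis using b0 by simp
  next
    case (Suc i)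
    have "Lc n (emb c) * S n (drho n d) = S n (\<lambda>j. b (Suc j))"
      by (rule Lc_step[OF Suc.prems(1-3)])
    hence e: "emb c * S n (drho n d) = S n (\<lambda>j. b (Suc j))" by (simp add: Lc_emb)
    have "b (Suc i) = drho n d i"
      by (rule Suc.IH[OF e dec_Suc[OF Suc.prems(2)] Suc.prems(3)]) (use Suc Suc.prems in auto)
    thus ?thesis using Suc by (simp add: drho_def)
  qed
qed simp

theorem theorem1p2:
  fixes r :: nat and a :: "nat \<Rightarrow> nat"
  assumes "r \<ge> 2"
    and "\<And>i j. i < j \<Longrightarrow> j < r \<Longrightarrow> a i > a j"
    and "a (r - 1) = 0"
    and "\<exists>j<r. a j \<noteq> drho r (Gcd (a ` {..<r})) j"
  shows "\<exists>C. S r a = C * S r (drho r (Gcd (a ` {..<r}))) \<and> irreducible_in r C"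
proof -
  define d where "d = Gcd (a ` {..<r})"
  have dec: "dec r a" using assms(2) by (auto simp: dec_def)
  have dvd: "d dvd a j" if "j < r" for j unfolding d_def using that by (intro Gcd_dvd) auto
  have "a 0 > 0" using dec_pos[OF dec, of 0] assms(1) by simp
  hence d0: "d > 0" using dvd[of 0] assms(1) by (intro gr0I) auto
  obtain C where C: "C * S r (drho r d) = S r a" using exists_C[OF d0, of r a] dvd by blast
  have nz: "S r a \<noteq> 0" by (rule S_nonzero[OF dec])
  hence C0: "C \<noteq> 0" using C by auto
  have vC: "vars C \<subseteq> {..<r}" using vars_factor[of C "S r (drho r d)"] nz vars_S[of r a] unfolding C by blast
  have "irreducible_in r C"
    unfolding irreducible_in_def
  proof (intro conjI allI impI)
    show "in_ring r C" using vC by (simp add: in_ring_def)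
    show "\<not> unit_in r C"
    proof
      assume "unit_in r C"
      then obtain q where "C * q = emb 1" by (auto simp: unit_in_def)
      then obtain c where "C = emb c" using emb_factor[of C q 1] by auto
      hence "a j = drho r d j" if "j < r" for j
        using drho_of_const_multiple[of c r d a j] C dec d0 assms(1,3) that by simp
      thus False using assms(4) by (auto simp: d_def)
    qed
    fix g h assume gh: "in_ring r g \<and> in_ring r h \<and> C = g * h"
    have f: "fact_pair r d a g h"
      unfolding fact_pair_def using gh C dec assms(3) d0 by (auto simp: in_ring_def d_def)
    have unit: "unit_in r P" if P: "is_const P" "P \<noteq> 0" for P
    proof -
      obtain c where c: "P = emb c" "c \<noteq> 0" using P by (auto simp: is_const_def)
      hence "P * emb (1 / c) = 1" by (simp flip: emb_mult)
      thus ?thesis unfolding unit_in_def in_ring_def by (intro exI[of _ "emb (1 / c)"]) simp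
    qed
    have "g \<noteq> 0" "h \<noteq> 0" using C0 gh by auto
    thus "unit_in r g \<or> unit_in r h" using Irr_all[OF assms(1)] f unit unfolding Irr_def by blast
  qed
  thus ?thesis using C unfolding d_def by metis
qed

end
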